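(* Let $k$ be any field, let $q\in k^\times$, and let $$\Lambda_q=\frac{k\langle x,y,z\rangle}{(x^2,\ y^2,\ z^2,\ yx+qxy,\ zy+qyz,\ xz+qzx)}.$$ Then $\Lambda_q$ is an eight-dimensional local symmetric $k$-algebra, and every finite-dimensional left $\Lambda_q$-module $M$ satisfies $$\operatorname{Ext}_{\Lambda_q}^1(M,M)=0=\operatorname{Ext}_{\Lambda_q}^2(M,M)\quad\Longrightarrow\quad M\text{ is projective}.$$ In particular, $\Lambda_q$ satisfies the Auslander--Reiten conjecture (ARC) and Tachikawa's second conjecture (TC2).
   Context: $k\langle x,y,z\rangle$ is the free associative unital $k$-algebra, and the denominator denotes the two-sided ideal generated by the listed elements. $\operatorname{Ext}$ denotes Ext of ordinary left modules. A finite-dimensional $k$-algebra $\Lambda$ is symmetric if there is a nondegenerate symmetric associative bilinear form on it, i.e. a linear form $\ell:\Lambda\to k$ with $\ell(ab)=\ell(ba)$ for all $a,b$ such that $(a,b)\mapsto \ell(ab)$ is nondegenerate. An Artin algebra $\Lambda$ satisfies ARC if every finitely generated left $\Lambda$-module $M$ with $\operatorname{Ext}_\Lambda^i(M,M\oplus \Lambda)=0$ for all $i>0$ is projective. A self-injective algebra $\Lambda$ satisfies TC2 if every finitely generated left $\Lambda$-module $M$ with $\operatorname{Ext}_\Lambda^i(M,M)=0$ for all $i>0$ is projective. *)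

theory Defs
  imports "HOL-Algebra.Algebra" "HOL-Algebra.Algebraic_Closure_Type"
    "HOL-Library.Poly_Mapping"
begin

section \<open>Modules over possibly noncommutative rings\<close>

text \<open>The locale \<^locale>\<open>module\<close> of HOL-Algebra assumes a commutative ring of scalars. As there,
  the fields \<open>mult\<close> and \<open>one\<close> of a record that represents a module are irrelevant.\<close>

locale left_module = R?: ring R + M?: abelian_group M
  for R :: "('a, 'c) ring_scheme" (structure) and M :: "('a, 'm, 'd) module_scheme" (structure) +
  assumes smult_closed [simp, intro]:
      "\<lbrakk>a \<in> carrier R; x \<in> carrier M\<rbrakk> \<Longrightarrow> a \<odot>\<^bsub>M\<^esub> x \<in> carrier M"
    and smult_l_distr:
      "\<lbrakk>a \<in> carrier R; b \<in> carrier R; x \<in> carrier M\<rbrakk> \<Longrightarrow>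
      (a \<oplus> b) \<odot>\<^bsub>M\<^esub> x = a \<odot>\<^bsub>M\<^esub> x \<oplus>\<^bsub>M\<^esub> b \<odot>\<^bsub>M\<^esub> x"
    and smult_r_distr:
      "\<lbrakk>a \<in> carrier R; x \<in> carrier M; y \<in> carrier M\<rbrakk> \<Longrightarrow>
      a \<odot>\<^bsub>M\<^esub> (x \<oplus>\<^bsub>M\<^esub> y) = a \<odot>\<^bsub>M\<^esub> x \<oplus>\<^bsub>M\<^esub> a \<odot>\<^bsub>M\<^esub> y"
    and smult_assoc:
      "\<lbrakk>a \<in> carrier R; b \<in> carrier R; x \<in> carrier M\<rbrakk> \<Longrightarrow>
      (a \<otimes> b) \<odot>\<^bsub>M\<^esub> x = a \<odot>\<^bsub>M\<^esub> (b \<odot>\<^bsub>M\<^esub> x)"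
    and smult_one [simp]:
      "x \<in> carrier M \<Longrightarrow> \<one> \<odot>\<^bsub>M\<^esub> x = x"

definition regular_module :: "('a, 'c) ring_scheme \<Rightarrow> ('a, 'a) module" where
  "regular_module R =
    \<lparr>carrier = carrier R, monoid.mult = monoid.mult R, one = one R,
     ring.zero = ring.zero R, add = add R, module.smult = monoid.mult R\<rparr>"

definition module_sum ::
    "('a, 'b, 'd) module_scheme \<Rightarrow> ('a, 'c, 'e) module_scheme \<Rightarrow> ('a, 'b \<times> 'c) module" where
  "module_sum M N =
    \<lparr>carrier = carrier M \<times> carrier N, monoid.mult = undefined, one = undefined,
     ring.zero = (\<zero>\<^bsub>M\<^esub>, \<zero>\<^bsub>N\<^esub>),
     add = (\<lambda>(x, y) (x', y'). (x \<oplus>\<^bsub>M\<^esub> x', y \<oplus>\<^bsub>N\<^esub> y')),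
     module.smult = (\<lambda>r (x, y). (r \<odot>\<^bsub>M\<^esub> x, r \<odot>\<^bsub>N\<^esub> y))\<rparr>"

definition free_module :: "('a, 'c) ring_scheme \<Rightarrow> 'x set \<Rightarrow> ('a, 'x \<Rightarrow> 'a) module" where
  "free_module R B =
    \<lparr>carrier = {f. (\<forall>x. f x \<in> carrier R) \<and> finite {x. f x \<noteq> \<zero>\<^bsub>R\<^esub>} \<and> {x. f x \<noteq> \<zero>\<^bsub>R\<^esub>} \<subseteq> B},
     monoid.mult = undefined, one = undefined,
     ring.zero = (\<lambda>_. \<zero>\<^bsub>R\<^esub>), add = (\<lambda>f g x. f x \<oplus>\<^bsub>R\<^esub> g x),
     module.smult = (\<lambda>r f x. r \<otimes>\<^bsub>R\<^esub> f x)\<rparr>"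

definition module_hom ::
    "('a, 'c) ring_scheme \<Rightarrow> ('a, 'm, 'd) module_scheme \<Rightarrow> ('a, 'n, 'e) module_scheme \<Rightarrow> ('m \<Rightarrow> 'n) set"
  where
  "module_hom R M N = {f \<in> carrier M \<rightarrow>\<^sub>E carrier N.
     (\<forall>x\<in>carrier M. \<forall>y\<in>carrier M. f (x \<oplus>\<^bsub>M\<^esub> y) = f x \<oplus>\<^bsub>N\<^esub> f y) \<and>
     (\<forall>r\<in>carrier R. \<forall>x\<in>carrier M. f (r \<odot>\<^bsub>M\<^esub> x) = r \<odot>\<^bsub>N\<^esub> f x)}"

definition finitely_generated ::
    "('a, 'c) ring_scheme \<Rightarrow> ('a, 'm, 'd) module_scheme \<Rightarrow> bool" where
  "finitely_generated R M \<longleftrightarrow>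
    (\<exists>S. finite S \<and> S \<subseteq> carrier M \<and>
      (\<forall>m\<in>carrier M. \<exists>c\<in>S \<rightarrow> carrier R. m = (\<Oplus>\<^bsub>M\<^esub>s\<in>S. c s \<odot>\<^bsub>M\<^esub> s)))"

text \<open>Projective modules are the direct summands of free modules, that is, the modules \<open>P\<close> with
  homomorphisms \<open>P \<rightarrow> F \<rightarrow> P\<close> composing to the identity for some free module \<open>F\<close>. Bases of \<open>F\<close>
  taken from the element type of \<open>P\<close> suffice, since \<open>P\<close> is a quotient of the free module on
  the set of its own elements.\<close>

definition projective :: "('a, 'c) ring_scheme \<Rightarrow> ('a, 'm, 'd) module_scheme \<Rightarrow> bool" where
  "projective R P \<longleftrightarrow> left_module R P \<and>
    (\<exists>(B :: 'm set). \<exists>i\<in>module_hom R P (free_module R B). \<exists>p\<in>module_hom R (free_module R B) P.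
      \<forall>x\<in>carrier P. p (i x) = x)"


section \<open>Ext\<close>

text \<open>Ext is the cohomology of \<open>Hom(P\<^sub>\<bullet>, N)\<close> for the following free resolution \<open>P\<^sub>\<bullet>\<close> of \<open>M\<close>,
  which exists over every ring. The basis of \<open>P\<^sub>0\<close> consists of the elements of \<open>M\<close>. The basis of
  \<open>P\<^sub>n\<^sub>+\<^sub>1\<close> consists of the formal linear combinations of basis elements of \<open>P\<^sub>n\<close> that represent
  an element of the kernel of the preceding map. Basis elements of all degrees live in one type,
  so that all \<open>P\<^sub>n\<close> do as well.\<close>

datatype ('a, 'm) cell = Elt (cell_elt: 'm) | Rel (cell_rel: "('a \<times> ('a, 'm) cell) list")

definition formal_sum :: "('a, 'c) ring_scheme \<Rightarrow> ('a \<times> 'x) list \<Rightarrow> 'x \<Rightarrow> 'a" where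
  "formal_sum R l y = foldr (\<lambda>(r, x) s. if x = y then r \<oplus>\<^bsub>R\<^esub> s else s) l \<zero>\<^bsub>R\<^esub>"

definition linear_extension ::
    "('a, 'c) ring_scheme \<Rightarrow> ('a, 'n, 'd) module_scheme \<Rightarrow> ('x \<Rightarrow> 'n) \<Rightarrow> ('x \<Rightarrow> 'a) \<Rightarrow> 'n" where
  "linear_extension R N \<phi> f = (\<Oplus>\<^bsub>N\<^esub>x\<in>{x. f x \<noteq> \<zero>\<^bsub>R\<^esub>}. f x \<odot>\<^bsub>N\<^esub> \<phi> x)"

definition res_aug ::
    "('a, 'c) ring_scheme \<Rightarrow> ('a, 'm, 'd) module_scheme \<Rightarrow> (('a, 'm) cell \<Rightarrow> 'a) \<Rightarrow> 'm" where
  "res_aug R M = linear_extension R M cell_elt"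

definition res_diff ::
    "('a, 'c) ring_scheme \<Rightarrow> (('a, 'm) cell \<Rightarrow> 'a) \<Rightarrow> (('a, 'm) cell \<Rightarrow> 'a)" where
  "res_diff R = linear_extension R (free_module R UNIV) (\<lambda>x. formal_sum R (cell_rel x))"

primrec res_basis ::
    "('a, 'c) ring_scheme \<Rightarrow> ('a, 'm, 'd) module_scheme \<Rightarrow> nat \<Rightarrow> ('a, 'm) cell set" where
  "res_basis R M 0 = Elt ` carrier M"
| "res_basis R M (Suc n) = {Rel l | l. set l \<subseteq> carrier R \<times> res_basis R M n \<and>
     (if n = 0 then res_aug R M (formal_sum R l) = \<zero>\<^bsub>M\<^esub>
      else res_diff R (formal_sum R l) = (\<lambda>_. \<zero>\<^bsub>R\<^esub>))}"

definition res_module ::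
    "('a, 'c) ring_scheme \<Rightarrow> ('a, 'm, 'd) module_scheme \<Rightarrow> nat \<Rightarrow> ('a, ('a, 'm) cell \<Rightarrow> 'a) module" where
  "res_module R M n = free_module R (res_basis R M n)"

definition hom_group ::
    "('a, 'c) ring_scheme \<Rightarrow> ('a, 'm, 'd) module_scheme \<Rightarrow> ('a, 'n, 'e) module_scheme \<Rightarrow> ('m \<Rightarrow> 'n) monoid"
  where
  "hom_group R M N =
    \<lparr>carrier = module_hom R M N,
     monoid.mult = (\<lambda>f g. \<lambda>x\<in>carrier M. f x \<oplus>\<^bsub>N\<^esub> g x),
     one = (\<lambda>x\<in>carrier M. \<zero>\<^bsub>N\<^esub>)\<rparr>"

definition ext_cochains ::
    "('a, 'c) ring_scheme \<Rightarrow> nat \<Rightarrow> ('a, 'm, 'd) module_scheme \<Rightarrow> ('a, 'n, 'e) module_scheme \<Rightarrow>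
      ((('a, 'm) cell \<Rightarrow> 'a) \<Rightarrow> 'n) monoid" where
  "ext_cochains R n M N = hom_group R (res_module R M n) N"

definition ext_coboundary ::
    "('a, 'c) ring_scheme \<Rightarrow> nat \<Rightarrow> ('a, 'm, 'd) module_scheme \<Rightarrow>
      ((('a, 'm) cell \<Rightarrow> 'a) \<Rightarrow> 'n) \<Rightarrow> ((('a, 'm) cell \<Rightarrow> 'a) \<Rightarrow> 'n)" where
  "ext_coboundary R n M g = compose (carrier (res_module R M (Suc n))) g (res_diff R)"

definition Ext ::
    "('a, 'c) ring_scheme \<Rightarrow> nat \<Rightarrow> ('a, 'm, 'd) module_scheme \<Rightarrow> ('a, 'n, 'e) module_scheme \<Rightarrow>
      ((('a, 'm) cell \<Rightarrow> 'a) \<Rightarrow> 'n) set monoid" where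
  "Ext R n M N =
    (let C = ext_cochains R n M N;
         Z = kernel C (ext_cochains R (Suc n) M N) (ext_coboundary R n M);
         B = (case n of 0 \<Rightarrow> {\<one>\<^bsub>C\<^esub>}
              | Suc m \<Rightarrow> ext_coboundary R m M ` carrier (ext_cochains R m M N))
     in C\<lparr>carrier := Z\<rparr> Mod B)"


section \<open>The conjectures\<close>

text \<open>The first argument fixes the element type of the modules; a theorem that is polymorphic
  in it covers all modules. (Up to isomorphism, finitely generated modules already occur with
  elements in \<open>(nat \<Rightarrow> 'a) set\<close>.)\<close>

definition satisfies_ARC :: "'m itself \<Rightarrow> ('a, 'c) ring_scheme \<Rightarrow> bool" where
  "satisfies_ARC T R \<longleftrightarrow>
    (\<forall>M :: ('a, 'm) module. left_module R M \<longrightarrow> finitely_generated R M \<longrightarrow>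
      (\<forall>i>0. trivial_group (Ext R i M (module_sum M (regular_module R)))) \<longrightarrow> projective R M)"

definition satisfies_TC2 :: "'m itself \<Rightarrow> ('a, 'c) ring_scheme \<Rightarrow> bool" where
  "satisfies_TC2 T R \<longleftrightarrow>
    (\<forall>M :: ('a, 'm) module. left_module R M \<longrightarrow> finitely_generated R M \<longrightarrow>
      (\<forall>i>0. trivial_group (Ext R i M M)) \<longrightarrow> projective R M)"


section \<open>Algebras over a field\<close>

locale k_algebra = vs: module "ring_of_type_algebra :: 'k::field ring" A + ring A
  for A :: "('k::field, 'a, 'c) module_scheme" (structure) +
  assumes smult_mult_left:
      "\<lbrakk>a \<in> carrier A; b \<in> carrier A\<rbrakk> \<Longrightarrow> (c \<odot> a) \<otimes> b = c \<odot> (a \<otimes> b)"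
    and smult_mult_right:
      "\<lbrakk>a \<in> carrier A; b \<in> carrier A\<rbrakk> \<Longrightarrow> a \<otimes> (c \<odot> b) = c \<odot> (a \<otimes> b)"

definition has_dimension :: "('k::field, 'v, 'c) module_scheme \<Rightarrow> nat \<Rightarrow> bool" where
  "has_dimension V n \<longleftrightarrow>
    (\<exists>B. finite B \<and> card B = n \<and> B \<subseteq> carrier V \<and>
      (\<forall>v\<in>carrier V. \<exists>!c. c \<in> B \<rightarrow>\<^sub>E UNIV \<and> v = (\<Oplus>\<^bsub>V\<^esub>b\<in>B. c b \<odot>\<^bsub>V\<^esub> b)))"

definition restrict_to_field ::
    "('k::field, 'a, 'c) module_scheme \<Rightarrow> ('a, 'm, 'd) module_scheme \<Rightarrow> ('k, 'm) module" where
  "restrict_to_field A M =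
    \<lparr>carrier = carrier M, monoid.mult = monoid.mult M, one = one M, ring.zero = ring.zero M, add = add M,
     module.smult = (\<lambda>c m. (c \<odot>\<^bsub>A\<^esub> \<one>\<^bsub>A\<^esub>) \<odot>\<^bsub>M\<^esub> m)\<rparr>"

definition finite_dimensional_module ::
    "('k::field, 'a, 'c) module_scheme \<Rightarrow> ('a, 'm, 'd) module_scheme \<Rightarrow> bool" where
  "finite_dimensional_module A M \<longleftrightarrow>
    left_module A M \<and> (\<exists>n. has_dimension (restrict_to_field A M) n)"

definition left_ideal :: "('a, 'c) ring_scheme \<Rightarrow> 'a set \<Rightarrow> bool" where
  "left_ideal R I \<longleftrightarrow> additive_subgroup I R \<and> (\<forall>r\<in>carrier R. \<forall>x\<in>I. r \<otimes>\<^bsub>R\<^esub> x \<in> I)"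

definition maximal_left_ideal :: "('a, 'c) ring_scheme \<Rightarrow> 'a set \<Rightarrow> bool" where
  "maximal_left_ideal R I \<longleftrightarrow> left_ideal R I \<and> I \<noteq> carrier R \<and>
    (\<forall>J. left_ideal R J \<longrightarrow> I \<subseteq> J \<longrightarrow> J = I \<or> J = carrier R)"

definition is_local_ring :: "('a, 'c) ring_scheme \<Rightarrow> bool" where
  "is_local_ring R \<longleftrightarrow> ring R \<and> (\<exists>!I. maximal_left_ideal R I)"

text \<open>By the symmetry of \<open>\<phi>(ab)\<close>, nondegeneracy in one argument is nondegeneracy in both.\<close>

definition symmetric_algebra :: "('k::field, 'a, 'c) module_scheme \<Rightarrow> bool" where
  "symmetric_algebra A \<longleftrightarrow> k_algebra A \<and> (\<exists>n. has_dimension A n) \<and>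
    (\<exists>\<phi> :: 'a \<Rightarrow> 'k.
      (\<forall>a\<in>carrier A. \<forall>b\<in>carrier A. \<phi> (a \<oplus>\<^bsub>A\<^esub> b) = \<phi> a + \<phi> b) \<and>
      (\<forall>c. \<forall>a\<in>carrier A. \<phi> (c \<odot>\<^bsub>A\<^esub> a) = c * \<phi> a) \<and>
      (\<forall>a\<in>carrier A. \<forall>b\<in>carrier A. \<phi> (a \<otimes>\<^bsub>A\<^esub> b) = \<phi> (b \<otimes>\<^bsub>A\<^esub> a)) \<and>
      (\<forall>a\<in>carrier A. (\<forall>b\<in>carrier A. \<phi> (a \<otimes>\<^bsub>A\<^esub> b) = 0) \<longrightarrow> a = \<zero>\<^bsub>A\<^esub>))"


section \<open>Free algebras and the algebra \<open>\<Lambda>\<^sub>q\<close>\<close>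

text \<open>The type of lists, made an (additively written) monoid under concatenation. Finitely
  supported functions on this monoid with the convolution product of
  \<^theory>\<open>HOL-Library.Poly_Mapping\<close> form the free associative algebra.\<close>

datatype 'g fword = Word "'g list"

instantiation fword :: (type) monoid_add
begin

definition zero_fword :: "'a fword" where "0 = Word []"

fun plus_fword :: "'a fword \<Rightarrow> 'a fword \<Rightarrow> 'a fword" where "Word u + Word v = Word (u @ v)"

instance
proof
  fix a b c :: "'a fword"
  show "a + b + c = a + (b + c)" by (cases a; cases b; cases c) simp
  show "0 + a = a" by (cases a) (simp add: zero_fword_def)
  show "a + 0 = a" by (cases a) (simp add: zero_fword_def)
qed

end

type_synonym ('g, 'k) free_alg = "'g fword \<Rightarrow>\<^sub>0 'k"

abbreviation scal :: "'k::field \<Rightarrow> ('g, 'k) free_alg" where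
  "scal c \<equiv> Poly_Mapping.single 0 c"

abbreviation gen :: "'g \<Rightarrow> ('g, 'k::field) free_alg" where
  "gen g \<equiv> Poly_Mapping.single (Word [g]) 1"

definition free_algebra :: "('k::field, ('g, 'k) free_alg) module" where
  "free_algebra =
    \<lparr>carrier = UNIV, monoid.mult = (*), one = 1, ring.zero = 0, add = (+),
     module.smult = (\<lambda>c p. scal c * p)\<rparr>"

definition quotient_algebra ::
    "('k, 'a, 'c) module_scheme \<Rightarrow> 'a set \<Rightarrow> ('k, 'a set) module" where
  "quotient_algebra A I =
    \<lparr>carrier = carrier (A Quot I), monoid.mult = monoid.mult (A Quot I), one = one (A Quot I),
     ring.zero = ring.zero (A Quot I), add = add (A Quot I),
     module.smult = (\<lambda>c S. \<Union>a\<in>S. I +>\<^bsub>A\<^esub> (c \<odot>\<^bsub>A\<^esub> a))\<rparr>"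

datatype xyz = Gx | Gy | Gz

definition qext_relations :: "'k::field \<Rightarrow> (xyz, 'k) free_alg set" where
  "qext_relations q =
    (let x = gen Gx; y = gen Gy; z = gen Gz in
     {x * x, y * y, z * z, y * x + scal q * (x * y), z * y + scal q * (y * z), x * z + scal q * (z * x)})"

definition qext_algebra :: "'k::field \<Rightarrow> ('k, (xyz, 'k) free_alg set) module" where
  "qext_algebra q =
    quotient_algebra free_algebra (Idl\<^bsub>free_algebra\<^esub> (qext_relations q))"

end

theory Submission
  imports Defs "HOL-Computational_Algebra.Polynomial_FPS" "Jordan_Normal_Form.Determinant"
begin

text \<open>The generators of the algebra satisfy \<open>x\<^sub>a x\<^sub>b = s\<^sub>a\<^sub>b x\<^sub>b x\<^sub>a\<close> and \<open>x\<^sub>a\<^sup>2 = 0\<close>, where \<open>s\<^sub>a\<^sub>b s\<^sub>b\<^sub>a = 1\<close>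
  and \<open>s\<^sub>a\<^sub>a = -1\<close>. A module \<open>M\<close> with \<open>Ext\<^sup>1(M, M) = 0\<close> turns out to be projective, and the
  reason is that it carries contractions: linear operators \<open>T\<^sub>a\<close> with
  \<open>T\<^sub>a x\<^sub>b = s\<^sub>b\<^sub>a x\<^sub>b T\<^sub>a + \<delta>\<^sub>a\<^sub>b\<close>.

  Contractions give projectivity. Put \<open>\<theta> = T\<^sub>z T\<^sub>y T\<^sub>x\<close>, and let \<open>e\<close> run through the eight monomials
  and \<open>e\<^sup>*\<close> through the dual basis for the symmetrising form "coefficient of \<open>xyz\<close>". Contracting the
  generators one after the other shows \<open>\<Sum> e \<theta> e\<^sup>* = 1\<close> (\<open>partition_of_unity\<close>). Because
  \<open>\<Sum> e \<otimes> e\<^sup>*\<close> is a Casimir element, \<open>w \<mapsto> \<Sum> e \<otimes> \<theta>(e\<^sup>* w)\<close> is a linear section of the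
  multiplication map from \<open>\<Lambda> \<otimes>\<^sub>k M\<close> to \<open>M\<close> (\<open>projective_of_partition\<close>).

  Contractions come from rigidity. The obstruction to the existence of \<open>T\<^sub>a\<close> is a class in
  \<open>Ext\<^sup>1(M, M')\<close>, where \<open>M'\<close> is the twist of \<open>M\<close> by the automorphism that rescales each \<open>x\<^sub>b\<close> by
  \<open>s\<^sub>b\<^sub>a\<close>. So one has to compare \<open>M\<close> with its twists under the torus that rescales the
  generators. The deformation of \<open>M\<close> that replaces \<open>x\<^sub>a\<close> by \<open>(1 + t) x\<^sub>a\<close> is trivial over the power
  series ring, since the obstructions at each order lie in \<open>Ext\<^sup>1(M, M) = 0\<close>
  (\<open>deformation_series\<close>). The trivialisation solves a linear system over \<open>k[t]\<close>, and such a system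
  has a polynomial solution with the same value at \<open>t = 0\<close> (\<open>fps_solution_to_poly_solution\<close>); this
  gives a matrix \<open>P(t)\<close> of nonzero determinant that intertwines \<open>x\<^sub>a\<close> with \<open>(1 + t) x\<^sub>a\<close>. For a
  constant \<open>c\<close>, the product of \<open>P(ct + c - 1)\<close> with the adjugate of \<open>P(t)\<close> intertwines \<open>x\<^sub>a\<close> with
  \<open>c x\<^sub>a\<close>. Hence, for every torus twist, there are polynomial families of homomorphisms from
  \<open>M\<close> to the twist and back whose composition is a nonzero polynomial \<open>D(t)\<close> (\<open>twistable\<close>). No
  point of the field is substituted for \<open>t\<close>, so this also works over finite fields. The cocycle
  equation for \<open>T\<^sub>a\<close> can now be solved up to the factor \<open>D(t)\<close>, and comparing a coefficient at which
  \<open>D\<close> does not vanish gives \<open>T\<^sub>a\<close> (\<open>contraction_exists\<close>).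

  The link with \<open>Ext\<close> is that every short exact sequence with vanishing \<open>Ext\<^sup>1\<close> splits
  (\<open>ext1_splits\<close>); it is applied to extensions of \<open>M\<close> by itself that are written down as operators on
  \<open>M \<times> M\<close> (\<open>skew_operator_cobounds\<close>). The structure of the algebra itself follows from an explicit
  multiplication on \<open>k\<^sup>8\<close>, on which the free algebra acts so that the relations act as zero.\<close>

hide_const (open) UnivPoly.coeff UnivPoly.monom

section \<open>Power series solutions of polynomial linear systems\<close>

text \<open>Power series have no \<open>t\<close>-torsion, so a relation whose coefficients all vanish at \<open>0\<close> can be
  divided by \<open>t\<close>; the degree of the nonzero coefficient \<open>c j1\<close> bounds how often.\<close>

lemma relation_nonzero_at_0:
  fixes v :: "'j \<Rightarrow> 'k::field fps" and c :: "'j \<Rightarrow> 'k poly"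
  assumes "finite J" "j1 \<in> J" "c j1 \<noteq> 0" "(\<Sum>j\<in>J. fps_of_poly (c j) * v j) = 0"
  shows "\<exists>c'. (\<Sum>j\<in>J. fps_of_poly (c' j) * v j) = 0 \<and> (\<exists>j\<in>J. coeff (c' j) 0 \<noteq> 0)"
  using assms(3,4)
proof (induction "degree (c j1)" arbitrary: c rule: less_induct)
  case less
  show ?case
  proof (cases "\<exists>j\<in>J. coeff (c j) 0 \<noteq> 0")
    case False
    define c' where "c' j = (if j \<in> J then c j div [:0,1:] else 0)" for j
    have c: "c j = [:0,1:] * c' j" if "j \<in> J" for j
    proof -
      have "[:0,1:] dvd c j" using False that poly_eq_0_iff_dvd[of "c j" 0] by (simp add: poly_0_coeff_0)
      then show ?thesis using that by (simp only: c'_def if_True dvd_mult_div_cancel)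
    qed
    have "fps_X * (\<Sum>j\<in>J. fps_of_poly (c' j) * v j) = (\<Sum>j\<in>J. fps_of_poly (c j) * v j)"
      unfolding sum_distrib_left
    proof (rule sum.cong)
      fix j assume "j \<in> J"
      then have "fps_of_poly (c j) = fps_X * fps_of_poly (c' j)"
        by (subst c) (simp_all add: fps_of_poly_mult fps_of_poly_pCons)
      then show "fps_X * (fps_of_poly (c' j) * v j) = fps_of_poly (c j) * v j" by (simp add: mult.assoc)
    qed simp
    then have s: "(\<Sum>j\<in>J. fps_of_poly (c' j) * v j) = 0" using less.prems(2) by simp
    have nz: "c' j1 \<noteq> 0" using c[OF assms(2)] less.prems(1) by auto
    then have "degree (c j1) = Suc (degree (c' j1))"
      by (subst c[OF assms(2)]) (simp add: degree_mult_eq)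
    then show ?thesis using less.hyps[OF _ nz s] by simp
  qed (use less.prems in blast)
qed

text \<open>This is the flatness of power series over polynomials, in elementary form: \<open>w\<close> satisfies every
  linear equation with polynomial coefficients that \<open>v\<close> satisfies. If \<open>v\<close> satisfies no nontrivial
  one, the constants \<open>v j (0)\<close> do. Otherwise some relation has a coefficient that does not vanish at \<open>0\<close>. It
  expresses the corresponding entry by the others with a denominator that is invertible at
  \<open>0\<close>, and multiplying by this denominator keeps the values at \<open>0\<close> up to a common constant.\<close>

lemma fps_solution_to_poly_solution:
  fixes v :: "'j \<Rightarrow> 'k::field fps"
  assumes "finite J"
  shows "\<exists>w :: 'j \<Rightarrow> 'k poly. (\<forall>j\<in>J. coeff (w j) 0 = fps_nth (v j) 0) \<and>
    (\<forall>c. (\<Sum>j\<in>J. fps_of_poly (c j) * v j) = 0 \<longrightarrow> (\<Sum>j\<in>J. c j * w j) = 0)"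
  using assms
proof (induction "card J" arbitrary: J)
  case 0
  then show ?case by simp
next
  case (Suc n)
  show ?case
  proof (cases "\<exists>c. (\<Sum>j\<in>J. fps_of_poly (c j) * v j) = 0 \<and> (\<exists>j\<in>J. c j \<noteq> 0)")
    case False
    then show ?thesis
      by (intro exI[of _ "\<lambda>j. [:fps_nth (v j) 0:]"]) (auto intro!: sum.neutral)
  next
    case True
    then obtain b j1 where b: "(\<Sum>j\<in>J. fps_of_poly (b j) * v j) = 0" "j1 \<in> J" "b j1 \<noteq> 0" by blast
    obtain c j0 where c: "(\<Sum>j\<in>J. fps_of_poly (c j) * v j) = 0" and j0: "j0 \<in> J" "coeff (c j0) 0 \<noteq> 0"
      using relation_nonzero_at_0[OF Suc.prems b(2,3,1)] by blast
    define J' where "J' = J - {j0}"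
    have J': "finite J'" "n = card J'" using Suc j0 by (auto simp: J'_def)
    have split: "(\<Sum>j\<in>J. f j) = f j0 + (\<Sum>j\<in>J'. f j)" for f :: "'j \<Rightarrow> 'x::ab_group_add"
      using Suc.prems j0 by (simp add: J'_def sum.remove)
    obtain w where w0: "\<And>j. j \<in> J' \<Longrightarrow> coeff (w j) 0 = fps_nth (v j) 0"
      and w: "\<And>e. (\<Sum>j\<in>J'. fps_of_poly (e j) * v j) = 0 \<Longrightarrow> (\<Sum>j\<in>J'. e j * w j) = 0"
      using Suc.hyps(1)[OF J'(2,1)] by blast
    define w' where "w' j = smult (inverse (coeff (c j0) 0)) (if j = j0 then - (\<Sum>i\<in>J'. c i * w i) else c j0 * w j)" for j
    have cv: "fps_of_poly (c j0) * v j0 = - (\<Sum>j\<in>J'. fps_of_poly (c j) * v j)"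
      using c[unfolded split] by (simp only: eq_neg_iff_add_eq_0)
    have "coeff (w' j0) 0 = fps_nth (v j0) 0"
    proof -
      have "fps_nth (fps_of_poly (c j0) * v j0) 0 = fps_nth (- (\<Sum>j\<in>J'. fps_of_poly (c j) * v j)) 0"
        using cv by simp
      then have "coeff (c j0) 0 * fps_nth (v j0) 0 = - (\<Sum>j\<in>J'. coeff (c j) 0 * fps_nth (v j) 0)"
        by (simp add: fps_sum_nth)
      then show ?thesis using j0 w0 by (simp add: w'_def coeff_sum coeff_mult field_simps)
    qed
    moreover have "coeff (w' j) 0 = fps_nth (v j) 0" if "j \<in> J'" for j
      using that w0 j0 by (simp add: w'_def J'_def coeff_mult)
    ultimately have "\<forall>j\<in>J. coeff (w' j) 0 = fps_nth (v j) 0" by (auto simp: J'_def)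
    moreover have "(\<Sum>j\<in>J. e j * w' j) = 0" if e: "(\<Sum>j\<in>J. fps_of_poly (e j) * v j) = 0" for e
    proof -
      have ev: "fps_of_poly (e j0) * v j0 = - (\<Sum>j\<in>J'. fps_of_poly (e j) * v j)"
        using e[unfolded split] by (simp only: eq_neg_iff_add_eq_0)
      have "fps_of_poly (c j0) * (fps_of_poly (e j0) * v j0) = fps_of_poly (e j0) * (fps_of_poly (c j0) * v j0)"
        by (simp add: algebra_simps)
      then have "(\<Sum>j\<in>J'. fps_of_poly (c j0 * e j - e j0 * c j) * v j) = 0"
        unfolding ev cv
        by (simp add: fps_of_poly_mult fps_of_poly_diff algebra_simps sum_subtractf sum_distrib_left)
      from w[OF this] have "(\<Sum>j\<in>J'. e j * (c j0 * w j)) = e j0 * (\<Sum>i\<in>J'. c i * w i)"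
        by (simp add: algebra_simps sum_subtractf sum_distrib_left)
      moreover have "(\<Sum>j\<in>J'. e j * w' j) = smult (inverse (coeff (c j0) 0)) (\<Sum>j\<in>J'. e j * (c j0 * w j))"
      proof -
        have sm: "smult a (\<Sum>j\<in>J'. p j) = (\<Sum>j\<in>J'. smult a (p j))" for a and p :: "'j \<Rightarrow> 'k poly"
          by (induction J' rule: infinite_finite_induct) (simp_all add: smult_add_right)
        show ?thesis unfolding sm by (rule sum.cong) (auto simp: w'_def J'_def)
      qed
      ultimately show ?thesis unfolding split by (simp add: w'_def)
    qed
    ultimately show ?thesis by blast
  qed
qed

section \<open>Square matrices with polynomial entries\<close>

lemma mult_mat_entry:
  assumes "A \<in> carrier_mat n n" "B \<in> carrier_mat n n" "i < n" "j < n"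
  shows "(A * B) $$ (i, j) = (\<Sum>l<n. A $$ (i, l) * B $$ (l, j))"
  using assms by (simp add: scalar_prod_def atLeast0LessThan)

abbreviation const_mat :: "'k::comm_ring_1 mat \<Rightarrow> 'k poly mat" where
  "const_mat A \<equiv> map_mat (\<lambda>a. [:a:]) A"

abbreviation coeff_mat :: "nat \<Rightarrow> 'k::comm_ring_1 poly mat \<Rightarrow> 'k mat" where
  "coeff_mat k A \<equiv> map_mat (\<lambda>p. coeff p k) A"

lemma coeff_mat_mult_const:
  assumes "A \<in> carrier_mat n n" "B \<in> carrier_mat n n"
  shows "coeff_mat k (A * const_mat B) = coeff_mat k A * B"
    and "coeff_mat k (const_mat B * A) = B * coeff_mat k A"
  using assms
  by (intro eq_matI; simp add: scalar_prod_def coeff_sum mult.commute[of _ "[:_:]"] mult.commute)+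

lemma coeff_mat_eqI:
  assumes "A \<in> carrier_mat n n" "B \<in> carrier_mat n n" "\<And>k. coeff_mat k A = coeff_mat k B"
  shows "A = B"
proof (rule eq_matI)
  fix i j assume ij: "i < dim_row B" "j < dim_col B"
  show "A $$ (i, j) = B $$ (i, j)"
  proof (rule poly_eqI)
    fix k
    have "coeff_mat k A $$ (i, j) = coeff_mat k B $$ (i, j)" by (simp add: assms)
    then show "coeff (A $$ (i, j)) k = coeff (B $$ (i, j)) k" using ij assms(1,2) by auto
  qed
qed (use assms in auto)

lemma poly_mat_of_coeffs:
  assumes "\<And>k. P k \<in> carrier_mat n n" "\<And>k. N < k \<Longrightarrow> P k = 0\<^sub>m n n"
  shows "\<exists>A\<in>carrier_mat n n. \<forall>k. coeff_mat k A = P k"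
proof (intro bexI allI)
  define A where "A = mat n n (\<lambda>(i, j). \<Sum>k\<le>N. Polynomial.monom (P k $$ (i, j)) k)"
  show "A \<in> carrier_mat n n" by (simp add: A_def)
  show "coeff_mat k A = P k" for k
    using assms(1)[of k] assms(2)[of k]
    by (intro eq_matI) (auto simp: A_def coeff_sum if_distrib sum.delta cong: if_cong)
qed

lemma coeff_mat_bounded:
  assumes "A \<in> carrier_mat n n"
  shows "\<exists>N. \<forall>k>N. coeff_mat k A = 0\<^sub>m n n"
proof (intro exI allI impI)
  define N where "N = (\<Sum>(i, j)\<in>{..<n}\<times>{..<n}. degree (A $$ (i, j)))"
  fix k assume k: "N < k"
  show "coeff_mat k A = 0\<^sub>m n n"
  proof (rule eq_matI)
    fix i j assume ij: "i < dim_row (0\<^sub>m n n :: 'a mat)" "j < dim_col (0\<^sub>m n n :: 'a mat)"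
    have "degree (A $$ (i, j)) \<le> N"
      unfolding N_def using ij
      by (intro order.trans[OF _ member_le_sum[where i="(i,j)"]]) auto
    then show "coeff_mat k A $$ (i, j) = 0\<^sub>m n n $$ (i, j)" using k ij assms by (simp add: coeff_eq_0)
  qed (use assms in auto)
qed

lemmas square_mat_simps =
  mult_carrier_mat[of _ n n _ n for n] smult_carrier_mat[of _ n n for n] add_carrier_mat[of _ n n for n]
  one_carrier_mat[of n for n] zero_carrier_mat[of n n for n]
  assoc_mult_mat[of _ n n _ n _ n for n]
  mult_smult_assoc_mat[of _ n n _ n for n] mult_smult_distrib[of _ n n _ n for n]
  mult_add_distrib_mat[of _ n n _ n for n] add_mult_distrib_mat[of _ n n _ _ n for n]
  left_mult_one_mat[of _ n n for n] right_mult_one_mat[of _ n n for n]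
  left_mult_zero_mat[of _ n n n for n] right_mult_zero_mat[of _ n n n for n]
  left_add_zero_mat[of _ n n for n] right_add_zero_mat[of _ n n for n]

lemma smult_mat_cancel:
  fixes A :: "'r::idom mat"
  assumes "p \<cdot>\<^sub>m A = p \<cdot>\<^sub>m B" "p \<noteq> 0"
  shows "A = B"
proof (rule eq_matI)
  have d: "dim_row A = dim_row B" "dim_col A = dim_col B"
    using arg_cong[OF assms(1), of dim_row] arg_cong[OF assms(1), of dim_col] by auto
  then show "dim_row A = dim_row B" "dim_col A = dim_col B" by auto
  fix i j assume "i < dim_row B" "j < dim_col B"
  then show "A $$ (i, j) = B $$ (i, j)"
    using arg_cong[OF assms(1), of "\<lambda>M. M $$ (i, j)"] d assms(2) by simp
qed

lemma one_smult_mat: "1 \<cdot>\<^sub>m A = (A :: 'r::comm_ring_1 mat)"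
  by (rule eq_matI) auto

lemma zero_smult_mat: "0 \<cdot>\<^sub>m (1\<^sub>m n :: 'r::comm_ring_1 mat) = 0\<^sub>m n n"
  by (rule eq_matI) auto

lemma smult_smult_mat: "p \<cdot>\<^sub>m (r \<cdot>\<^sub>m A) = (p * r) \<cdot>\<^sub>m (A :: 'r::comm_ring_1 mat)"
  by (rule eq_matI) (auto simp: mult.assoc)

lemma map_mat_pcompose_mult:
  assumes "A \<in> carrier_mat n n" "B \<in> carrier_mat n n"
  shows "map_mat (\<lambda>p. pcompose p r) (A * B) = map_mat (\<lambda>p. pcompose p r) A * map_mat (\<lambda>p. pcompose p r) B"
  using assms by (intro eq_matI) (auto simp: scalar_prod_def pcompose_sum pcompose_mult)

lemma map_mat_pcompose_smult:
  "map_mat (\<lambda>p. pcompose p r) (s \<cdot>\<^sub>m A) = pcompose s r \<cdot>\<^sub>m map_mat (\<lambda>p. pcompose p r) A"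
  by (intro eq_matI) (auto simp: pcompose_mult)

section \<open>Rigid families of skew-commuting matrices\<close>

text \<open>The entries of a commutation relation between \<open>V\<close> and given matrices are linear forms in the entries
  of \<open>V\<close>; this is the form in which \<open>fps_solution_to_poly_solution\<close> is applied to them.\<close>

lemma sum_row_column:
  fixes V :: "nat \<times> nat \<Rightarrow> 'r::comm_ring_1"
  assumes "i < n" "j < n"
  shows "(\<Sum>p\<in>{..<n}\<times>{..<n}. ((if fst p = i then A (snd p) else 0) - (if snd p = j then B (fst p) else 0)) * V p)
    = (\<Sum>l<n. V (i, l) * A l) - (\<Sum>l<n. B l * V (l, j))"
proof -
  have "(\<Sum>p\<in>{..<n}\<times>{..<n}. (if fst p = i then A (snd p) else 0) * V p) =
      (\<Sum>k<n. \<Sum>l<n. if k = i then V (i, l) * A l else 0)"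
    unfolding sum.cartesian_product by (rule sum.cong) auto
  also have "\<dots> = (\<Sum>l<n. V (i, l) * A l)"
    by (subst sum.swap) (use assms in simp)
  finally have 1: "(\<Sum>p\<in>{..<n}\<times>{..<n}. (if fst p = i then A (snd p) else 0) * V p) = \<dots>" .
  have "(\<Sum>p\<in>{..<n}\<times>{..<n}. (if snd p = j then B (fst p) else 0) * V p) =
      (\<Sum>k<n. \<Sum>l<n. if l = j then B k * V (k, j) else 0)"
    unfolding sum.cartesian_product by (rule sum.cong) auto
  also have "\<dots> = (\<Sum>l<n. B l * V (l, j))" using assms by simp
  finally show ?thesis by (simp add: left_diff_distrib sum_subtractf 1)
qed

text \<open>The matrices \<open>\<xi> b\<close> describe the generators on a module. An assignment of \<open>A\<close> to one generator
  \<open>a\<close>, and of \<open>0\<close> to all others, is a 1-cocycle exactly if \<open>A\<close> commutes with the generators in the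
  same way as \<open>\<xi> a\<close>; the assumption \<open>rigid\<close> says that all these cocycles are coboundaries.\<close>

locale rigid_skew_system =
  fixes n :: nat and \<xi> :: "'g \<Rightarrow> 'k::field mat" and s :: "'g \<Rightarrow> 'g \<Rightarrow> 'k"
  assumes gens [simp]: "\<xi> b \<in> carrier_mat n n"
    and skew: "\<xi> a * \<xi> b = s a b \<cdot>\<^sub>m (\<xi> b * \<xi> a)"
    and square: "\<xi> a * \<xi> a = 0\<^sub>m n n"
    and s_diag: "s a a = -1"
    and s_nz: "s a b \<noteq> 0"
    and rigid: "A \<in> carrier_mat n n \<Longrightarrow> (\<And>b. A * \<xi> b = s a b \<cdot>\<^sub>m (\<xi> b * A)) \<Longrightarrow>
      \<exists>S\<in>carrier_mat n n. \<forall>b. S * \<xi> b = \<xi> b * S + (if b = a then A else 0\<^sub>m n n)"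
begin

abbreviation \<Xi> :: "'g \<Rightarrow> 'k poly mat" where
  "\<Xi> b \<equiv> const_mat (\<xi> b)"

lemma const_gens [simp]: "\<Xi> b \<in> carrier_mat n n" by simp

lemma dim_gens [simp]: "dim_row (\<xi> b) = n" "dim_col (\<xi> b) = n"
  by (rule carrier_matD[OF gens])+

text \<open>The coefficients of a formal isomorphism between the module and its deformation by
  \<open>\<xi> a \<mapsto> (1 + t) \<xi> a\<close>. At each order the obstruction is \<open>\<xi> a * P i\<close>. It is a cocycle: \<open>P i\<close> commutes with
  the other generators, and \<open>\<xi> a * P i * \<xi> a\<close> vanishes because \<open>P i\<close> moves past \<open>\<xi> a\<close> up to terms that
  begin with \<open>\<xi> a\<close>.\<close>

lemma deformation_series:
  "\<exists>P. P 0 = 1\<^sub>m n \<and> (\<forall>i. P i \<in> carrier_mat n n \<and>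
    (\<forall>b. P (Suc i) * \<xi> b = \<xi> b * P (Suc i) + (if b = a then \<xi> a * P i else 0\<^sub>m n n)))"
proof -
  define good where "good i P \<longleftrightarrow> P \<in> carrier_mat n n \<and> (i = (0::nat) \<longrightarrow> P = 1\<^sub>m n) \<and>
    \<xi> a * (P * \<xi> a) = 0\<^sub>m n n \<and> (\<forall>b. b \<noteq> a \<longrightarrow> P * \<xi> b = \<xi> b * P)" for i P
  have "\<exists>P. \<forall>i. good i (P i) \<and> (\<forall>b. P (Suc i) * \<xi> b = \<xi> b * P (Suc i) + (if b = a then \<xi> a * P i else 0\<^sub>m n n))"
  proof (rule dependent_nat_choice)
    show "\<exists>P. good 0 P" by (rule exI[of _ "1\<^sub>m n"]) (auto simp: good_def square left_mult_one_mat[of _ n n] right_mult_one_mat[of _ n n])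
  next
    fix P i assume g: "good i P"
    then have P [simp]: "P \<in> carrier_mat n n" by (simp add: good_def)
    have XXP: "\<xi> b * (\<xi> b * Q) = 0\<^sub>m n n" if "Q \<in> carrier_mat n n" for b Q
      using assoc_mult_mat[of "\<xi> b" n n "\<xi> b" n Q n] that by (simp add: square)
    have "(\<xi> a * P) * \<xi> b = s a b \<cdot>\<^sub>m (\<xi> b * (\<xi> a * P))" for b
    proof (cases "b = a")
      case True
      then show ?thesis using g by (simp add: square_mat_simps[where n=n] good_def XXP)
    next
      case False
      then have "(\<xi> a * P) * \<xi> b = (\<xi> a * \<xi> b) * P"
        using g by (simp add: square_mat_simps[where n=n] good_def)
      also have "\<dots> = s a b \<cdot>\<^sub>m (\<xi> b * (\<xi> a * P))"
        unfolding skew[of a b] by (simp add: square_mat_simps[where n=n])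
      finally show ?thesis .
    qed
    from rigid[of "\<xi> a * P" a, OF _ this] obtain S where S [simp]: "S \<in> carrier_mat n n"
      and eq: "\<And>b. S * \<xi> b = \<xi> b * S + (if b = a then \<xi> a * P else 0\<^sub>m n n)"
      by (auto simp: square_mat_simps[where n=n])
    have "good (Suc i) S"
      unfolding good_def
      using eq by (auto simp: square_mat_simps[where n=n] XXP)
    with eq show "\<exists>S. good (Suc i) S \<and> (\<forall>b. S * \<xi> b = \<xi> b * S + (if b = a then \<xi> a * P else 0\<^sub>m n n))" by blast
  qed
  then show ?thesis by (auto simp: good_def)
qed


text \<open>The value \<open>1\<close> at \<open>t = 0\<close>, kept in the passage from power series to polynomials, is what makes the
  determinant of \<open>P\<close> nonzero.\<close>

lemma deformation_poly:
  "\<exists>P\<in>carrier_mat n n. coeff_mat 0 P = 1\<^sub>m n \<and>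
    (\<forall>b. P * \<Xi> b = (if b = a then [:1, 1:] else 1) \<cdot>\<^sub>m (\<Xi> b * P))"
proof -
  obtain P where P0: "P 0 = 1\<^sub>m n" and P [simp]: "\<And>i. P i \<in> carrier_mat n n"
    and PS: "\<And>i b. P (Suc i) * \<xi> b = \<xi> b * P (Suc i) + (if b = a then \<xi> a * P i else 0\<^sub>m n n)"
    using deformation_series[of a] by blast
  define J where "J = {..<n} \<times> {..<n}"
  define v where "v p = Abs_fps (\<lambda>k. P k $$ p)" for p
  have finJ: "finite J" by (simp add: J_def)
  define \<mu> :: "'g \<Rightarrow> 'k poly" where "\<mu> b = (if b = a then [:1, 1:] else 1)" for b
  obtain w where w0: "\<And>p. p \<in> J \<Longrightarrow> coeff (w p) 0 = fps_nth (v p) 0"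
    and w: "\<And>c. (\<Sum>j\<in>J. fps_of_poly (c j) * v j) = 0 \<Longrightarrow> (\<Sum>j\<in>J. c j * w j) = 0"
    using fps_solution_to_poly_solution[OF finJ, of v] by blast
  define W where "W = mat n n w"
  have W [simp]: "W \<in> carrier_mat n n" "dim_row W = n" "dim_col W = n" by (simp_all add: W_def)
  have "coeff_mat 0 W = 1\<^sub>m n"
    by (rule eq_matI) (auto simp: W_def w0 J_def v_def P0)
  moreover have "W * \<Xi> b = \<mu> b \<cdot>\<^sub>m (\<Xi> b * W)" for b
  proof (rule eq_matI)
    fix i j assume "i < dim_row (\<mu> b \<cdot>\<^sub>m (\<Xi> b * W))" "j < dim_col (\<mu> b \<cdot>\<^sub>m (\<Xi> b * W))"
    then have ij: "i < n" "j < n" using W gens[of b] by auto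
    define c where "c p = (if fst p = i then [:\<xi> b $$ (snd p, j):] else 0) -
      (if snd p = j then \<mu> b * [:\<xi> b $$ (i, fst p):] else 0)" for p
    have fc: "fps_of_poly (c p) = (if fst p = i then fps_const (\<xi> b $$ (snd p, j)) else 0) -
      (if snd p = j then fps_of_poly (\<mu> b) * fps_const (\<xi> b $$ (i, fst p)) else 0)" for p
      unfolding c_def by (simp add: fps_of_poly_diff fps_of_poly_mult fps_of_poly_const del: mult_pCons_right mult_pCons_left)
    have "(\<Sum>l<n. v (i, l) * fps_const (\<xi> b $$ (l, j))) =
      (\<Sum>l<n. (fps_of_poly (\<mu> b) * fps_const (\<xi> b $$ (i, l))) * v (l, j))" (is "?L = ?R")
    proof (rule fps_ext)
      fix k
      have L: "fps_nth ?L k = (P k * \<xi> b) $$ (i, j)" for k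
        using ij by (simp add: fps_sum_nth v_def mult_mat_entry[where n=n])
      have R0: "fps_nth (\<Sum>l<n. fps_const (\<xi> b $$ (i, l)) * v (l, j)) k = (\<xi> b * P k) $$ (i, j)" for k b
        using ij by (simp add: fps_sum_nth v_def mult_mat_entry[where n=n])
      have "?R = fps_of_poly (\<mu> b) * (\<Sum>l<n. fps_const (\<xi> b $$ (i, l)) * v (l, j))"
        by (simp add: sum_distrib_left mult.assoc)
      also have "\<dots> = (1 + (if b = a then fps_X else 0)) * (\<Sum>l<n. fps_const (\<xi> b $$ (i, l)) * v (l, j))"
        by (simp add: \<mu>_def fps_of_poly_pCons)
      finally have R: "fps_nth ?R k = (\<xi> b * P k) $$ (i, j) + (if b = a \<and> k > 0 then (\<xi> a * P (k - 1)) $$ (i, j) else 0)"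
        by (simp add: distrib_right R0 del: index_mult_mat(1))
      show "fps_nth ?L k = fps_nth ?R k"
      proof (cases k)
        case 0
        then show ?thesis unfolding L R by (simp add: P0 square_mat_simps[where n=n])
      next
        case (Suc m)
        have "(P (Suc m) * \<xi> b) $$ (i, j) = (\<xi> b * P (Suc m)) $$ (i, j) + (if b = a then (\<xi> a * P m) $$ (i, j) else 0)"
          unfolding PS using ij by (simp add: carrier_matD[OF P] del: index_mult_mat(1))
        then show ?thesis unfolding L R by (simp add: Suc del: index_mult_mat(1))
      qed
    qed
    then have "(\<Sum>p\<in>J. fps_of_poly (c p) * v p) = 0"
      unfolding fc J_def
      by (subst sum_row_column[OF ij, of "\<lambda>l. fps_const (\<xi> b $$ (l, j))"]) simp
    from w[OF this] have "(\<Sum>l<n. w (i, l) * [:\<xi> b $$ (l, j):]) = (\<Sum>l<n. (\<mu> b * [:\<xi> b $$ (i, l):]) * w (l, j))"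
      unfolding c_def J_def
      by (subst (asm) sum_row_column[OF ij, of "\<lambda>l. [:\<xi> b $$ (l, j):]"]) (simp only: right_minus_eq)
    then show "(W * \<Xi> b) $$ (i, j) = (\<mu> b \<cdot>\<^sub>m (\<Xi> b * W)) $$ (i, j)"
      using ij by (simp add: mult_mat_entry[where n=n] W_def sum_distrib_left mult.assoc
          del: index_mult_mat(1) mult_pCons_right mult_pCons_left)
  qed auto
  ultimately show ?thesis unfolding \<mu>_def by (intro bexI[of _ W]) auto
qed

text \<open>Up to the nonzero polynomial \<open>D\<close>, the matrices \<open>Q\<close> and \<open>Q'\<close> are inverse isomorphisms between the
  module and its twist by \<open>\<xi> b \<mapsto> \<kappa> b * \<xi> b\<close>. Coefficients in \<open>k[t]\<close> are needed since \<open>D\<close> may vanish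
  at every point of a finite field.\<close>

definition twistable :: "('g \<Rightarrow> 'k) \<Rightarrow> bool" where
  "twistable \<kappa> \<longleftrightarrow> (\<exists>Q\<in>carrier_mat n n. \<exists>Q'\<in>carrier_mat n n. \<exists>D. D \<noteq> 0 \<and> Q * Q' = D \<cdot>\<^sub>m 1\<^sub>m n \<and>
    (\<forall>b. Q * \<Xi> b = [:\<kappa> b:] \<cdot>\<^sub>m (\<Xi> b * Q)) \<and>
    (\<forall>b. [:\<kappa> b:] \<cdot>\<^sub>m (Q' * \<Xi> b) = \<Xi> b * Q'))"

lemma twistable_one: "twistable (\<lambda>_. 1)"
  unfolding twistable_def
  by (intro bexI[of _ "1\<^sub>m n"] exI[of _ 1]) (auto simp: square_mat_simps[where n=n] simp flip: one_pCons)

lemma twistable_mult: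
  assumes "twistable \<kappa>" "twistable \<mu>"
  shows "twistable (\<lambda>b. \<kappa> b * \<mu> b)"
proof -
  obtain Q Q' D where Q [simp]: "Q \<in> carrier_mat n n" "Q' \<in> carrier_mat n n" and D: "D \<noteq> 0" "Q * Q' = D \<cdot>\<^sub>m 1\<^sub>m n"
    and 1: "\<And>b. Q * \<Xi> b = [:\<kappa> b:] \<cdot>\<^sub>m (\<Xi> b * Q)"
    and 2: "\<And>b. [:\<kappa> b:] \<cdot>\<^sub>m (Q' * \<Xi> b) = \<Xi> b * Q'"
    using assms(1) unfolding twistable_def by blast
  obtain R R' E where R [simp]: "R \<in> carrier_mat n n" "R' \<in> carrier_mat n n" and E: "E \<noteq> 0" "R * R' = E \<cdot>\<^sub>m 1\<^sub>m n"
    and 3: "\<And>b. R * \<Xi> b = [:\<mu> b:] \<cdot>\<^sub>m (\<Xi> b * R)"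
    and 4: "\<And>b. [:\<mu> b:] \<cdot>\<^sub>m (R' * \<Xi> b) = \<Xi> b * R'"
    using assms(2) unfolding twistable_def by blast
  note sq = square_mat_simps[where n=n]
  have "(Q * R) * (R' * Q') = Q * ((R * R') * Q')" by (simp add: sq)
  also have "\<dots> = (D * E) \<cdot>\<^sub>m 1\<^sub>m n" by (simp add: E D sq smult_smult_mat mult.commute)
  finally have a: "(Q * R) * (R' * Q') = (D * E) \<cdot>\<^sub>m 1\<^sub>m n" .
  have b: "(Q * R) * \<Xi> b = [:\<kappa> b * \<mu> b:] \<cdot>\<^sub>m (\<Xi> b * (Q * R))" for b
  proof -
    have "(Q * R) * \<Xi> b = [:\<mu> b:] \<cdot>\<^sub>m ((Q * \<Xi> b) * R)" by (simp add: sq 3)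
    also have "\<dots> = [:\<kappa> b * \<mu> b:] \<cdot>\<^sub>m (\<Xi> b * (Q * R))"
      unfolding 1 by (simp add: sq smult_smult_mat mult.commute)
    finally show ?thesis .
  qed
  have c: "[:\<kappa> b * \<mu> b:] \<cdot>\<^sub>m ((R' * Q') * \<Xi> b) = \<Xi> b * (R' * Q')" for b
  proof -
    have "[:\<kappa> b * \<mu> b:] \<cdot>\<^sub>m ((R' * Q') * \<Xi> b) = [:\<mu> b:] \<cdot>\<^sub>m (R' * ([:\<kappa> b:] \<cdot>\<^sub>m (Q' * \<Xi> b)))"
      by (simp add: sq smult_smult_mat mult.commute)
    also have "\<dots> = ([:\<mu> b:] \<cdot>\<^sub>m (R' * \<Xi> b)) * Q'" unfolding 2 by (simp add: sq)
    also have "\<dots> = \<Xi> b * (R' * Q')" unfolding 4 by (simp add: sq)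
    finally show ?thesis .
  qed
  show ?thesis unfolding twistable_def
    by (rule bexI[of _ "Q * R"], rule bexI[of _ "R' * Q'"], rule exI[of _ "D * E"])
      (use a b c D E in \<open>auto simp: sq\<close>)
qed

text \<open>If \<open>P(t)\<close> rescales \<open>\<xi> a\<close> by \<open>1 + t\<close>, then \<open>P(ct + c - 1)\<close> rescales it by \<open>c(1 + t)\<close>. Composing with the
  adjugate of \<open>P(t)\<close>, which rescales back by \<open>1 + t\<close>, leaves the constant factor \<open>c\<close>.\<close>

lemma twistable_at:
  assumes "c \<noteq> 0"
  shows "twistable (\<lambda>b. if b = a then c else 1)"
proof -
  note sq = square_mat_simps[where n=n]
  define \<mu> :: "'g \<Rightarrow> 'k poly" where "\<mu> b = (if b = a then [:1, 1:] else 1)" for b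
  define \<kappa> where "\<kappa> b = (if b = a then c else 1)" for b
  obtain P where P [simp]: "P \<in> carrier_mat n n" and P0: "coeff_mat 0 P = 1\<^sub>m n"
    and P\<xi>: "\<And>b. P * \<Xi> b = \<mu> b \<cdot>\<^sub>m (\<Xi> b * P)"
    using deformation_poly[of a] unfolding \<mu>_def by blast
  define R where "R = adj_mat P"
  define D where "D = det P"
  have R [simp]: "R \<in> carrier_mat n n" and PR: "P * R = D \<cdot>\<^sub>m 1\<^sub>m n" and RP: "R * P = D \<cdot>\<^sub>m 1\<^sub>m n"
    using adj_mat[OF P] by (auto simp: R_def D_def)
  interpret c0: comm_ring_hom "\<lambda>p :: 'k poly. coeff p 0"
    by unfold_locales (simp_all add: coeff_mult_0)
  have "coeff D 0 = det (coeff_mat 0 P)"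
    by (simp add: D_def)
  then have D: "D \<noteq> 0" by (auto simp: P0)
  have R\<xi>: "\<Xi> b * R = \<mu> b \<cdot>\<^sub>m (R * \<Xi> b)" for b
  proof (rule smult_mat_cancel[OF _ D])
    have "D \<cdot>\<^sub>m (\<Xi> b * R) = (R * P) * (\<Xi> b * R)" by (simp add: RP sq)
    also have "\<dots> = R * (P * \<Xi> b) * R" by (simp add: sq)
    also have "\<dots> = \<mu> b \<cdot>\<^sub>m (R * \<Xi> b * (P * R))" unfolding P\<xi> by (simp add: sq)
    also have "\<dots> = D \<cdot>\<^sub>m (\<mu> b \<cdot>\<^sub>m (R * \<Xi> b))" by (simp add: PR sq smult_smult_mat mult.commute)
    finally show "D \<cdot>\<^sub>m (\<Xi> b * R) = D \<cdot>\<^sub>m (\<mu> b \<cdot>\<^sub>m (R * \<Xi> b))" .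
  qed
  define \<phi> :: "'k poly \<Rightarrow> 'k poly" where "\<phi> p = pcompose p [:c - 1, c:]" for p
  have \<phi>_mult: "map_mat \<phi> (A * B) = map_mat \<phi> A * map_mat \<phi> B" if "A \<in> carrier_mat n n" "B \<in> carrier_mat n n" for A B
    using map_mat_pcompose_mult[OF that] unfolding \<phi>_def .
  have \<phi>_smult: "map_mat \<phi> (r \<cdot>\<^sub>m A) = \<phi> r \<cdot>\<^sub>m map_mat \<phi> A" for r A
    unfolding \<phi>_def by (rule map_mat_pcompose_smult)
  have \<phi>_const: "map_mat \<phi> (const_mat A) = const_mat A" for A by (rule eq_matI) (auto simp: \<phi>_def)
  have \<phi>_one: "map_mat \<phi> (1\<^sub>m n) = 1\<^sub>m n" by (rule eq_matI) (auto simp: \<phi>_def pcompose_1)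
  have \<phi>\<mu>: "\<phi> (\<mu> b) = [:\<kappa> b:] * \<mu> b" for b
    by (auto simp: \<phi>_def \<mu>_def \<kappa>_def pcompose_pCons pcompose_1 one_pCons)
  have \<mu>_nz: "\<mu> b \<noteq> 0" for b by (simp add: \<mu>_def)
  define P' where "P' = map_mat \<phi> P"
  define R' where "R' = map_mat \<phi> R"
  have [simp]: "P' \<in> carrier_mat n n" "R' \<in> carrier_mat n n" by (simp_all add: P'_def R'_def)
  have P'\<xi>: "P' * \<Xi> b = ([:\<kappa> b:] * \<mu> b) \<cdot>\<^sub>m (\<Xi> b * P')" for b
    using arg_cong[OF P\<xi>[of b], of "map_mat \<phi>"] by (simp only: \<phi>_mult P const_gens \<phi>_smult \<phi>_const P'_def \<phi>\<mu>)
  have R'\<xi>: "\<Xi> b * R' = ([:\<kappa> b:] * \<mu> b) \<cdot>\<^sub>m (R' * \<Xi> b)" for b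
    using arg_cong[OF R\<xi>[of b], of "map_mat \<phi>"] by (simp only: \<phi>_mult R const_gens \<phi>_smult \<phi>_const R'_def \<phi>\<mu>)
  have P'R': "P' * R' = \<phi> D \<cdot>\<^sub>m 1\<^sub>m n"
    using arg_cong[OF PR, of "map_mat \<phi>"] by (simp only: \<phi>_mult P R \<phi>_smult \<phi>_one P'_def R'_def)
  have \<phi>D: "\<phi> D \<noteq> 0" using D assms by (simp add: \<phi>_def pcompose_eq_0_iff)
  have a: "(P' * R) * (P * R') = (D * \<phi> D) \<cdot>\<^sub>m 1\<^sub>m n"
  proof -
    have "(P' * R) * (P * R') = P' * ((R * P) * R')" by (simp add: sq)
    also have "\<dots> = D \<cdot>\<^sub>m (P' * R')" by (simp add: RP sq)
    finally show ?thesis by (simp add: P'R' smult_smult_mat)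
  qed
  have b: "(P' * R) * \<Xi> b = [:\<kappa> b:] \<cdot>\<^sub>m (\<Xi> b * (P' * R))" for b
  proof (rule smult_mat_cancel[OF _ \<mu>_nz[of b]])
    have "\<mu> b \<cdot>\<^sub>m ((P' * R) * \<Xi> b) = P' * (\<mu> b \<cdot>\<^sub>m (R * \<Xi> b))" by (simp add: sq)
    also have "\<dots> = (P' * \<Xi> b) * R" unfolding R\<xi>[symmetric] by (simp add: sq)
    also have "\<dots> = \<mu> b \<cdot>\<^sub>m ([:\<kappa> b:] \<cdot>\<^sub>m (\<Xi> b * (P' * R)))"
      unfolding P'\<xi> by (simp add: sq smult_smult_mat mult.commute)
    finally show "\<mu> b \<cdot>\<^sub>m ((P' * R) * \<Xi> b) = \<dots>" .
  qed
  have c: "[:\<kappa> b:] \<cdot>\<^sub>m ((P * R') * \<Xi> b) = \<Xi> b * (P * R')" for b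
  proof (rule smult_mat_cancel[OF _ \<mu>_nz[of b]])
    have "\<mu> b \<cdot>\<^sub>m ([:\<kappa> b:] \<cdot>\<^sub>m ((P * R') * \<Xi> b)) = P * (([:\<kappa> b:] * \<mu> b) \<cdot>\<^sub>m (R' * \<Xi> b))"
      by (simp add: sq smult_smult_mat mult.commute)
    also have "\<dots> = (P * \<Xi> b) * R'" unfolding R'\<xi>[symmetric] by (simp add: sq)
    also have "\<dots> = \<mu> b \<cdot>\<^sub>m (\<Xi> b * (P * R'))" unfolding P\<xi> by (simp add: sq)
    finally show "\<mu> b \<cdot>\<^sub>m ([:\<kappa> b:] \<cdot>\<^sub>m ((P * R') * \<Xi> b)) = \<dots>" .
  qed
  show ?thesis unfolding twistable_def \<kappa>_def[symmetric]
    by (rule bexI[of _ "P' * R"], rule bexI[of _ "P * R'"], rule exI[of _ "D * \<phi> D"])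
      (use a b c D \<phi>D in \<open>auto simp: sq\<close>)
qed

lemma twistable:
  assumes "finite (UNIV :: 'g set)" "\<And>b. \<kappa> b \<noteq> 0"
  shows "twistable \<kappa>"
proof -
  have "twistable (\<lambda>b. if b \<in> F then \<kappa> b else 1)" if "finite F" for F
    using that
  proof (induction F)
    case empty
    then show ?case by (simp add: twistable_one)
  next
    case (insert a F)
    have eq: "(\<lambda>b. (if b = a then \<kappa> a else 1) * (if b \<in> F then \<kappa> b else 1)) = (\<lambda>b. if b \<in> insert a F then \<kappa> b else 1)"
      using insert.hyps by auto
    show ?case using twistable_mult[OF twistable_at[OF assms(2)[of a], of a] insert.IH] by (simp only: eq)
  qed
  from this[OF assms(1)] show ?thesis by simp
qed

text \<open>The coefficients of \<open>Q'\<close> for the twist by \<open>1 / s\<^sub>a\<^sub>b\<close> are cocycles, so \<open>Q'\<close> is the coboundary of some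
  polynomial matrix \<open>V\<close>. Then \<open>Q * V\<close> is a contraction for \<open>a\<close> up to the factor \<open>Q * Q' = D\<close>, and so is each
  of its coefficients up to the corresponding coefficient of \<open>D\<close>.\<close>

lemma contraction_exists:
  assumes "finite (UNIV :: 'g set)"
  shows "\<exists>T\<in>carrier_mat n n. \<forall>b. T * \<xi> b = inverse (s a b) \<cdot>\<^sub>m (\<xi> b * T) + (if b = a then 1\<^sub>m n else 0\<^sub>m n n)"
proof -
  note sq = square_mat_simps[where n=n]
  obtain Q Q' D where Q [simp]: "Q \<in> carrier_mat n n" "Q' \<in> carrier_mat n n" and D: "D \<noteq> 0" "Q * Q' = D \<cdot>\<^sub>m 1\<^sub>m n"
    and 1: "\<And>b. Q * \<Xi> b = [:inverse (s a b):] \<cdot>\<^sub>m (\<Xi> b * Q)"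
    and 2: "\<And>b. [:inverse (s a b):] \<cdot>\<^sub>m (Q' * \<Xi> b) = \<Xi> b * Q'"
    using twistable[OF assms, of "\<lambda>b. inverse (s a b)"] s_nz unfolding twistable_def by auto
  have cs: "coeff_mat k ([:c:] \<cdot>\<^sub>m A) = c \<cdot>\<^sub>m coeff_mat k A" for k c and A :: "'k poly mat"
    by (rule eq_matI) auto
  have "coeff_mat k Q' * \<xi> b = s a b \<cdot>\<^sub>m (\<xi> b * coeff_mat k Q')" for k b
  proof -
    have "inverse (s a b) \<cdot>\<^sub>m (coeff_mat k Q' * \<xi> b) = \<xi> b * coeff_mat k Q'"
      using arg_cong[OF 2[of b], of "coeff_mat k"]
      by (simp only: cs coeff_mat_mult_const[OF Q(2) gens])
    then have "s a b \<cdot>\<^sub>m (inverse (s a b) \<cdot>\<^sub>m (coeff_mat k Q' * \<xi> b)) = s a b \<cdot>\<^sub>m (\<xi> b * coeff_mat k Q')" by simp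
    then show ?thesis using s_nz[of a b] by (simp add: smult_smult_mat one_smult_mat)
  qed
  then have ex: "\<exists>S\<in>carrier_mat n n. \<forall>b. S * \<xi> b = \<xi> b * S + (if b = a then coeff_mat k Q' else 0\<^sub>m n n)" for k
    by (intro rigid) auto
  define sol where "sol k S \<longleftrightarrow> S \<in> carrier_mat n n \<and> (\<forall>b. S * \<xi> b = \<xi> b * S + (if b = a then coeff_mat k Q' else 0\<^sub>m n n))" for k S
  \<comment> \<open>Choosing \<open>0\<close> whenever it is a solution keeps \<open>S\<close> finitely supported, hence polynomial.\<close>
  define S where "S k = (if coeff_mat k Q' = 0\<^sub>m n n then 0\<^sub>m n n else SOME S. sol k S)" for k
  have S: "sol k (S k)" for k
  proof (cases "coeff_mat k Q' = 0\<^sub>m n n")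
    case False
    have "sol k (SOME S. sol k S)"
      by (rule someI_ex) (use ex[of k] in \<open>auto simp: sol_def\<close>)
    then show ?thesis using False by (simp add: S_def)
  next
    case True
    then show ?thesis by (auto simp: sol_def S_def sq)
  qed
  obtain N where "\<forall>k>N. coeff_mat k Q' = 0\<^sub>m n n" using coeff_mat_bounded[OF Q(2)] by blast
  then obtain V where V [simp]: "V \<in> carrier_mat n n" and VS: "\<And>k. coeff_mat k V = S k"
    using poly_mat_of_coeffs[of S n N] S by (auto simp: S_def sol_def)
  have V\<xi>: "V * \<Xi> b = \<Xi> b * V + (if b = a then Q' else 0\<^sub>m n n)" for b
  proof (rule coeff_mat_eqI[of _ n])
    fix k
    have "coeff_mat k (V * \<Xi> b) = \<xi> b * S k + (if b = a then coeff_mat k Q' else 0\<^sub>m n n)"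
      using S[of k] by (simp add: coeff_mat_mult_const[OF V gens] VS sol_def)
    also have "\<dots> = coeff_mat k (\<Xi> b * V) + coeff_mat k (if b = a then Q' else 0\<^sub>m n n)"
      by (auto simp: coeff_mat_mult_const[OF V gens] VS)
    also have "\<dots> = coeff_mat k (\<Xi> b * V + (if b = a then Q' else 0\<^sub>m n n))"
      by (cases "b = a"; rule eq_matI)
        (auto simp: carrier_matD[OF Q(2)] carrier_matD[OF V] simp del: index_mult_mat(1))
    finally show "coeff_mat k (V * \<Xi> b) = \<dots>" .
  qed (auto simp: sq)
  obtain k where k: "coeff D k \<noteq> 0" using D(1) by (metis leading_coeff_0_iff)
  have QV: "Q * V \<in> carrier_mat n n" by (simp add: sq)
  define C where "C = coeff_mat k (Q * V)"
  have C [simp]: "C \<in> carrier_mat n n" "dim_row C = n" "dim_col C = n"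
    using QV by (simp_all add: C_def carrier_matD[OF V] carrier_matD[OF Q(1)])
  define T where "T = inverse (coeff D k) \<cdot>\<^sub>m C"
  have "T * \<xi> b = inverse (s a b) \<cdot>\<^sub>m (\<xi> b * T) + (if b = a then 1\<^sub>m n else 0\<^sub>m n n)" for b
  proof -
    have "(Q * V) * \<Xi> b = Q * (\<Xi> b * V + (if b = a then Q' else 0\<^sub>m n n))" by (simp add: sq V\<xi>)
    also have "\<dots> = (Q * \<Xi> b) * V + (if b = a then D else 0) \<cdot>\<^sub>m 1\<^sub>m n"
      by (auto simp: sq D zero_smult_mat)
    also have "\<dots> = [:inverse (s a b):] \<cdot>\<^sub>m (\<Xi> b * (Q * V)) + (if b = a then D else 0) \<cdot>\<^sub>m 1\<^sub>m n"
      unfolding 1 by (simp add: sq)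
    finally have "coeff_mat k ((Q * V) * \<Xi> b) =
      coeff_mat k ([:inverse (s a b):] \<cdot>\<^sub>m (\<Xi> b * (Q * V))) + (if b = a then coeff D k else 0) \<cdot>\<^sub>m 1\<^sub>m n"
      using QV by (auto intro!: eq_matI simp del: index_mult_mat(1))
    then have *: "C * \<xi> b = inverse (s a b) \<cdot>\<^sub>m (\<xi> b * C) + (if b = a then coeff D k else 0) \<cdot>\<^sub>m 1\<^sub>m n"
      by (simp only: coeff_mat_mult_const[OF QV gens] cs C_def)
    have "T * \<xi> b = inverse (coeff D k) \<cdot>\<^sub>m (C * \<xi> b)"
      by (simp add: T_def sq)
    also have "\<dots> = inverse (s a b) \<cdot>\<^sub>m (\<xi> b * T) + (if b = a then 1\<^sub>m n else 0\<^sub>m n n)"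
      unfolding * T_def using k
      by (cases "b = a"; intro eq_matI) (auto simp: sq algebra_simps simp del: index_mult_mat(1))
    finally show ?thesis .
  qed
  moreover have "T \<in> carrier_mat n n" by (simp add: T_def)
  ultimately show ?thesis by blast
qed

end

section \<open>Linear maps and free modules\<close>

text \<open>The homomorphisms of \<open>module_hom\<close> without the requirement of extensionality, which would get in the
  way of writing them as lambda terms.\<close>

definition is_linear :: "('a, 'c) ring_scheme \<Rightarrow> ('a, 'm, 'd) module_scheme \<Rightarrow> ('a, 'n, 'e) module_scheme \<Rightarrow> ('m \<Rightarrow> 'n) \<Rightarrow> bool" where
  "is_linear R M N f \<longleftrightarrow> f \<in> carrier M \<rightarrow> carrier N \<and>
     (\<forall>x\<in>carrier M. \<forall>y\<in>carrier M. f (x \<oplus>\<^bsub>M\<^esub> y) = f x \<oplus>\<^bsub>N\<^esub> f y) \<and>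
     (\<forall>r\<in>carrier R. \<forall>x\<in>carrier M. f (r \<odot>\<^bsub>M\<^esub> x) = r \<odot>\<^bsub>N\<^esub> f x)"

lemma module_hom_iff: "f \<in> module_hom R M N \<longleftrightarrow> is_linear R M N f \<and> f \<in> extensional (carrier M)"
  by (auto simp: module_hom_def is_linear_def PiE_def)

lemma is_linearI:
  assumes "\<And>x. x \<in> carrier M \<Longrightarrow> f x \<in> carrier N"
    "\<And>x y. x \<in> carrier M \<Longrightarrow> y \<in> carrier M \<Longrightarrow> f (x \<oplus>\<^bsub>M\<^esub> y) = f x \<oplus>\<^bsub>N\<^esub> f y"
    "\<And>r x. r \<in> carrier R \<Longrightarrow> x \<in> carrier M \<Longrightarrow> f (r \<odot>\<^bsub>M\<^esub> x) = r \<odot>\<^bsub>N\<^esub> f x"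
  shows "is_linear R M N f"
  using assms by (auto simp: is_linear_def)

lemma is_linearD:
  assumes "is_linear R M N f"
  shows "x \<in> carrier M \<Longrightarrow> f x \<in> carrier N"
    "x \<in> carrier M \<Longrightarrow> y \<in> carrier M \<Longrightarrow> f (x \<oplus>\<^bsub>M\<^esub> y) = f x \<oplus>\<^bsub>N\<^esub> f y"
    "r \<in> carrier R \<Longrightarrow> x \<in> carrier M \<Longrightarrow> f (r \<odot>\<^bsub>M\<^esub> x) = r \<odot>\<^bsub>N\<^esub> f x"
  using assms by (auto simp: is_linear_def)

lemma is_linear_cong:
  assumes "left_module R M" "\<And>x. x \<in> carrier M \<Longrightarrow> f x = g x"
  shows "is_linear R M N f \<longleftrightarrow> is_linear R M N g"
proof -
  interpret M: left_module R M by fact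
  show ?thesis using assms(2) by (auto simp: is_linear_def Pi_def)
qed

lemma is_linear_restrict:
  assumes "left_module R M" "is_linear R M N f"
  shows "restrict f (carrier M) \<in> module_hom R M N"
proof -
  interpret M: left_module R M by fact
  show ?thesis using assms(2) by (auto simp: module_hom_iff is_linear_def)
qed

context left_module
begin

lemma smult_l_zero [simp]: "x \<in> carrier M \<Longrightarrow> \<zero> \<odot>\<^bsub>M\<^esub> x = \<zero>\<^bsub>M\<^esub>"
proof -
  assume x: "x \<in> carrier M"
  have "\<zero> \<odot>\<^bsub>M\<^esub> x \<oplus>\<^bsub>M\<^esub> \<zero> \<odot>\<^bsub>M\<^esub> x = \<zero> \<odot>\<^bsub>M\<^esub> x"
    using smult_l_distr[of \<zero> \<zero> x] x by simp
  then show ?thesis using x by (metis M.add.l_cancel_one' R.zero_closed smult_closed)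
qed

lemma smult_r_zero [simp]: "r \<in> carrier R \<Longrightarrow> r \<odot>\<^bsub>M\<^esub> \<zero>\<^bsub>M\<^esub> = \<zero>\<^bsub>M\<^esub>"
proof -
  assume r: "r \<in> carrier R"
  have "r \<odot>\<^bsub>M\<^esub> \<zero>\<^bsub>M\<^esub> \<oplus>\<^bsub>M\<^esub> r \<odot>\<^bsub>M\<^esub> \<zero>\<^bsub>M\<^esub> = r \<odot>\<^bsub>M\<^esub> \<zero>\<^bsub>M\<^esub>"
    using smult_r_distr[of r "\<zero>\<^bsub>M\<^esub>" "\<zero>\<^bsub>M\<^esub>"] r by simp
  then show ?thesis using r by (metis M.add.l_cancel_one' M.zero_closed smult_closed)
qed

lemma smult_r_minus: "r \<in> carrier R \<Longrightarrow> x \<in> carrier M \<Longrightarrow> r \<odot>\<^bsub>M\<^esub> (\<ominus>\<^bsub>M\<^esub> x) = \<ominus>\<^bsub>M\<^esub> (r \<odot>\<^bsub>M\<^esub> x)"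
  by (rule sym, rule M.minus_equality) (auto simp: M.l_neg simp flip: smult_r_distr)

lemma smult_finsum:
  assumes "r \<in> carrier R" "f \<in> A \<rightarrow> carrier M"
  shows "r \<odot>\<^bsub>M\<^esub> (\<Oplus>\<^bsub>M\<^esub>x\<in>A. f x) = (\<Oplus>\<^bsub>M\<^esub>x\<in>A. r \<odot>\<^bsub>M\<^esub> f x)"
  using assms(2)
proof (induction A rule: infinite_finite_induct)
  case (insert a A)
  then show ?case using assms(1) by (subst (1 2) M.finsum_insert) (auto simp: smult_r_distr Pi_def)
qed (use assms(1) in auto)

end

lemma linear_zero:
  assumes "left_module R M" "left_module R N" "is_linear R M N f"
  shows "f \<zero>\<^bsub>M\<^esub> = \<zero>\<^bsub>N\<^esub>"
proof -
  interpret M: left_module R M by fact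
  interpret N: left_module R N by fact
  have "f (\<zero>\<^bsub>R\<^esub> \<odot>\<^bsub>M\<^esub> \<zero>\<^bsub>M\<^esub>) = \<zero>\<^bsub>R\<^esub> \<odot>\<^bsub>N\<^esub> f \<zero>\<^bsub>M\<^esub>"
    by (rule is_linearD(3)[OF assms(3)]) auto
  then show ?thesis using is_linearD(1)[OF assms(3), of "\<zero>\<^bsub>M\<^esub>"] by simp
qed

lemma linear_finsum:
  assumes "left_module R M" "left_module R N" "is_linear R M N u" "f \<in> A \<rightarrow> carrier M"
  shows "u (\<Oplus>\<^bsub>M\<^esub>x\<in>A. f x) = (\<Oplus>\<^bsub>N\<^esub>x\<in>A. u (f x))"
  using assms(4)
proof (induction A rule: infinite_finite_induct)
  case (infinite A)
  interpret M: left_module R M by fact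
  interpret N: left_module R N by fact
  show ?case using infinite linear_zero[OF assms(1-3)] by simp
next
  case empty
  interpret M: left_module R M by fact
  interpret N: left_module R N by fact
  show ?case using linear_zero[OF assms(1-3)] by simp
next
  case (insert a A)
  interpret M: left_module R M by fact
  interpret N: left_module R N by fact
  show ?case using insert is_linearD(1,2)[OF assms(3)]
    by (subst M.finsum_insert; (subst N.finsum_insert)?) (auto simp: Pi_def)
qed

lemma linear_compose:
  "is_linear R M N f \<Longrightarrow> is_linear R N P g \<Longrightarrow> is_linear R M P (\<lambda>x. g (f x))"
  by (auto simp: is_linear_def Pi_def)

lemma linear_minus:
  assumes "left_module R M" "left_module R N" "is_linear R M N f" "x \<in> carrier M" "y \<in> carrier M"
  shows "f (x \<ominus>\<^bsub>M\<^esub> y) = f x \<ominus>\<^bsub>N\<^esub> f y"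
proof -
  interpret M: left_module R M by fact
  interpret N: left_module R N by fact
  have "f (x \<ominus>\<^bsub>M\<^esub> y) \<oplus>\<^bsub>N\<^esub> f y = f x"
    using is_linearD(2)[OF assms(3), of "x \<ominus>\<^bsub>M\<^esub> y" y] assms(4,5)
    by (simp add: M.minus_eq M.add.m_assoc M.l_neg)
  then show ?thesis using is_linearD(1)[OF assms(3)] assms(4,5)
    by (metis M.minus_closed N.add.inv_closed N.add.m_assoc N.minus_eq N.r_neg N.r_zero)
qed

lemma free_module_simps [simp]:
  "\<zero>\<^bsub>free_module R B\<^esub> = (\<lambda>_. \<zero>\<^bsub>R\<^esub>)"
  "f \<oplus>\<^bsub>free_module R B\<^esub> g = (\<lambda>x. f x \<oplus>\<^bsub>R\<^esub> g x)"
  "r \<odot>\<^bsub>free_module R B\<^esub> f = (\<lambda>x. r \<otimes>\<^bsub>R\<^esub> f x)"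
  by (auto simp: free_module_def)

lemma free_carrier:
  "f \<in> carrier (free_module R B) \<longleftrightarrow> (\<forall>x. f x \<in> carrier R) \<and> finite {x. f x \<noteq> \<zero>\<^bsub>R\<^esub>} \<and> {x. f x \<noteq> \<zero>\<^bsub>R\<^esub>} \<subseteq> B"
  by (simp add: free_module_def)

lemma left_module_free:
  fixes R (structure)
  assumes "ring R"
  shows "left_module R (free_module R B)"
proof -
  interpret ring R by fact
  have add: "(\<lambda>x. f x \<oplus> g x) \<in> carrier (free_module R B)"
    if "f \<in> carrier (free_module R B)" "g \<in> carrier (free_module R B)" for f g
  proof -
    have "{x. f x \<oplus> g x \<noteq> \<zero>} \<subseteq> {x. f x \<noteq> \<zero>} \<union> {x. g x \<noteq> \<zero>}" by auto
    then show ?thesis using that unfolding free_carrier by (auto intro: finite_subset)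
  qed
  have sm: "(\<lambda>x. r \<otimes> f x) \<in> carrier (free_module R B)"
    if "f \<in> carrier (free_module R B)" "r \<in> carrier R" for r f
  proof -
    have "{x. r \<otimes> f x \<noteq> \<zero>} \<subseteq> {x. f x \<noteq> \<zero>}" using that by auto
    then show ?thesis using that unfolding free_carrier by (auto intro: finite_subset)
  qed
  have c: "f x \<in> carrier R" if "f \<in> carrier (free_module R B)" for f x using that by (simp add: free_carrier)
  have "abelian_group (free_module R B)"
  proof (rule abelian_groupI)
    show "\<exists>y\<in>carrier (free_module R B). y \<oplus>\<^bsub>free_module R B\<^esub> f = \<zero>\<^bsub>free_module R B\<^esub>"
      if "f \<in> carrier (free_module R B)" for f
      by (rule bexI[OF _ sm[OF that, of "\<ominus> \<one>"]]) (use c[OF that] in \<open>auto simp: fun_eq_iff l_minus l_neg\<close>)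
  qed (auto simp: c add free_carrier[of "\<lambda>_. \<zero>"] fun_eq_iff intro!: a_assoc a_comm)
  then show ?thesis
    by (intro left_module.intro left_module_axioms.intro assms)
      (auto simp: c sm l_distr r_distr m_assoc fun_eq_iff)
qed

lemma left_module_sum:
  assumes "left_module R M" "left_module R N"
  shows "left_module R (module_sum M N)"
proof -
  interpret M: left_module R M by fact
  interpret N: left_module R N by fact
  have "abelian_group (module_sum M N)"
  proof (rule abelian_groupI)
    fix u assume "u \<in> carrier (module_sum M N)"
    then show "\<exists>v\<in>carrier (module_sum M N). v \<oplus>\<^bsub>module_sum M N\<^esub> u = \<zero>\<^bsub>module_sum M N\<^esub>"
      by (intro bexI[of _ "(\<ominus>\<^bsub>M\<^esub> fst u, \<ominus>\<^bsub>N\<^esub> snd u)"]) (auto simp: module_sum_def M.l_neg N.l_neg)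
  qed (auto simp: module_sum_def M.a_ac N.a_ac)
  then show ?thesis
    by (intro left_module.intro left_module_axioms.intro M.R.ring_axioms)
      (auto simp: module_sum_def M.smult_l_distr N.smult_l_distr M.smult_r_distr N.smult_r_distr
        M.smult_assoc N.smult_assoc)
qed

lemma left_module_regular:
  assumes "ring R"
  shows "left_module R (regular_module R)"
proof -
  interpret ring R by fact
  have "abelian_group (regular_module R)"
  proof (rule abelian_groupI)
    fix u assume "u \<in> carrier (regular_module R)"
    then show "\<exists>v\<in>carrier (regular_module R). v \<oplus>\<^bsub>regular_module R\<^esub> u = \<zero>\<^bsub>regular_module R\<^esub>"
      by (intro bexI[of _ "\<ominus>\<^bsub>R\<^esub> u"]) (auto simp: regular_module_def l_neg)
  qed (auto simp: regular_module_def a_ac)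
  then show ?thesis
    by (intro left_module.intro left_module_axioms.intro ring_axioms)
      (auto simp: regular_module_def l_distr r_distr m_assoc)
qed

definition basis_vector :: "('a, 'c) ring_scheme \<Rightarrow> 'x \<Rightarrow> 'x \<Rightarrow> 'a" where
  "basis_vector R x y = (if y = x then \<one>\<^bsub>R\<^esub> else \<zero>\<^bsub>R\<^esub>)"

lemma basis_vector_closed:
  fixes R (structure)
  assumes "ring R" "x \<in> B"
  shows "basis_vector R x \<in> carrier (free_module R B)"
proof -
  interpret ring R by fact
  have "{y. basis_vector R x y \<noteq> \<zero>} \<subseteq> {x}" by (auto simp: basis_vector_def)
  then show ?thesis using assms(2) unfolding free_carrier
    by (auto simp: basis_vector_def intro: finite_subset)
qed

context left_module
begin

lemma linear_extension_superset:
  assumes "\<And>x. x \<in> B \<Longrightarrow> \<phi> x \<in> carrier M" "f \<in> carrier (free_module R B)"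
    "finite A" "{x. f x \<noteq> \<zero>} \<subseteq> A" "A \<subseteq> B"
  shows "linear_extension R M \<phi> f = (\<Oplus>\<^bsub>M\<^esub>x\<in>A. f x \<odot>\<^bsub>M\<^esub> \<phi> x)"
  unfolding linear_extension_def
proof (rule M.add.finprod_mono_neutral_cong_left)
  show "(\<lambda>x. f x \<odot>\<^bsub>M\<^esub> \<phi> x) \<in> A \<rightarrow> carrier M" using assms(1,2,5) by (auto simp: free_carrier)
qed (use assms in \<open>auto simp: subset_iff\<close>)

lemma linear_extension_linear:
  assumes "\<And>x. x \<in> B \<Longrightarrow> \<phi> x \<in> carrier M"
  shows "is_linear R (free_module R B) M (linear_extension R M \<phi>)"
proof (rule is_linearI)
  fix f assume f: "f \<in> carrier (free_module R B)"
  have ftm: "(\<lambda>x. g x \<odot>\<^bsub>M\<^esub> \<phi> x) \<in> A \<rightarrow> carrier M" if "g \<in> carrier (free_module R B)" "A \<subseteq> B" for g A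
    using that assms by (auto simp: free_carrier)
  show "linear_extension R M \<phi> f \<in> carrier M"
    unfolding linear_extension_def by (rule M.finsum_closed) (use ftm[OF f] f in \<open>auto simp: free_carrier\<close>)
  interpret F: left_module R "free_module R B" by (rule left_module_free) (rule R.ring_axioms)
  {
    fix g assume g: "g \<in> carrier (free_module R B)"
    let ?A = "{x. f x \<noteq> \<zero>} \<union> {x. g x \<noteq> \<zero>}"
    have A: "finite ?A" "?A \<subseteq> B" using f g by (auto simp: free_carrier)
    have fg: "f \<oplus>\<^bsub>free_module R B\<^esub> g \<in> carrier (free_module R B)" using f g by (rule F.M.add.m_closed)
    have "linear_extension R M \<phi> (f \<oplus>\<^bsub>free_module R B\<^esub> g) = (\<Oplus>\<^bsub>M\<^esub>x\<in>?A. (f x \<oplus> g x) \<odot>\<^bsub>M\<^esub> \<phi> x)"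
      by (subst linear_extension_superset[OF assms fg A(1) _ A(2)]) auto
    also have "\<dots> = (\<Oplus>\<^bsub>M\<^esub>x\<in>?A. f x \<odot>\<^bsub>M\<^esub> \<phi> x \<oplus>\<^bsub>M\<^esub> g x \<odot>\<^bsub>M\<^esub> \<phi> x)"
      using f g A(2) assms by (intro M.finsum_cong') (auto simp: free_carrier smult_l_distr subset_iff)
    also have "\<dots> = (\<Oplus>\<^bsub>M\<^esub>x\<in>?A. f x \<odot>\<^bsub>M\<^esub> \<phi> x) \<oplus>\<^bsub>M\<^esub> (\<Oplus>\<^bsub>M\<^esub>x\<in>?A. g x \<odot>\<^bsub>M\<^esub> \<phi> x)"
      by (rule M.finsum_addf[OF ftm[OF f A(2)] ftm[OF g A(2)]])
    also have "\<dots> = linear_extension R M \<phi> f \<oplus>\<^bsub>M\<^esub> linear_extension R M \<phi> g"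
      by (subst (1 2) linear_extension_superset[OF assms _ A(1) _ A(2)]) (use f g in auto)
    finally show "linear_extension R M \<phi> (f \<oplus>\<^bsub>free_module R B\<^esub> g) = linear_extension R M \<phi> f \<oplus>\<^bsub>M\<^esub> linear_extension R M \<phi> g" .
  }
  fix r assume r: "r \<in> carrier R"
  let ?A = "{x. f x \<noteq> \<zero>}"
  have A: "finite ?A" "?A \<subseteq> B" using f by (auto simp: free_carrier)
  have rf: "r \<odot>\<^bsub>free_module R B\<^esub> f \<in> carrier (free_module R B)" using f r by (rule F.smult_closed[rotated])
  have "linear_extension R M \<phi> (r \<odot>\<^bsub>free_module R B\<^esub> f) = (\<Oplus>\<^bsub>M\<^esub>x\<in>?A. (r \<otimes> f x) \<odot>\<^bsub>M\<^esub> \<phi> x)"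
    by (subst linear_extension_superset[OF assms rf A(1) _ A(2)]) (use r in auto)
  also have "\<dots> = (\<Oplus>\<^bsub>M\<^esub>x\<in>?A. r \<odot>\<^bsub>M\<^esub> (f x \<odot>\<^bsub>M\<^esub> \<phi> x))"
    using f r A(2) assms by (intro M.finsum_cong') (auto simp: free_carrier smult_assoc subset_iff)
  also have "\<dots> = r \<odot>\<^bsub>M\<^esub> linear_extension R M \<phi> f"
    unfolding linear_extension_def by (rule smult_finsum[symmetric]) (use r ftm[OF f A(2)] in auto)
  finally show "linear_extension R M \<phi> (r \<odot>\<^bsub>free_module R B\<^esub> f) = r \<odot>\<^bsub>M\<^esub> linear_extension R M \<phi> f" .
qed

lemma linear_extension_basis_vector:
  assumes "\<phi> x \<in> carrier M"
  shows "linear_extension R M \<phi> (basis_vector R x) = \<phi> x"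
proof -
  have "linear_extension R M \<phi> (basis_vector R x) = (\<Oplus>\<^bsub>M\<^esub>y\<in>{x}. basis_vector R x y \<odot>\<^bsub>M\<^esub> \<phi> y)"
    by (rule linear_extension_superset[of "{x}"])
      (use assms basis_vector_closed[OF R.ring_axioms, of x "{x}"] in \<open>auto simp: basis_vector_def split: if_splits\<close>)
  also have "\<dots> = \<phi> x" using assms by (subst M.finsum_insert) (auto simp: basis_vector_def)
  finally show ?thesis .
qed

end

lemma linear_linear_extension:
  assumes "left_module R M" "left_module R N" "is_linear R M N u"
    "\<And>x. x \<in> B \<Longrightarrow> \<phi> x \<in> carrier M" "f \<in> carrier (free_module R B)"
  shows "u (linear_extension R M \<phi> f) = linear_extension R N (\<lambda>x. u (\<phi> x)) f"
proof -
  interpret M: left_module R M by fact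
  interpret N: left_module R N by fact
  have "(\<lambda>x. f x \<odot>\<^bsub>M\<^esub> \<phi> x) \<in> {x. f x \<noteq> \<zero>\<^bsub>R\<^esub>} \<rightarrow> carrier M" using assms(4,5) by (auto simp: free_carrier)
  then show ?thesis
    unfolding linear_extension_def
    by (subst linear_finsum[OF assms(1-3)])
      (use assms(4,5) is_linearD[OF assms(3)] in \<open>auto simp: free_carrier subset_iff intro!: N.finsum_cong'\<close>)
qed

lemma linear_extension_eq_zero:
  assumes "left_module R M" "f \<in> carrier (free_module R B)" "\<And>x. x \<in> B \<Longrightarrow> \<phi> x = \<zero>\<^bsub>M\<^esub>"
  shows "linear_extension R M \<phi> f = \<zero>\<^bsub>M\<^esub>"
proof -
  interpret M: left_module R M by fact
  have "linear_extension R M \<phi> f = (\<Oplus>\<^bsub>M\<^esub>x\<in>{x. f x \<noteq> \<zero>\<^bsub>R\<^esub>}. \<zero>\<^bsub>M\<^esub>)"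
    unfolding linear_extension_def
    by (rule M.finsum_cong') (use assms(2,3) in \<open>auto simp: free_carrier subset_iff\<close>)
  then show ?thesis by simp
qed

section \<open>The canonical free resolution\<close>

lemma formal_sum_Nil: "formal_sum R [] = (\<lambda>_. \<zero>\<^bsub>R\<^esub>)"
  by (simp add: formal_sum_def fun_eq_iff)

lemma formal_sum_Cons: "formal_sum R ((r, x) # l) = (\<lambda>y. if x = y then r \<oplus>\<^bsub>R\<^esub> formal_sum R l y else formal_sum R l y)"
  by (simp add: formal_sum_def fun_eq_iff)

lemma formal_sum_closed:
  assumes "ring R" "set l \<subseteq> carrier R \<times> B"
  shows "formal_sum R l \<in> carrier (free_module R B)"
  using assms(2)
proof (induction l)
  case Nil
  interpret ring R by fact
  show ?case by (simp add: formal_sum_Nil free_carrier)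
next
  case (Cons p l)
  interpret ring R by fact
  obtain r x where p: "p = (r, x)" by fastforce
  have "{y. formal_sum R (p # l) y \<noteq> \<zero>\<^bsub>R\<^esub>} \<subseteq> insert x {y. formal_sum R l y \<noteq> \<zero>\<^bsub>R\<^esub>}"
    by (auto simp: p formal_sum_Cons)
  moreover have "\<forall>y. formal_sum R (p # l) y \<in> carrier R"
    using Cons by (auto simp: p formal_sum_Cons free_carrier)
  ultimately show ?case using Cons unfolding free_carrier by (auto simp: p intro: finite_subset)
qed

lemma formal_sum_surj:
  assumes "ring R" "f \<in> carrier (free_module R B)"
  obtains l where "set l \<subseteq> carrier R \<times> B" "formal_sum R l = f"
proof -
  interpret ring R by fact
  obtain xs where xs: "set xs = {x. f x \<noteq> \<zero>\<^bsub>R\<^esub>}" "distinct xs"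
    using assms(2) finite_distinct_list[of "{x. f x \<noteq> \<zero>\<^bsub>R\<^esub>}"] unfolding free_carrier by metis
  have "formal_sum R (map (\<lambda>x. (f x, x)) ys) y = (if y \<in> set ys then f y else \<zero>\<^bsub>R\<^esub>)" if "distinct ys" for ys y
    using that assms(2) by (induction ys) (auto simp: formal_sum_Nil formal_sum_Cons free_carrier)
  from this[OF xs(2)] have "formal_sum R (map (\<lambda>x. (f x, x)) xs) = f" by (auto simp: xs(1) fun_eq_iff)
  moreover have "set (map (\<lambda>x. (f x, x)) xs) \<subseteq> carrier R \<times> B" using assms(2) xs(1) by (auto simp: free_carrier)
  ultimately show thesis using that by blast
qed

lemma res_aug_linear:
  assumes "left_module R M"
  shows "is_linear R (res_module R M 0) M (res_aug R M)"
proof -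
  interpret left_module R M by fact
  show ?thesis unfolding res_module_def res_aug_def by (rule linear_extension_linear) auto
qed

lemma cell_rel_closed:
  assumes "left_module R M" "x \<in> res_basis R M (Suc n)"
  shows "formal_sum R (cell_rel x) \<in> carrier (res_module R M n)"
proof -
  interpret M: left_module R M by fact
  obtain l where "x = Rel l" "set l \<subseteq> carrier R \<times> res_basis R M n" using assms(2) by auto
  then show ?thesis using formal_sum_closed[OF M.R.ring_axioms] by (simp add: res_module_def)
qed

lemma res_diff_eq:
  assumes "left_module R M" "f \<in> carrier (res_module R M (Suc n))"
  shows "res_diff R f = linear_extension R (res_module R M n) (\<lambda>x. formal_sum R (cell_rel x)) f"
proof -
  interpret M: left_module R M by fact
  have lm: "left_module R (free_module R B)" for B by (rule left_module_free) (rule M.R.ring_axioms)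
  have "is_linear R (res_module R M n) (free_module R UNIV) (\<lambda>x. x)"
    unfolding res_module_def by (rule is_linearI) (auto simp: free_carrier)
  from linear_linear_extension[OF _ lm this cell_rel_closed[OF assms(1)] assms(2)[unfolded res_module_def]]
  show ?thesis unfolding res_diff_def res_module_def by (simp add: lm)
qed

lemma left_module_res: "left_module R M \<Longrightarrow> left_module R (res_module R M n)"
  unfolding res_module_def by (rule left_module_free) (simp add: left_module_def)

lemma res_diff_linear:
  assumes "left_module R M"
  shows "is_linear R (res_module R M (Suc n)) (res_module R M n) (res_diff R)"
proof -
  interpret F: left_module R "res_module R M n" using left_module_res[OF assms] .
  have *: "is_linear R (res_module R M (Suc n)) (res_module R M n) (linear_extension R (res_module R M n) (\<lambda>x. formal_sum R (cell_rel x)))"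
    unfolding res_module_def[of _ _ "Suc n"]
    by (rule F.linear_extension_linear) (rule cell_rel_closed[OF assms])
  interpret F': left_module R "res_module R M (Suc n)" using left_module_res[OF assms] .
  show ?thesis
    by (rule is_linear_cong[THEN iffD2, OF F'.left_module_axioms res_diff_eq[OF assms] *])
qed

lemma aug_diff_zero:
  assumes "left_module R M" "f \<in> carrier (res_module R M 1)"
  shows "res_aug R M (res_diff R f) = \<zero>\<^bsub>M\<^esub>"
proof -
  interpret M: left_module R M by fact
  have f: "f \<in> carrier (free_module R (res_basis R M (Suc 0)))" using assms(2) by (simp add: res_module_def)
  have f': "f \<in> carrier (res_module R M (Suc 0))" using assms(2) by simp
  show ?thesis unfolding res_diff_eq[OF assms(1) f']
    by (subst linear_linear_extension[OF left_module_res[OF assms(1)] assms(1) res_aug_linear[OF assms(1)] cell_rel_closed[OF assms(1)] f], simp)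
      (rule linear_extension_eq_zero[OF assms(1) f], auto)
qed

lemma diff_diff_zero:
  assumes "left_module R M" "f \<in> carrier (res_module R M (Suc (Suc n)))"
  shows "res_diff R (res_diff R f) = (\<lambda>_. \<zero>\<^bsub>R\<^esub>)"
proof -
  interpret M: left_module R M by fact
  have f: "f \<in> carrier (free_module R (res_basis R M (Suc (Suc n))))" using assms(2) by (simp add: res_module_def)
  have z: "(\<lambda>_. \<zero>\<^bsub>R\<^esub>) = \<zero>\<^bsub>res_module R M n\<^esub>" by (simp add: res_module_def)
  show ?thesis unfolding res_diff_eq[OF assms] z
    by (subst linear_linear_extension[OF left_module_res[OF assms(1)] left_module_res[OF assms(1)] res_diff_linear[OF assms(1)] cell_rel_closed[OF assms(1)] f], simp)
      (rule linear_extension_eq_zero[OF left_module_res[OF assms(1)] f], auto simp: res_module_def)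
qed

text \<open>A kernel element is the formal sum of some list, and this list is itself a basis element in the
  next degree.\<close>

lemma aug_exact:
  assumes "left_module R M" "f \<in> carrier (res_module R M 0)" "res_aug R M f = \<zero>\<^bsub>M\<^esub>"
  shows "\<exists>g\<in>carrier (res_module R M 1). res_diff R g = f"
proof -
  interpret M: left_module R M by fact
  obtain l where l: "set l \<subseteq> carrier R \<times> res_basis R M 0" "formal_sum R l = f"
    using formal_sum_surj[OF M.R.ring_axioms assms(2)[unfolded res_module_def]] .
  have R: "Rel l \<in> res_basis R M (Suc 0)" using l assms(3) by auto
  then have b: "basis_vector R (Rel l) \<in> carrier (res_module R M (Suc 0))"
    unfolding res_module_def by (intro basis_vector_closed M.R.ring_axioms)
  interpret F: left_module R "res_module R M 0" using left_module_res[OF assms(1)] .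
  have "res_diff R (basis_vector R (Rel l)) = f"
    unfolding res_diff_eq[OF assms(1) b]
    by (subst F.linear_extension_basis_vector) (use l cell_rel_closed[OF assms(1) R] in auto)
  then show ?thesis using b by auto
qed

section \<open>First extensions\<close>

text \<open>Cocycles are coboundaries. For maps that need not be extensional, this is easier to use than the
  triviality of a factor group.\<close>

definition ext1_vanishes :: "('a, 'c) ring_scheme \<Rightarrow> ('a, 'm, 'd) module_scheme \<Rightarrow> ('a, 'n, 'e) module_scheme \<Rightarrow> bool" where
  "ext1_vanishes R M N \<longleftrightarrow>
    (\<forall>g. is_linear R (res_module R M 1) N g \<longrightarrow>
      (\<forall>f\<in>carrier (res_module R M 2). g (res_diff R f) = \<zero>\<^bsub>N\<^esub>) \<longrightarrow>
      (\<exists>h. is_linear R (res_module R M 0) N h \<and> (\<forall>f\<in>carrier (res_module R M 1). g f = h (res_diff R f))))"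

lemma ext1_vanishes_if_trivial:
  assumes "left_module R M" "left_module R N" "trivial_group (Ext R 1 M N)"
  shows "ext1_vanishes R M N"
  unfolding ext1_vanishes_def
proof (intro allI impI)
  fix g assume g: "is_linear R (res_module R M 1) N g"
    and gd: "\<forall>f\<in>carrier (res_module R M 2). g (res_diff R f) = \<zero>\<^bsub>N\<^esub>"
  interpret N: left_module R N by fact
  interpret F0: left_module R "res_module R M 0" using left_module_res[OF assms(1)] .
  interpret F1: left_module R "res_module R M 1" using left_module_res[OF assms(1)] .
  let ?C = "ext_cochains R 1 M N"
  let ?Z = "kernel ?C (ext_cochains R 2 M N) (ext_coboundary R 1 M)"
  let ?B = "ext_coboundary R 0 M ` carrier (ext_cochains R 0 M N)"
  define g' where "g' = restrict g (carrier (res_module R M 1))"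
  have d: "f \<in> carrier (res_module R M 2) \<Longrightarrow> res_diff R f \<in> carrier (res_module R M 1)" for f
    using is_linearD(1)[OF res_diff_linear[OF assms(1), of 1], of f] by (simp add: numeral_2_eq_2)
  have d0: "f \<in> carrier (res_module R M 1) \<Longrightarrow> res_diff R f \<in> carrier (res_module R M 0)" for f
    using is_linearD(1)[OF res_diff_linear[OF assms(1), of 0], of f] by simp
  have hom: "g' \<in> module_hom R (res_module R M 1) N"
    unfolding g'_def by (rule is_linear_restrict[OF _ g]) (rule left_module_res[OF assms(1)])
  then have Z: "g' \<in> ?Z"
    using gd d by (auto simp: kernel_def ext_cochains_def hom_group_def ext_coboundary_def g'_def compose_def numeral_2_eq_2 fun_eq_iff restrict_def)
  have E: "Ext R 1 M N = ?C\<lparr>carrier := ?Z\<rparr> Mod ?B" by (simp add: Ext_def Let_def numeral_2_eq_2)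
  have "?B #>\<^bsub>?C\<lparr>carrier := ?Z\<rparr>\<^esub> g' \<in> carrier (Ext R 1 M N)"
    unfolding E using Z by (auto simp: FactGroup_def RCOSETS_def)
  then have "?B #>\<^bsub>?C\<lparr>carrier := ?Z\<rparr>\<^esub> g' = ?B"
    using assms(3) unfolding E by (auto simp: trivial_group_def FactGroup_def)
  moreover have "g' \<in> ?B #>\<^bsub>?C\<lparr>carrier := ?Z\<rparr>\<^esub> g'"
  proof -
    define z where "z = (\<lambda>x\<in>carrier (res_module R M 0). \<zero>\<^bsub>N\<^esub>)"
    have "z \<in> carrier (ext_cochains R 0 M N)"
      unfolding ext_cochains_def hom_group_def z_def
      by (auto intro!: is_linear_restrict is_linearI left_module_res assms(1))
    then have "ext_coboundary R 0 M z \<otimes>\<^bsub>?C\<^esub> g' \<in> ?B #>\<^bsub>?C\<lparr>carrier := ?Z\<rparr>\<^esub> g'"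
      unfolding r_coset_def by auto
    moreover have "ext_coboundary R 0 M z \<otimes>\<^bsub>?C\<^esub> g' = g'"
      using d0 is_linearD(1)[OF g]
      by (auto simp: ext_coboundary_def ext_cochains_def hom_group_def z_def g'_def compose_def fun_eq_iff restrict_def)
    ultimately show ?thesis by simp
  qed
  ultimately obtain h where h: "h \<in> module_hom R (res_module R M 0) N" "g' = ext_coboundary R 0 M h"
    by (auto simp: ext_cochains_def hom_group_def)
  have "g f = h (res_diff R f)" if "f \<in> carrier (res_module R M 1)" for f
  proof -
    have "g f = g' f" using that by (simp add: g'_def)
    also have "\<dots> = h (res_diff R f)" unfolding h(2) using that by (simp add: ext_coboundary_def compose_def)
    finally show ?thesis .
  qed
  then show "\<exists>h. is_linear R (res_module R M 0) N h \<and> (\<forall>f\<in>carrier (res_module R M 1). g f = h (res_diff R f))"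
    using h(1) by (auto simp: module_hom_iff)
qed

lemma ext1_vanishes_summand:
  assumes "left_module R N'" "ext1_vanishes R M (module_sum N N')"
  shows "ext1_vanishes R M N"
  unfolding ext1_vanishes_def
proof (intro allI impI)
  interpret N': left_module R N' by fact
  fix g assume g: "is_linear R (res_module R M 1) N g"
    and gd: "\<forall>f\<in>carrier (res_module R M 2). g (res_diff R f) = \<zero>\<^bsub>N\<^esub>"
  have "is_linear R (res_module R M 1) (module_sum N N') (\<lambda>f. (g f, \<zero>\<^bsub>N'\<^esub>))"
    using g by (auto simp: is_linear_def module_sum_def)
  moreover have "\<forall>f\<in>carrier (res_module R M 2). (g (res_diff R f), \<zero>\<^bsub>N'\<^esub>) = \<zero>\<^bsub>module_sum N N'\<^esub>"
    using gd by (simp add: module_sum_def)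
  ultimately obtain h where h: "is_linear R (res_module R M 0) (module_sum N N') h"
    "\<And>f. f \<in> carrier (res_module R M 1) \<Longrightarrow> (g f, \<zero>\<^bsub>N'\<^esub>) = h (res_diff R f)"
    using assms(2) unfolding ext1_vanishes_def by blast
  have "is_linear R (res_module R M 0) N (\<lambda>x. fst (h x))"
    using h(1) by (auto simp: is_linear_def module_sum_def Pi_def mem_Times_iff split: prod.splits)
  moreover have "g f = fst (h (res_diff R f))" if "f \<in> carrier (res_module R M 1)" for f
    using h(2)[OF that] by (metis fst_conv)
  ultimately show "\<exists>h. is_linear R (res_module R M 0) N h \<and> (\<forall>f\<in>carrier (res_module R M 1). g f = h (res_diff R f))"
    by blast
qed

text \<open>The free cover \<open>P\<^sub>0 \<rightarrow> M\<close> lifts to a map \<open>\<Psi>\<close> into \<open>E\<close>, which sends boundaries into \<open>N\<close> and so defines a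
  1-cocycle \<open>g\<close>. If \<open>g\<close> is the coboundary of \<open>h\<close>, then \<open>\<Psi> - i h\<close> vanishes on the kernel of the cover and
  descends to a section of \<open>E \<rightarrow> M\<close>.\<close>

lemma ext1_splits:
  fixes M :: "('a, 'm, 'd) module_scheme" and R :: "('a, 'c) ring_scheme"
    and E :: "('a, 'x, 'y) module_scheme" (structure)
  assumes M: "left_module R M" and N: "left_module R N" and E: "left_module R E"
    and ext: "ext1_vanishes R M N"
    and i: "is_linear R N E i" and p: "is_linear R E M p"
    and inj: "inj_on i (carrier N)" and exact: "\<And>e. e \<in> carrier E \<Longrightarrow> p e = \<zero>\<^bsub>M\<^esub> \<Longrightarrow> e \<in> i ` carrier N"
    and surj: "carrier M \<subseteq> p ` carrier E" and pi: "\<And>x. x \<in> carrier N \<Longrightarrow> p (i x) = \<zero>\<^bsub>M\<^esub>"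
  shows "\<exists>s. is_linear R M E s \<and> (\<forall>x\<in>carrier M. p (s x) = x)"
proof -
  let ?F0 = "res_module R M 0" and ?F1 = "res_module R M 1"
  interpret M: left_module R M by fact
  interpret N: left_module R N by fact
  interpret E: left_module R E by fact
  have F: "left_module R (res_module R M n)" for n using left_module_res[OF M] .
  interpret F0: left_module R "?F0" by (rule F)
  define \<sigma> where "\<sigma> x = (SOME e. e \<in> carrier E \<and> p e = x)" for x
  have \<sigma>: "\<sigma> x \<in> carrier E \<and> p (\<sigma> x) = x" if "x \<in> carrier M" for x
    unfolding \<sigma>_def by (rule someI_ex) (use surj that in auto)
  define \<Psi> where "\<Psi> = linear_extension R E (\<lambda>c :: ('a, 'm) cell. \<sigma> (cell_elt c))"
  have \<Psi>: "is_linear R (?F0) E \<Psi>"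
    unfolding \<Psi>_def res_module_def by (rule E.linear_extension_linear) (use \<sigma> in auto)
  have p\<Psi>: "p (\<Psi> f) = res_aug R M f" if "f \<in> carrier (?F0)" for f
  proof -
    have "p (\<Psi> f) = linear_extension R M (\<lambda>c. p (\<sigma> (cell_elt c))) f"
      unfolding \<Psi>_def
      by (rule linear_linear_extension[OF E M p _ that[unfolded res_module_def]]) (use \<sigma> in auto)
    also have "\<dots> = res_aug R M f"
      unfolding res_aug_def linear_extension_def
      using that \<sigma> by (intro M.finsum_cong') (auto simp: res_module_def free_carrier subset_iff)
    finally show ?thesis .
  qed
  define g where "g f = inv_into (carrier N) i (\<Psi> (res_diff R f))" for f
  have d: "res_diff R f \<in> carrier (?F0)" if "f \<in> carrier (?F1)" for f
    using is_linearD(1)[OF res_diff_linear[OF M, of 0], of f] that by simp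
  have \<Psi>d: "\<Psi> (res_diff R f) \<in> i ` carrier N" if "f \<in> carrier (?F1)" for f
    by (rule exact) (use d[OF that] p\<Psi> aug_diff_zero[OF M that] is_linearD(1)[OF \<Psi>] in auto)
  have g: "g f \<in> carrier N" "i (g f) = \<Psi> (res_diff R f)" if "f \<in> carrier (?F1)" for f
    unfolding g_def using \<Psi>d[OF that] by (auto intro: inv_into_into f_inv_into_f)
  have gI: "g f = x" if "f \<in> carrier (?F1)" "x \<in> carrier N" "i x = \<Psi> (res_diff R f)" for f x
    using inj_onD[OF inj, of "g f" x] g[OF that(1)] that(2,3) by simp
  have d1: "is_linear R (?F1) (?F0) (res_diff R)"
    using res_diff_linear[OF M, of 0] by simp
  interpret F1: left_module R "?F1" by (rule F)
  have glin: "is_linear R (?F1) N g"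
    by (rule is_linearI)
      (auto intro!: gI simp: g is_linearD[OF i] is_linearD[OF \<Psi>] is_linearD[OF d1] d simp del: One_nat_def)
  have "\<forall>f\<in>carrier (res_module R M 2). g (res_diff R f) = \<zero>\<^bsub>N\<^esub>"
  proof
    fix f assume f: "f \<in> carrier (res_module R M 2)"
    have z: "(\<lambda>_. \<zero>\<^bsub>R\<^esub>) = \<zero>\<^bsub>?F0\<^esub>" by (simp add: res_module_def)
    have "res_diff R f \<in> carrier (?F1)"
      using is_linearD(1)[OF res_diff_linear[OF M, of 1], of f] f by (simp add: numeral_2_eq_2)
    then show "g (res_diff R f) = \<zero>\<^bsub>N\<^esub>"
      by (rule gI) (use f diff_diff_zero[OF M, of f 0] linear_zero[OF F E \<Psi>] linear_zero[OF N E i] z in \<open>auto simp: numeral_2_eq_2\<close>)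
  qed
  then obtain h where h: "is_linear R (?F0) N h"
    and gh: "\<And>f. f \<in> carrier (?F1) \<Longrightarrow> g f = h (res_diff R f)"
    using ext glin unfolding ext1_vanishes_def by blast
  define \<Theta> where "\<Theta> f = \<Psi> f \<ominus> i (h f)" for f
  have \<Theta>c: "\<Theta> f \<in> carrier E" if "f \<in> carrier (?F0)" for f
    using that is_linearD(1)[OF h] is_linearD(1)[OF i] is_linearD(1)[OF \<Psi>] by (simp add: \<Theta>_def)
  have ih: "is_linear R (?F0) E (\<lambda>f. i (h f))" using linear_compose[OF h i] .
  have \<Theta>: "is_linear R (?F0) E \<Theta>"
  proof (rule is_linearI[OF \<Theta>c])
    fix x y assume "x \<in> carrier (?F0)" "y \<in> carrier (?F0)"
    then show "\<Theta> (x \<oplus>\<^bsub>?F0\<^esub> y) = \<Theta> x \<oplus> \<Theta> y"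
      using is_linearD[OF \<Psi>] is_linearD[OF ih]
      by (simp add: \<Theta>_def E.minus_eq E.minus_add E.a_ac)
  next
    fix r x assume r: "r \<in> carrier R" "x \<in> carrier (?F0)"
    have "r \<odot> (u \<ominus> v) = r \<odot> u \<ominus> r \<odot> v" if "u \<in> carrier E" "v \<in> carrier E" for u v
      using r that by (simp add: E.minus_eq E.smult_r_distr E.smult_r_minus)
    then show "\<Theta> (r \<odot>\<^bsub>?F0\<^esub> x) = r \<odot> \<Theta> x"
      using r is_linearD[OF \<Psi>] is_linearD[OF ih] by (simp add: \<Theta>_def)
  qed
  have \<Theta>0: "\<Theta> f = \<zero>" if f: "f \<in> carrier (?F0)" "res_aug R M f = \<zero>\<^bsub>M\<^esub>" for f
  proof -
    obtain e where e: "e \<in> carrier (?F1)" "res_diff R e = f" using aug_exact[OF M f] by blast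
    have "\<Psi> f = i (h f)" using g(2)[OF e(1)] gh[OF e(1)] e(2) by simp
    then show ?thesis using is_linearD(1)[OF ih f(1)] by (simp add: \<Theta>_def E.r_neg E.minus_eq)
  qed
  have \<Theta>cong: "\<Theta> f = \<Theta> f'" if f: "f \<in> carrier (?F0)" "f' \<in> carrier (?F0)" "res_aug R M f = res_aug R M f'" for f f'
  proof -
    have ac: "res_aug R M f' \<in> carrier M" using is_linearD(1)[OF res_aug_linear[OF M]] f by blast
    have "res_aug R M (f \<ominus>\<^bsub>?F0\<^esub> f') = \<zero>\<^bsub>M\<^esub>"
      using linear_minus[OF F M res_aug_linear[OF M] f(1,2)] f(3) ac by (simp add: M.minus_eq M.r_neg)
    then have "\<Theta> f \<ominus> \<Theta> f' = \<zero>"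
      using linear_minus[OF F E \<Theta> f(1,2)] \<Theta>0[of "f \<ominus>\<^bsub>?F0\<^esub> f'"] f by simp
    then show ?thesis using \<Theta>c f
      by (metis E.minus_eq E.minus_equality E.minus_minus E.a_inv_closed)
  qed
  define b where "b x = basis_vector R (Elt x :: ('a, 'm) cell)" for x
  have b: "b x \<in> carrier (?F0)" if "x \<in> carrier M" for x
    unfolding b_def res_module_def using that by (intro basis_vector_closed M.R.ring_axioms) simp
  have ab: "res_aug R M (b x) = x" if "x \<in> carrier M" for x
    unfolding b_def res_aug_def using that by (subst M.linear_extension_basis_vector) auto
  have "is_linear R M E (\<lambda>x. \<Theta> (b x))"
    by (rule is_linearI)
      (auto simp: b \<Theta>c ab is_linearD(2,3)[OF \<Theta>, symmetric] is_linearD(2,3)[OF res_aug_linear[OF M]] intro!: \<Theta>cong)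
  moreover have "p (\<Theta> (b x)) = x" if "x \<in> carrier M" for x
    using that b[OF that] is_linearD(1)[OF h b[OF that]] is_linearD(1)[OF i]
    unfolding \<Theta>_def
    by (subst linear_minus[OF E M p]) (auto simp: is_linearD(1)[OF \<Psi>] p\<Psi> ab pi M.minus_eq)
  ultimately show ?thesis by blast
qed

section \<open>Algebras given by generators and relations\<close>

abbreviation scalars :: "'k::field ring" where "scalars \<equiv> ring_of_type_algebra"

lemma scalars_simps [simp]:
  "carrier scalars = UNIV" "\<zero>\<^bsub>scalars\<^esub> = 0" "\<one>\<^bsub>scalars\<^esub> = 1"
  "a \<oplus>\<^bsub>scalars\<^esub> b = a + b" "a \<otimes>\<^bsub>scalars\<^esub> b = a * b"
  by (simp_all add: ring_of_type_algebra_def)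

lemma ring_scalars: "ring scalars"
  by (rule ring_from_type_algebra)

lemma module_scalars_iff: "module scalars V \<longleftrightarrow> left_module scalars V"
proof
  assume "module scalars V"
  then interpret module scalars V .
  show "left_module scalars V"
    by (intro left_module.intro left_module_axioms.intro ring_scalars abelian_group_axioms)
      (auto simp: smult_l_distr[simplified] smult_r_distr[simplified] smult_assoc1[simplified] smult_one[simplified] intro: smult_closed[simplified])
next
  assume "left_module scalars V"
  then interpret left_module scalars V .
  show "module scalars V"
    by (intro module.intro module_axioms.intro cring_from_type_algebra M.abelian_group_axioms)
      (auto simp: smult_l_distr[simplified] smult_r_distr[simplified] smult_assoc[simplified] smult_one[simplified] intro: smult_closed[simplified])
qed

text \<open>The free algebra is spanned by words, which are built from \<open>1\<close> by left multiplication with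
  generators.\<close>

lemma free_alg_induct [case_names zero one add scal gen]:
  fixes f :: "('g, 'k::field) free_alg"
  assumes "P 0" "P 1" "\<And>f g. P f \<Longrightarrow> P g \<Longrightarrow> P (f + g)" "\<And>c f. P f \<Longrightarrow> P (scal c * f)"
    "\<And>g f. P f \<Longrightarrow> P (gen g * f)"
  shows "P f"
proof -
  have w: "P (Poly_Mapping.single (Word w) 1)" for w
  proof (induction w)
    case Nil
    have "Poly_Mapping.single (Word []) 1 = (1 :: ('g, 'k) free_alg)" by (simp flip: zero_fword_def)
    then show ?case using assms(2) by simp
  next
    case (Cons g w)
    have "Poly_Mapping.single (Word (g # w)) 1 = gen g * (Poly_Mapping.single (Word w) 1 :: ('g, 'k) free_alg)"
      by (simp add: mult_single)
    then show ?case using assms(5)[OF Cons] by simp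
  qed
  have s: "P (Poly_Mapping.single w c)" for w c
  proof -
    have "Poly_Mapping.single w c = scal c * (Poly_Mapping.single w 1 :: ('g, 'k) free_alg)"
      by (simp add: mult_single)
    then show ?thesis using assms(4)[OF w] by (cases w) metis
  qed
  show ?thesis
  proof (induction f rule: update_induct)
    case const
    show ?case by (rule assms(1))
  next
    case (update f a b)
    have "Poly_Mapping.update a b f = Poly_Mapping.single a b + f"
      using update(1) by (intro poly_mapping_eqI) (auto simp: lookup_update lookup_add lookup_single in_keys_iff)
    then show ?case using assms(3)[OF s update(3)] by simp
  qed
qed

definition word_act :: "('g \<Rightarrow> 'v \<Rightarrow> 'v) \<Rightarrow> 'g fword \<Rightarrow> 'v \<Rightarrow> 'v" where
  "word_act \<xi> w v = (case w of Word l \<Rightarrow> foldr \<xi> l v)"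

definition free_act :: "('k::field, 'v, 'd) module_scheme \<Rightarrow> ('g \<Rightarrow> 'v \<Rightarrow> 'v) \<Rightarrow> ('g, 'k) free_alg \<Rightarrow> 'v \<Rightarrow> 'v" where
  "free_act V \<xi> f v = linear_extension scalars V (\<lambda>w. word_act \<xi> w v) (Poly_Mapping.lookup f)"

locale operators = left_module "scalars :: 'k::field ring" V
  for V :: "('k::field, 'v, 'd) module_scheme" (structure) and \<xi> :: "'g \<Rightarrow> 'v \<Rightarrow> 'v" +
  assumes op_linear: "is_linear scalars V V (\<xi> g)"
begin

lemma word_act_closed: "v \<in> carrier V \<Longrightarrow> word_act \<xi> w v \<in> carrier V"
proof -
  assume v: "v \<in> carrier V"
  have "foldr \<xi> l v \<in> carrier V" for l
    using v by (induction l) (auto intro: is_linearD(1)[OF op_linear])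
  then show ?thesis by (simp add: word_act_def split: fword.split)
qed

lemma lookup_free: "Poly_Mapping.lookup (f :: ('g, 'k) free_alg) \<in> carrier (free_module scalars UNIV)"
  by (simp add: free_carrier flip: Poly_Mapping.keys.rep_eq)

lemma free_act_closed: "v \<in> carrier V \<Longrightarrow> free_act V \<xi> f v \<in> carrier V"
  unfolding free_act_def
  by (rule is_linearD(1)[OF linear_extension_linear[of UNIV] lookup_free]) (rule word_act_closed)

lemma free_act_add: "v \<in> carrier V \<Longrightarrow> free_act V \<xi> (f + h) v = free_act V \<xi> f v \<oplus> free_act V \<xi> h v"
  unfolding free_act_def
  using is_linearD(2)[OF linear_extension_linear[of UNIV "\<lambda>w. word_act \<xi> w v"] lookup_free[of f] lookup_free[of h]]
  by (simp add: word_act_closed lookup_add plus_poly_mapping.rep_eq)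

lemma lookup_scal_mult: "Poly_Mapping.lookup (scal c * f) w = c * Poly_Mapping.lookup (f :: ('g, 'k) free_alg) w"
  unfolding mult_map_scale_conv_mult[symmetric] by transfer (simp add: when_def)

lemma free_act_scal: "v \<in> carrier V \<Longrightarrow> free_act V \<xi> (scal c * f) v = c \<odot> free_act V \<xi> f v"
proof -
  assume v: "v \<in> carrier V"
  have "Poly_Mapping.lookup (scal c * f) = c \<odot>\<^bsub>free_module scalars UNIV\<^esub> Poly_Mapping.lookup f"
    by (simp add: lookup_scal_mult fun_eq_iff)
  then show ?thesis unfolding free_act_def
    using is_linearD(3)[OF linear_extension_linear[of UNIV "\<lambda>w. word_act \<xi> w v"] _ lookup_free[of f], of c]
    by (simp add: word_act_closed v del: free_module_simps)
qed

lemma free_act_word: "v \<in> carrier V \<Longrightarrow> free_act V \<xi> (Poly_Mapping.single w 1) v = word_act \<xi> w v"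
proof -
  assume v: "v \<in> carrier V"
  have "Poly_Mapping.lookup (Poly_Mapping.single w 1 :: ('g, 'k) free_alg) = basis_vector scalars w"
    by (auto simp: basis_vector_def lookup_single fun_eq_iff when_def)
  then show ?thesis unfolding free_act_def
    by (simp add: linear_extension_basis_vector word_act_closed[OF v])
qed

lemma word_act_zero: "word_act \<xi> 0 v = v"
  by (simp add: word_act_def zero_fword_def)

lemma free_act_one: "v \<in> carrier V \<Longrightarrow> free_act V \<xi> 1 v = v"
  using free_act_word[of v 0] by (simp add: word_act_zero)

lemma free_act_zero: "v \<in> carrier V \<Longrightarrow> free_act V \<xi> 0 v = \<zero>"
  using free_act_scal[of v 0 0] free_act_closed[of v 0] by (simp add: smult_l_zero[simplified])

lemma free_act_gen: "v \<in> carrier V \<Longrightarrow> free_act V \<xi> (gen g) v = \<xi> g v"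
  using free_act_word[of v "Word [g]"] by (simp add: word_act_def)

lemma free_act_gen_mult:
  assumes v: "v \<in> carrier V"
  shows "free_act V \<xi> (gen g * f) v = \<xi> g (free_act V \<xi> f v)"
proof (induction f rule: update_induct)
  case const
  have "\<xi> g \<zero> = \<zero>" by (rule linear_zero[OF left_module_axioms left_module_axioms op_linear])
  then show ?case by (simp add: free_act_zero v)
next
  case (update f w b)
  have u: "Poly_Mapping.update w b f = scal b * Poly_Mapping.single w 1 + f"
    using update(1) by (intro poly_mapping_eqI) (auto simp: lookup_update lookup_add lookup_single in_keys_iff mult_single)
  have "gen g * Poly_Mapping.update w b f = scal b * (gen g * Poly_Mapping.single w 1) + gen g * f"
    unfolding u by (simp add: mult_single distrib_left)
  moreover have "free_act V \<xi> (gen g * Poly_Mapping.single w 1) v = \<xi> g (word_act \<xi> w v)"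
  proof -
    have "gen g * Poly_Mapping.single w 1 = (Poly_Mapping.single (Word [g] + w) 1 :: ('g, 'k) free_alg)" by (simp add: mult_single)
    then show ?thesis using free_act_word[OF v, of "Word [g] + w"] by (cases w) (simp add: word_act_def)
  qed
  ultimately show ?case unfolding u
    using update(3) word_act_closed[OF v, of w] free_act_closed[OF v, of f]
    by (simp add: free_act_add free_act_scal free_act_word v is_linearD[OF op_linear])
qed

lemma free_act_mult:
  assumes v: "v \<in> carrier V"
  shows "free_act V \<xi> (f * h) v = free_act V \<xi> f (free_act V \<xi> h v)"
proof (induction f rule: free_alg_induct)
  case (scal c f)
  then show ?case by (simp add: free_act_scal v free_act_closed mult.assoc)
next
  case (gen g f)
  then show ?case by (simp add: free_act_gen_mult v free_act_closed mult.assoc)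
qed (simp_all add: free_act_zero free_act_one free_act_add v free_act_closed distrib_right)

lemma smult_commute: "v \<in> carrier V \<Longrightarrow> c \<odot> (d \<odot> v) = d \<odot> (c \<odot> v)"
  using smult_assoc[of c d v] smult_assoc[of d c v] by (simp add: mult.commute)

lemma free_act_linear: "is_linear scalars V V (free_act V \<xi> f)"
proof (induction f rule: free_alg_induct)
  case zero
  then show ?case by (auto simp: is_linear_def free_act_zero)
next
  case one
  then show ?case by (auto simp: is_linear_def free_act_one)
next
  case (add f h)
  show ?case
  proof (rule is_linearI)
    fix x y assume "x \<in> carrier V" "y \<in> carrier V"
    then show "free_act V \<xi> (f + h) (x \<oplus> y) = free_act V \<xi> (f + h) x \<oplus> free_act V \<xi> (f + h) y"
      by (simp add: free_act_add free_act_closed is_linearD(2)[OF add(1)] is_linearD(2)[OF add(2)] M.a_ac)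
  next
    fix r :: 'k and x assume "r \<in> carrier scalars" "x \<in> carrier V"
    then show "free_act V \<xi> (f + h) (r \<odot> x) = r \<odot> free_act V \<xi> (f + h) x"
      by (simp add: free_act_add free_act_closed is_linearD(3)[OF add(1)] is_linearD(3)[OF add(2)] smult_r_distr)
  qed (rule free_act_closed)
next
  case (scal c f)
  show ?case
  proof (rule is_linearI)
    fix x y assume "x \<in> carrier V" "y \<in> carrier V"
    then show "free_act V \<xi> (scal c * f) (x \<oplus> y) = free_act V \<xi> (scal c * f) x \<oplus> free_act V \<xi> (scal c * f) y"
      by (simp add: free_act_scal free_act_closed is_linearD(2)[OF scal] smult_r_distr)
  next
    fix r :: 'k and x assume "r \<in> carrier scalars" "x \<in> carrier V"
    then show "free_act V \<xi> (scal c * f) (r \<odot> x) = r \<odot> free_act V \<xi> (scal c * f) x"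
      by (simp add: free_act_scal free_act_closed is_linearD(3)[OF scal] smult_commute[of _ r c])
  qed (rule free_act_closed)
next
  case (gen g f)
  show ?case
  proof (rule is_linearI)
    fix x y assume "x \<in> carrier V" "y \<in> carrier V"
    then show "free_act V \<xi> (gen g * f) (x \<oplus> y) = free_act V \<xi> (gen g * f) x \<oplus> free_act V \<xi> (gen g * f) y"
      by (simp add: free_act_gen_mult free_act_closed is_linearD(2)[OF gen] is_linearD(2)[OF op_linear])
  next
    fix r :: 'k and x assume "r \<in> carrier scalars" "x \<in> carrier V"
    then show "free_act V \<xi> (gen g * f) (r \<odot> x) = r \<odot> free_act V \<xi> (gen g * f) x"
      by (simp add: free_act_gen_mult free_act_closed is_linearD(3)[OF gen] is_linearD(3)[OF op_linear])
  qed (rule free_act_closed)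
qed

end

lemma ring_free_algebra: "ring (free_algebra :: ('k::field, ('g, 'k) free_alg) module)"
proof (rule ringI)
  show "abelian_group (free_algebra :: ('k, ('g, 'k) free_alg) module)"
  proof (rule abelian_groupI)
    fix x :: "('g, 'k) free_alg"
    show "\<exists>y\<in>carrier free_algebra. y \<oplus>\<^bsub>free_algebra\<^esub> x = \<zero>\<^bsub>free_algebra\<^esub>"
      by (rule bexI[of _ "- x"]) (simp_all add: free_algebra_def)
  qed (simp_all add: free_algebra_def add.assoc add.commute)
  show "Group.monoid (free_algebra :: ('k, ('g, 'k) free_alg) module)"
    by (rule monoidI) (auto simp: free_algebra_def mult.assoc)
qed (auto simp: free_algebra_def distrib_left distrib_right)

lemma free_algebra_simps [simp]:
  "carrier free_algebra = UNIV" "\<zero>\<^bsub>free_algebra\<^esub> = 0" "\<one>\<^bsub>free_algebra\<^esub> = 1"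
  "a \<oplus>\<^bsub>free_algebra\<^esub> b = a + b" "a \<otimes>\<^bsub>free_algebra\<^esub> b = a * b" "c \<odot>\<^bsub>free_algebra\<^esub> a = scal c * a"
  by (simp_all add: free_algebra_def)

lemma minus_free_algebra [simp]: "\<ominus>\<^bsub>free_algebra\<^esub> a = - a"
proof -
  interpret F: ring free_algebra by (rule ring_free_algebra)
  show ?thesis by (rule F.minus_equality) simp_all
qed

lemma scal_commute: "f * scal c = scal c * (f :: ('g, 'k::field) free_alg)"
proof (induction f rule: free_alg_induct)
  case (scal d f)
  have "scal d * scal c = scal c * (scal d :: ('g, 'k) free_alg)" by (simp add: mult_single mult.commute)
  then have "scal d * (scal c * f) = scal c * (scal d * f)" by (simp only: flip: mult.assoc)
  then show ?case using scal by (simp add: mult.assoc)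
next
  case (gen g f)
  have "gen g * scal c = scal c * (gen g :: ('g, 'k) free_alg)" by (simp add: mult_single)
  then have "gen g * (scal c * f) = scal c * (gen g * f)" by (simp only: flip: mult.assoc)
  then show ?case using gen by (simp add: mult.assoc)
qed (auto simp: distrib_left distrib_right)

text \<open>In this locale \<open>proj f\<close> is the class of \<open>f\<close>; every element of the quotient is of this form, and all
  computations there are reduced to the free algebra.\<close>

locale presented_algebra =
  fixes rels :: "('g, 'k::field) free_alg set"
begin

definition rel_ideal :: "('g, 'k) free_alg set" where
  "rel_ideal = Idl\<^bsub>free_algebra\<^esub> rels"

definition alg :: "('k, ('g, 'k) free_alg set) module" where
  "alg = quotient_algebra free_algebra rel_ideal"

definition proj :: "('g, 'k) free_alg \<Rightarrow> ('g, 'k) free_alg set" where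
  "proj f = rel_ideal +>\<^bsub>free_algebra\<^esub> f"

sublocale I: ideal rel_ideal free_algebra
  unfolding rel_ideal_def
  by (rule ring.genideal_ideal[OF ring_free_algebra]) simp

lemma rels_in: "r \<in> rels \<Longrightarrow> r \<in> rel_ideal"
  unfolding rel_ideal_def using ring.genideal_self[OF ring_free_algebra, of rels] by auto

lemma ideal_add: "a \<in> rel_ideal \<Longrightarrow> b \<in> rel_ideal \<Longrightarrow> a + b \<in> rel_ideal"
  using additive_subgroup.a_closed[OF I.additive_subgroup_axioms, of a b] by simp

lemma ideal_left: "a \<in> rel_ideal \<Longrightarrow> b * a \<in> rel_ideal"
  using I.I_l_closed by simp

lemma ideal_right: "a \<in> rel_ideal \<Longrightarrow> a * b \<in> rel_ideal"
  using I.I_r_closed by simp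

lemma ideal_minimal:
  assumes "rels \<subseteq> J" "0 \<in> J" "\<And>a b. a \<in> J \<Longrightarrow> b \<in> J \<Longrightarrow> a + b \<in> J"
    "\<And>a b. a \<in> J \<Longrightarrow> b * a \<in> J" "\<And>a b. a \<in> J \<Longrightarrow> a * b \<in> J"
  shows "rel_ideal \<subseteq> J"
proof -
  have neg: "- a \<in> J" if "a \<in> J" for a using assms(4)[OF that, of "- 1"] by simp
  have "ideal J free_algebra"
  proof (rule idealI[OF ring_free_algebra])
    have "inv\<^bsub>add_monoid free_algebra\<^esub> a = - a" for a :: "('g, 'k) free_alg"
      using minus_free_algebra[of a] by (simp only: a_inv_def)
    then show "subgroup J (add_monoid free_algebra)"
      by (intro subgroup.intro) (use assms neg in auto)
  qed (use assms in auto)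
  then show ?thesis unfolding rel_ideal_def by (rule ring.genideal_minimal[OF ring_free_algebra _ assms(1)])
qed

lemma alg_carrier: "carrier alg = range proj"
  by (auto simp: alg_def quotient_algebra_def FactRing_def A_RCOSETS_def' proj_def)

lemma proj_closed [simp]: "proj f \<in> carrier alg"
  by (simp add: alg_carrier)

lemma proj_add: "proj f \<oplus>\<^bsub>alg\<^esub> proj h = proj (f + h)"
  using I.a_rcos_sum[of f h] by (simp add: alg_def quotient_algebra_def FactRing_def proj_def)

lemma proj_mult: "proj f \<otimes>\<^bsub>alg\<^esub> proj h = proj (f * h)"
  using I.rcoset_mult_add[of f h] by (simp add: alg_def quotient_algebra_def FactRing_def proj_def)

lemma proj_one: "\<one>\<^bsub>alg\<^esub> = proj 1"
  by (simp add: alg_def quotient_algebra_def FactRing_def proj_def)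

lemma proj_zero: "\<zero>\<^bsub>alg\<^esub> = proj 0"
  using I.a_rcos_const[OF additive_subgroup.zero_closed[OF I.additive_subgroup_axioms]] by (simp add: alg_def quotient_algebra_def FactRing_def proj_def)

lemma proj_eq_iff: "proj f = proj h \<longleftrightarrow> f - h \<in> rel_ideal"
  using ring.quotient_eq_iff_same_a_r_cos[OF ring_free_algebra I.ideal_axioms, of f h]
  by (simp add: proj_def a_minus_def)

lemma proj_smult: "c \<odot>\<^bsub>alg\<^esub> proj f = proj (scal c * f)"
proof -
  have "proj (scal c * a) = proj (scal c * f)" if "a \<in> proj f" for a
  proof -
    from that obtain i where "i \<in> rel_ideal" "a = i + f" by (auto simp: a_r_coset_def' proj_def)
    then have "scal c * a - scal c * f \<in> rel_ideal" using ideal_left[of i "scal c"] by (simp add: distrib_left)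
    then show ?thesis by (simp add: proj_eq_iff)
  qed
  moreover have "f \<in> proj f" using I.a_rcos_self[of f] by (simp add: proj_def)
  ultimately have "(\<Union>a\<in>proj f. proj (scal c * a)) = proj (scal c * f)" by blast
  then show ?thesis by (simp add: alg_def quotient_algebra_def proj_def)
qed

lemma alg_cases:
  assumes "r \<in> carrier alg"
  obtains f where "r = proj f"
  using assms by (auto simp: alg_carrier)

lemma ring_alg: "ring alg"
proof (rule ringI)
  show "abelian_group alg"
  proof (rule abelian_groupI)
    fix x assume "x \<in> carrier alg"
    then obtain f where "x = proj f" by (rule alg_cases)
    then show "\<exists>y\<in>carrier alg. y \<oplus>\<^bsub>alg\<^esub> x = \<zero>\<^bsub>alg\<^esub>"
      by (intro bexI[of _ "proj (- f)"]) (auto simp: proj_add proj_zero)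
  qed (auto simp: alg_carrier proj_add proj_zero add.assoc add.commute add.left_commute)
  show "Group.monoid alg"
    by (rule monoidI) (auto simp: alg_carrier proj_mult proj_one mult.assoc)
qed (auto simp: alg_carrier proj_mult proj_add distrib_left distrib_right)

lemma scal_add: "scal (a + b) = scal a + (scal b :: ('g, 'k) free_alg)"
  by (simp add: single_add)

lemma scal_mult: "scal (a * b) = scal a * (scal b :: ('g, 'k) free_alg)"
  by (simp add: mult_single)

lemma k_algebra_alg: "k_algebra alg"
proof -
  interpret A: ring alg by (rule ring_alg)
  have "left_module scalars alg"
    by (intro left_module.intro left_module_axioms.intro ring_scalars A.is_abelian_group)
      (auto simp: alg_carrier proj_smult proj_add scal_add scal_mult distrib_left distrib_right mult.assoc)
  then interpret module scalars alg by (simp add: module_scalars_iff)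
  show ?thesis
    by (intro k_algebra.intro k_algebra_axioms.intro module_axioms ring_alg)
      (auto simp: alg_carrier proj_smult proj_mult mult.assoc scal_commute[THEN arg_cong[where f="\<lambda>x. x * _"], unfolded mult.assoc])
qed

section \<open>Modules from operators\<close>

text \<open>An element of the quotient acts through an arbitrary representative. This is meaningful if the
  relations act as zero, as they do in \<open>represented_algebra\<close>.\<close>

definition module_of_operators :: "('k, 'v, 'd) module_scheme \<Rightarrow> ('g \<Rightarrow> 'v \<Rightarrow> 'v) \<Rightarrow> (('g, 'k) free_alg set, 'v) module" where
  "module_of_operators V \<xi> =
    \<lparr>carrier = carrier V, monoid.mult = undefined, one = undefined, ring.zero = \<zero>\<^bsub>V\<^esub>, add = add V,
     module.smult = (\<lambda>r v. free_act V \<xi> (SOME f. proj f = r) v)\<rparr>"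

lemma module_of_operators_simps [simp]:
  "carrier (module_of_operators V \<xi>) = carrier V"
  "\<zero>\<^bsub>module_of_operators V \<xi>\<^esub> = \<zero>\<^bsub>V\<^esub>"
  "v \<oplus>\<^bsub>module_of_operators V \<xi>\<^esub> w = v \<oplus>\<^bsub>V\<^esub> w"
  by (simp_all add: module_of_operators_def)

end

locale represented_algebra = presented_algebra rels + operators V \<xi>
  for rels :: "('g, 'k::field) free_alg set" and V :: "('k, 'v, 'd) module_scheme" and \<xi> :: "'g \<Rightarrow> 'v \<Rightarrow> 'v" +
  assumes rels_act: "r \<in> rels \<Longrightarrow> v \<in> carrier V \<Longrightarrow> free_act V \<xi> r v = \<zero>\<^bsub>V\<^esub>"
begin

lemma ideal_act: "f \<in> rel_ideal \<Longrightarrow> v \<in> carrier V \<Longrightarrow> free_act V \<xi> f v = \<zero>\<^bsub>V\<^esub>"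
proof -
  let ?J = "{f. \<forall>v\<in>carrier V. free_act V \<xi> f v = \<zero>\<^bsub>V\<^esub>}"
  have "free_act V \<xi> f \<zero>\<^bsub>V\<^esub> = \<zero>\<^bsub>V\<^esub>" for f
    by (rule linear_zero[OF left_module_axioms left_module_axioms free_act_linear])
  then have "rel_ideal \<subseteq> ?J"
    by (intro ideal_minimal) (auto simp: rels_act free_act_zero free_act_add free_act_mult free_act_closed)
  then show "f \<in> rel_ideal \<Longrightarrow> v \<in> carrier V \<Longrightarrow> free_act V \<xi> f v = \<zero>\<^bsub>V\<^esub>" by auto
qed

lemma free_act_cong:
  assumes "proj f = proj h" "v \<in> carrier V"
  shows "free_act V \<xi> f v = free_act V \<xi> h v"
proof -
  have "free_act V \<xi> (f - h) v = \<zero>\<^bsub>V\<^esub>" using assms by (simp add: proj_eq_iff ideal_act)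
  then have "free_act V \<xi> ((f - h) + h) v = free_act V \<xi> h v"
    unfolding free_act_add[OF assms(2)] using free_act_closed[OF assms(2)] by simp
  then show ?thesis by simp
qed

lemma proj_act: "v \<in> carrier V \<Longrightarrow> proj f \<odot>\<^bsub>module_of_operators V \<xi>\<^esub> v = free_act V \<xi> f v"
proof -
  assume v: "v \<in> carrier V"
  have "proj (SOME h. proj h = proj f) = proj f" by (rule someI) (rule refl)
  from free_act_cong[OF this v] show ?thesis by (simp add: module_of_operators_def)
qed

lemma left_module_of_operators: "left_module alg (module_of_operators V \<xi>)"
proof -
  have ag: "abelian_group (module_of_operators V \<xi>)"
  proof (rule abelian_groupI)
    fix x assume "x \<in> carrier (module_of_operators V \<xi>)"
    then show "\<exists>y\<in>carrier (module_of_operators V \<xi>). y \<oplus>\<^bsub>module_of_operators V \<xi>\<^esub> x = \<zero>\<^bsub>module_of_operators V \<xi>\<^esub>"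
      by (intro bexI[of _ "\<ominus>\<^bsub>V\<^esub> x"]) (simp_all add: M.l_neg)
  qed (simp_all add: M.a_ac)
  show ?thesis
    by (intro left_module.intro left_module_axioms.intro ring_alg ag)
      (auto simp: alg_carrier proj_act free_act_closed proj_add proj_mult proj_one free_act_add free_act_mult
        free_act_one is_linearD(2)[OF free_act_linear])
qed

end

context presented_algebra
begin

text \<open>A map that commutes with scalars and generators commutes with everything they generate.\<close>

lemma is_linear_algI:
  assumes M: "left_module alg M" and N: "left_module alg N"
    and closed: "\<And>m. m \<in> carrier M \<Longrightarrow> u m \<in> carrier N"
    and add: "\<And>m m'. m \<in> carrier M \<Longrightarrow> m' \<in> carrier M \<Longrightarrow> u (m \<oplus>\<^bsub>M\<^esub> m') = u m \<oplus>\<^bsub>N\<^esub> u m'"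
    and scal: "\<And>c m. m \<in> carrier M \<Longrightarrow> u (proj (scal c) \<odot>\<^bsub>M\<^esub> m) = proj (scal c) \<odot>\<^bsub>N\<^esub> u m"
    and gen: "\<And>g m. m \<in> carrier M \<Longrightarrow> u (proj (gen g) \<odot>\<^bsub>M\<^esub> m) = proj (gen g) \<odot>\<^bsub>N\<^esub> u m"
  shows "is_linear alg M N u"
proof (rule is_linearI)
  interpret M: left_module alg M by fact
  interpret N: left_module alg N by fact
  have "u (proj f \<odot>\<^bsub>M\<^esub> m) = proj f \<odot>\<^bsub>N\<^esub> u m" if m: "m \<in> carrier M" for f m
  proof (induction f rule: free_alg_induct)
    case zero
    have "u \<zero>\<^bsub>M\<^esub> \<oplus>\<^bsub>N\<^esub> u \<zero>\<^bsub>M\<^esub> = u \<zero>\<^bsub>M\<^esub>" using add[of "\<zero>\<^bsub>M\<^esub>" "\<zero>\<^bsub>M\<^esub>"] by simp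
    then have "u \<zero>\<^bsub>M\<^esub> = \<zero>\<^bsub>N\<^esub>" using closed[of "\<zero>\<^bsub>M\<^esub>"] by (metis N.add.l_cancel_one' M.zero_closed)
    then show ?case using m closed[OF m] by (simp flip: proj_zero)
  next
    case one
    show ?case using m closed[OF m] by (simp flip: proj_one)
  next
    case (add f h)
    then show ?case using m closed[OF m] assms(4) by (simp flip: proj_add add: M.smult_l_distr N.smult_l_distr)
  next
    case (scal c f)
    then show ?case using m closed[OF m] assms(5) by (simp flip: proj_mult add: M.smult_assoc N.smult_assoc)
  next
    case (gen g f)
    then show ?case using m closed[OF m] assms(6) by (simp flip: proj_mult add: M.smult_assoc N.smult_assoc)
  qed
  then show "u (r \<odot>\<^bsub>M\<^esub> x) = r \<odot>\<^bsub>N\<^esub> u x" if "r \<in> carrier alg" "x \<in> carrier M" for r x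
    using that by (auto simp: alg_carrier)
qed (use assms in auto)

lemma left_module_restrict:
  assumes "left_module alg M"
  shows "left_module scalars (restrict_to_field alg M)"
proof -
  interpret M: left_module alg M by fact
  have ag: "abelian_group (restrict_to_field alg M)"
  proof (rule abelian_groupI)
    fix x assume "x \<in> carrier (restrict_to_field alg M)"
    then show "\<exists>y\<in>carrier (restrict_to_field alg M). y \<oplus>\<^bsub>restrict_to_field alg M\<^esub> x = \<zero>\<^bsub>restrict_to_field alg M\<^esub>"
      by (intro bexI[of _ "\<ominus>\<^bsub>M\<^esub> x"]) (simp_all add: restrict_to_field_def M.l_neg)
  qed (simp_all add: restrict_to_field_def M.a_ac)
  show ?thesis
    by (intro left_module.intro left_module_axioms.intro ring_scalars ag)
      (auto simp: restrict_to_field_def proj_one proj_smult scal_add scal_mult M.smult_l_distr M.smult_r_distr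
         simp flip: proj_add proj_mult M.smult_assoc, simp_all flip: proj_one)
qed

lemma restrict_simps [simp]:
  "carrier (restrict_to_field A M) = carrier M"
  "\<zero>\<^bsub>restrict_to_field A M\<^esub> = \<zero>\<^bsub>M\<^esub>"
  "v \<oplus>\<^bsub>restrict_to_field A M\<^esub> w = v \<oplus>\<^bsub>M\<^esub> w"
  by (simp_all add: restrict_to_field_def)

lemma restrict_smult: "c \<odot>\<^bsub>restrict_to_field alg M\<^esub> m = proj (scal c) \<odot>\<^bsub>M\<^esub> m"
  by (simp add: restrict_to_field_def proj_one proj_smult)

end

section \<open>The quantum exterior algebra in coordinates\<close>

datatype monomial = M1 | Mx | My | Mz | Mxy | Myz | Mzx | Mxyz

lemma UNIV_monomial: "(UNIV :: monomial set) = {M1, Mx, My, Mz, Mxy, Myz, Mzx, Mxyz}"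
  using monomial.exhaust by auto

lemma finite_monomial [simp]: "finite (A :: monomial set)"
  by (rule finite_subset[OF subset_UNIV]) (simp add: UNIV_monomial)

lemma sum_monomial: "(\<Sum>m\<in>UNIV. f m) = f M1 + f Mx + f My + f Mz + f Mxy + f Myz + f Mzx + f Mxyz"
  for f :: "monomial \<Rightarrow> 'a::comm_monoid_add"
  by (simp add: UNIV_monomial add.assoc)

lemma all_monomial: "(\<forall>m. P m) \<longleftrightarrow> P M1 \<and> P Mx \<and> P My \<and> P Mz \<and> P Mxy \<and> P Myz \<and> P Mzx \<and> P Mxyz"
proof (intro iffI allI)
  fix m assume "P M1 \<and> P Mx \<and> P My \<and> P Mz \<and> P Mxy \<and> P Myz \<and> P Mzx \<and> P Mxyz"
  then show "P m" by (cases m) simp_all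
qed simp

text \<open>The product of \<open>\<Lambda>\<^sub>q\<close> in the basis \<open>1, x, y, z, xy, yz, zx, xyz\<close>. The choice of \<open>zx\<close> instead of \<open>xz\<close> makes
  it invariant under cyclic permutations of the generators. The relations imply
  \<open>xyz = yzx = zxy\<close>, so each monomial has a unique partner, and in both orders their product is
  \<open>xyz\<close> with coefficient \<open>1\<close>.\<close>

definition monomial_mult :: "'k::field \<Rightarrow> (monomial \<Rightarrow> 'k) \<Rightarrow> (monomial \<Rightarrow> 'k) \<Rightarrow> (monomial \<Rightarrow> 'k)" where
  "monomial_mult q a b m = (case m of
     M1 \<Rightarrow> a M1 * b M1
   | Mx \<Rightarrow> a M1 * b Mx + a Mx * b M1
   | My \<Rightarrow> a M1 * b My + a My * b M1
   | Mz \<Rightarrow> a M1 * b Mz + a Mz * b M1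
   | Mxy \<Rightarrow> a M1 * b Mxy + a Mxy * b M1 + a Mx * b My - q * (a My * b Mx)
   | Myz \<Rightarrow> a M1 * b Myz + a Myz * b M1 + a My * b Mz - q * (a Mz * b My)
   | Mzx \<Rightarrow> a M1 * b Mzx + a Mzx * b M1 + a Mz * b Mx - q * (a Mx * b Mz)
   | Mxyz \<Rightarrow> a M1 * b Mxyz + a Mx * b Myz + a My * b Mzx + a Mz * b Mxy
        + a Mxy * b Mz + a Myz * b Mx + a Mzx * b My + a Mxyz * b M1)"

definition unit_coeff :: "monomial \<Rightarrow> monomial \<Rightarrow> 'k::field" where
  "unit_coeff m n = (if n = m then 1 else 0)"

primrec gen_monomial :: "xyz \<Rightarrow> monomial" where
  "gen_monomial Gx = Mx" | "gen_monomial Gy = My" | "gen_monomial Gz = Mz"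

definition gen_mult :: "'k::field \<Rightarrow> xyz \<Rightarrow> (monomial \<Rightarrow> 'k) \<Rightarrow> (monomial \<Rightarrow> 'k)" where
  "gen_mult q g = monomial_mult q (unit_coeff (gen_monomial g))"

lemma monomial_mult_assoc:
  "monomial_mult q (monomial_mult q a b) c = monomial_mult q a (monomial_mult q b c)"
  by (simp add: fun_eq_iff all_monomial monomial_mult_def algebra_simps)

lemma monomial_mult_add: "monomial_mult q (\<lambda>m. a m + b m) c = (\<lambda>m. monomial_mult q a c m + monomial_mult q b c m)"
  by (simp add: fun_eq_iff all_monomial monomial_mult_def algebra_simps)

lemma monomial_mult_scal: "monomial_mult q (\<lambda>m. r * a m) c = (\<lambda>m. r * monomial_mult q a c m)"
  by (simp add: fun_eq_iff all_monomial monomial_mult_def algebra_simps)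

lemma monomial_mult_minus: "monomial_mult q (\<lambda>m. - a m) c = (\<lambda>m. - monomial_mult q a c m)"
  by (simp add: fun_eq_iff all_monomial monomial_mult_def algebra_simps)

lemma monomial_mult_linear:
  "monomial_mult q a (\<lambda>m. b m + c m) = (\<lambda>m. monomial_mult q a b m + monomial_mult q a c m)"
  "monomial_mult q a (\<lambda>m. r * b m) = (\<lambda>m. r * monomial_mult q a b m)"
  by (simp_all add: fun_eq_iff all_monomial monomial_mult_def algebra_simps)

lemma monomial_mult_zero: "monomial_mult q (\<lambda>_. 0) c = (\<lambda>_. 0)"
  by (simp add: fun_eq_iff all_monomial monomial_mult_def)

lemma monomial_mult_sum: "monomial_mult q a c n = (\<Sum>m\<in>UNIV. c m * monomial_mult q a (unit_coeff m) n)"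
  by (cases n) (simp_all add: sum_monomial monomial_mult_def unit_coeff_def algebra_simps)

lemma monomial_mult_one: "monomial_mult q (unit_coeff M1) a = a" "monomial_mult q a (unit_coeff M1) = a"
  by (simp_all add: fun_eq_iff all_monomial monomial_mult_def unit_coeff_def)

primrec mon :: "monomial \<Rightarrow> (xyz, 'k::field) free_alg" where
  "mon M1 = 1" | "mon Mx = gen Gx" | "mon My = gen Gy" | "mon Mz = gen Gz"
| "mon Mxy = gen Gx * gen Gy" | "mon Myz = gen Gy * gen Gz" | "mon Mzx = gen Gz * gen Gx"
| "mon Mxyz = gen Gx * (gen Gy * gen Gz)"

definition poly_of :: "(monomial \<Rightarrow> 'k::field) \<Rightarrow> (xyz, 'k) free_alg" where
  "poly_of c = (\<Sum>m\<in>UNIV. scal (c m) * mon m)"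

lemma free_module_UNIV_carrier [simp]: "carrier (free_module scalars (UNIV :: monomial set)) = UNIV"
  by (auto simp: free_carrier)

locale qext =
  fixes q :: "'k::field"
  assumes q: "q \<noteq> 0"

sublocale qext \<subseteq> presented_algebra "qext_relations q" .

lemma monomial_mult_gens:
  "monomial_mult q (unit_coeff m) (unit_coeff m) = (\<lambda>_. 0)" if "m = Mx \<or> m = My \<or> m = Mz"
  using that by (auto simp: fun_eq_iff all_monomial monomial_mult_def unit_coeff_def)

lemma monomial_mult_skew:
  "monomial_mult q (unit_coeff My) (unit_coeff Mx) = (\<lambda>m. - q * monomial_mult q (unit_coeff Mx) (unit_coeff My) m)"
  "monomial_mult q (unit_coeff Mz) (unit_coeff My) = (\<lambda>m. - q * monomial_mult q (unit_coeff My) (unit_coeff Mz) m)"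
  "monomial_mult q (unit_coeff Mx) (unit_coeff Mz) = (\<lambda>m. - q * monomial_mult q (unit_coeff Mz) (unit_coeff Mx) m)"
  by (simp_all add: fun_eq_iff all_monomial) (simp_all add: monomial_mult_def unit_coeff_def)

sublocale qext \<subseteq> represented_algebra "qext_relations q" "free_module (scalars :: 'k ring) (UNIV :: monomial set)" "gen_mult q"
proof -
  interpret V: left_module scalars "free_module (scalars :: 'k ring) (UNIV :: monomial set)"
    by (rule left_module_free) (rule ring_scalars)
  interpret V: operators "free_module (scalars :: 'k ring) (UNIV :: monomial set)" "gen_mult q"
  proof
    show "is_linear scalars (free_module scalars UNIV) (free_module scalars UNIV) (gen_mult q g)" for g
      by (rule is_linearI) (simp_all add: gen_mult_def monomial_mult_linear)
  qed
  have gg: "gen_mult q g (gen_mult q h v) = monomial_mult q (monomial_mult q (unit_coeff (gen_monomial g)) (unit_coeff (gen_monomial h))) v" for g h v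
    by (simp add: gen_mult_def monomial_mult_assoc)
  show "represented_algebra (qext_relations q) (free_module (scalars :: 'k ring) (UNIV :: monomial set)) (gen_mult q)"
  proof
    fix r v assume "r \<in> qext_relations q" "v \<in> carrier (free_module (scalars :: 'k ring) (UNIV :: monomial set))"
    then show "free_act (free_module scalars UNIV) (gen_mult q) r v = \<zero>\<^bsub>free_module scalars (UNIV :: monomial set)\<^esub>"
      unfolding qext_relations_def Let_def
      by (auto simp: V.free_act_add V.free_act_scal V.free_act_gen_mult V.free_act_gen gg monomial_mult_gens
          monomial_mult_skew monomial_mult_scal monomial_mult_minus monomial_mult_zero)
  qed
qed

context qext
begin

lemma alg_eq: "alg = qext_algebra q"
  by (simp add: alg_def rel_ideal_def qext_algebra_def)

definition coords :: "(xyz, 'k) free_alg \<Rightarrow> monomial \<Rightarrow> 'k" where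
  "coords f = free_act (free_module scalars UNIV) (gen_mult q) f (unit_coeff M1)"

lemma free_act_eq_mult: "free_act (free_module scalars UNIV) (gen_mult q) f v = monomial_mult q (coords f) v"
  unfolding coords_def
proof (induction f rule: free_alg_induct)
  case (add f g)
  then show ?case by (simp add: free_act_add monomial_mult_add)
next
  case (scal c f)
  then show ?case by (simp add: free_act_scal monomial_mult_scal)
next
  case (gen g f)
  then show ?case by (simp add: free_act_gen_mult gen_mult_def[of q g] monomial_mult_assoc)
qed (simp_all add: free_act_zero free_act_one monomial_mult_one monomial_mult_zero)

lemma coords_mult: "coords (f * h) = monomial_mult q (coords f) (coords h)"
  unfolding coords_def[of "f * h"] by (subst free_act_mult) (simp_all add: free_act_eq_mult monomial_mult_one)

lemma coords_add: "coords (f + h) m = coords f m + coords h m"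
  by (simp add: coords_def free_act_add)

lemma coords_scal: "coords (scal c * f) m = c * coords f m"
  by (simp add: coords_def free_act_scal)

lemma coords_one: "coords 1 = unit_coeff M1"
  by (simp add: coords_def free_act_one)

lemma coords_zero: "coords 0 m = 0"
  by (simp add: coords_def free_act_zero)

lemma coords_gen: "coords (gen g) = unit_coeff (gen_monomial g)"
  by (simp add: coords_def free_act_gen gen_mult_def monomial_mult_one)

lemma coords_cong: "proj f = proj h \<Longrightarrow> coords f = coords h"
  unfolding coords_def by (rule free_act_cong) auto

lemma coords_mon: "coords (mon m) = unit_coeff m"
  by (cases m) (simp_all add: coords_one coords_gen coords_mult,
      simp_all add: fun_eq_iff all_monomial monomial_mult_def unit_coeff_def)

lemma coords_poly_of: "coords (poly_of c) = c"
  by (simp add: poly_of_def sum_monomial coords_add coords_scal coords_mon fun_eq_iff all_monomial del: mon.simps)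
    (simp add: unit_coeff_def)

lemma proj_add_cong: "proj a = proj b \<Longrightarrow> proj c = proj d \<Longrightarrow> proj (a + c) = proj (b + d)"
  by (simp flip: proj_add)

lemma proj_scal_cong: "proj a = proj b \<Longrightarrow> proj (scal c * a) = proj (scal c * b)"
  by (simp flip: proj_smult)

lemma proj_sum_cong: "(\<And>m. m \<in> A \<Longrightarrow> proj (a m) = proj (b m)) \<Longrightarrow> proj (\<Sum>m\<in>A. a m) = proj (\<Sum>m\<in>A. b m)"
  by (induction A rule: infinite_finite_induct) (auto intro!: proj_add_cong)

lemma scal_sum: "scal (\<Sum>m\<in>A. c m) = (\<Sum>m\<in>A. scal (c m) :: (xyz, 'k) free_alg)"
  by (induction A rule: infinite_finite_induct) (simp_all add: scal_add)

lemma proj_eqI: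
  assumes "a - b = u * r * v + u' * r' * v'" "r \<in> rel_ideal" "r' \<in> rel_ideal"
  shows "proj a = proj b"
  unfolding proj_eq_iff assms(1) by (intro ideal_add ideal_right ideal_left assms)

text \<open>Every element is congruent to a combination of the eight monomials, with coefficients given by
  its action on \<open>1\<close>. It suffices that left multiplication with a generator preserves such
  combinations, which is a table of 24 products.\<close>

lemma proj_poly_of: "proj (poly_of (coords f)) = proj f"
proof (induction f rule: free_alg_induct)
  case zero
  then show ?case by (simp add: poly_of_def coords_zero)
next
  case one
  then show ?case by (simp add: poly_of_def coords_one sum_monomial) (simp add: unit_coeff_def)
next
  case (add f g)
  have "poly_of (coords (f + g)) = poly_of (coords f) + poly_of (coords g)"
    by (simp add: poly_of_def coords_add scal_add distrib_right sum.distrib)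
  then show ?case using proj_add_cong[OF add] by simp
next
  case (scal c f)
  have "poly_of (coords (scal c * f)) = scal c * poly_of (coords f)"
    by (simp add: poly_of_def coords_scal scal_mult mult.assoc sum_distrib_left)
  then show ?case using proj_scal_cong[OF scal] by simp
next
  case (gen g f)
  \<comment> \<open>The factor \<open>t = 1/q\<close> occurs when \<open>yzx\<close> and \<open>zxy\<close> are rewritten to \<open>xyz\<close>.\<close>
  define s t where "s = (scal q :: (xyz, 'k) free_alg)" and "t = (scal (1 / q) :: (xyz, 'k) free_alg)"
  define x y z where "x = (gen Gx :: (xyz, 'k) free_alg)" and "y = (gen Gy :: (xyz, 'k) free_alg)" and "z = (gen Gz :: (xyz, 'k) free_alg)"
  have ts: "t * s = 1" using q by (simp add: s_def t_def mult_single)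
  have tsa: "t * (s * a) = a" for a using ts by (simp flip: mult.assoc)
  have sc: "a * s = s * a" "a * t = t * a" for a unfolding s_def t_def by (rule scal_commute)+
  have sca: "a * (s * b) = s * (a * b)" "a * (t * b) = t * (a * b)" for a b
    unfolding mult.assoc[symmetric] sc[of a] by simp_all
  have rel: "x * x \<in> rel_ideal" "y * y \<in> rel_ideal" "z * z \<in> rel_ideal" "y * x + s * (x * y) \<in> rel_ideal"
    "z * y + s * (y * z) \<in> rel_ideal" "x * z + s * (z * x) \<in> rel_ideal"
    by (rule rels_in, simp add: qext_relations_def Let_def s_def x_def y_def z_def)+
  note ring = algebra_simps sc[of x] sc[of y] sc[of z] sca[of x] sca[of y] sca[of z] tsa
  have sq: "scal (- q) = - s" by (simp add: s_def single_uminus)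
  note gens_eq = x_def[symmetric] y_def[symmetric] z_def[symmetric]
  have t0: "proj (x * x) = proj 0"
    by (rule proj_eqI[where u = 1 and v = 1 and u' = 0, OF _ rel(1) rel(1)]) simp
  have t1: "proj (x * z) = proj (- s * (z * x))"
    by (rule proj_eqI[where u = 1 and v = 1 and u' = 0, OF _ rel(6) rel(1)]) (simp add: ring)
  have t2: "proj (x * (x * y)) = proj 0"
    by (rule proj_eqI[where u = 1 and v = y and u' = 0, OF _ rel(1) rel(1)]) (simp add: ring)
  have t3: "proj (x * (z * x)) = proj 0"
    by (rule proj_eqI[where u = 1 and v = x and u' = "- s * z" and v' = 1, OF _ rel(6) rel(1)]) (simp add: ring)
  have t4: "proj (x * (x * (y * z))) = proj 0"
    by (rule proj_eqI[where u = 1 and v = "y * z" and u' = 0, OF _ rel(1) rel(1)]) (simp add: ring)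
  have t5: "proj (y * y) = proj 0"
    by (rule proj_eqI[where u = 1 and v = 1 and u' = 0, OF _ rel(2) rel(1)]) simp
  have t6: "proj (y * x) = proj (- s * (x * y))"
    by (rule proj_eqI[where u = 1 and v = 1 and u' = 0, OF _ rel(4) rel(1)]) (simp add: ring)
  have t7: "proj (y * (x * y)) = proj 0"
    by (rule proj_eqI[where u = 1 and v = y and u' = "- s * x" and v' = 1, OF _ rel(4) rel(2)]) (simp add: ring)
  have t8: "proj (y * (y * z)) = proj 0"
    by (rule proj_eqI[where u = 1 and v = z and u' = 0, OF _ rel(2) rel(1)]) (simp add: ring)
  have t9: "proj (y * (z * x)) = proj (x * (y * z))"
    by (rule proj_eqI[where u = "t * y" and v = 1 and u' = "- t" and v' = z, OF _ rel(6) rel(4)]) (simp add: ring)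
  have t10: "proj (y * (x * (y * z))) = proj 0"
    by (rule proj_eqI[where u = 1 and v = "y * z" and u' = "- s * x" and v' = z, OF _ rel(4) rel(2)]) (simp add: ring)
  have t11: "proj (z * z) = proj 0"
    by (rule proj_eqI[where u = 1 and v = 1 and u' = 0, OF _ rel(3) rel(1)]) simp
  have t12: "proj (z * y) = proj (- s * (y * z))"
    by (rule proj_eqI[where u = 1 and v = 1 and u' = 0, OF _ rel(5) rel(1)]) (simp add: ring)
  have t13: "proj (z * (x * y)) = proj (x * (y * z))"
    by (rule proj_eqI[where u = t and v = y and u' = "- t * x" and v' = 1, OF _ rel(6) rel(5)]) (simp add: ring)
  have t14: "proj (z * (y * z)) = proj 0"
    by (rule proj_eqI[where u = 1 and v = z and u' = "- s * y" and v' = 1, OF _ rel(5) rel(3)]) (simp add: ring)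
  have t15: "proj (z * (z * x)) = proj 0"
    by (rule proj_eqI[where u = 1 and v = x and u' = 0, OF _ rel(3) rel(1)]) (simp add: ring)
  have t16: "proj (z * (x * (y * z))) = proj 0"
    proof -
      have "z * (x * (y * z)) - 0 = t * ((x * z + s * (z * x)) * y - x * (z * y + s * (y * z))) * z + x * y * (z * z)"
        by (simp add: ring)
      moreover have "(x * z + s * (z * x)) * y - x * (z * y + s * (y * z)) \<in> rel_ideal"
        using ideal_add[OF ideal_right[OF rel(6), of y] ideal_left[OF ideal_left[OF rel(5), of x], of "-1"]] by simp
      ultimately have "z * (x * (y * z)) - 0 \<in> rel_ideal"
        using ideal_add[OF ideal_right[OF ideal_left[of _ t], of _ z] ideal_left[OF rel(3), of "x * y"]] by simp
      then show ?thesis unfolding proj_eq_iff .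
    qed
  note tab = t0 t1 t2 t3 t4 t5 t6 t7 t8 t9 t10 t11 t12 t13 t14 t15 t16
  have table: "proj (gen g * mon m) = proj (poly_of (gen_mult q g (unit_coeff m)))" for m
    by (cases g; cases m; simp add: poly_of_def gen_mult_def sum_monomial monomial_mult_def unit_coeff_def gens_eq tab sq)
  define c where "c = coords f"
  have "proj (gen g * f) = proj (gen g * poly_of c)"
    unfolding proj_mult[symmetric] gen[folded c_def] ..
  also have "\<dots> = proj (poly_of (gen_mult q g c))"
  proof -
    have "gen g * poly_of c = (\<Sum>m\<in>UNIV. scal (c m) * (gen g * mon m))"
      unfolding poly_of_def sum_distrib_left by (rule sum.cong) (simp_all add: scal_commute[of "gen g"] flip: mult.assoc)
    also have "proj \<dots> = proj (\<Sum>m\<in>UNIV. scal (c m) * poly_of (gen_mult q g (unit_coeff m)))"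
      by (intro proj_sum_cong proj_scal_cong table)
    also have "(\<Sum>m\<in>UNIV. scal (c m) * poly_of (gen_mult q g (unit_coeff m))) =
        (\<Sum>n\<in>UNIV. \<Sum>m\<in>UNIV. scal (c m * gen_mult q g (unit_coeff m) n) * mon n)"
      unfolding poly_of_def sum_distrib_left by (subst sum.swap) (simp add: scal_mult mult.assoc)
    also have "\<dots> = poly_of (gen_mult q g c)"
      unfolding poly_of_def gen_mult_def monomial_mult_sum[of q _ c] by (simp add: scal_sum sum_distrib_right)
    finally show ?thesis .
  qed
  also have "gen_mult q g c = coords (gen g * f)"
    by (simp add: coords_mult coords_gen gen_mult_def c_def)
  finally show ?case by simp
qed


text \<open>The functions \<open>elt\<close> and \<open>coefficients\<close> identify the algebra with \<open>k\<^sup>8\<close>.\<close>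

definition elt :: "(monomial \<Rightarrow> 'k) \<Rightarrow> (xyz, 'k) free_alg set" where
  "elt c = proj (poly_of c)"

definition coefficients :: "(xyz, 'k) free_alg set \<Rightarrow> monomial \<Rightarrow> 'k" where
  "coefficients r = coords (SOME f. proj f = r)"

lemma coefficients_proj: "coefficients (proj f) = coords f"
  unfolding coefficients_def by (rule coords_cong) (rule someI, rule refl)

lemma elt_closed [simp]: "elt c \<in> carrier alg"
  by (simp add: elt_def)

lemma elt_coefficients: "r \<in> carrier alg \<Longrightarrow> elt (coefficients r) = r"
  by (auto simp: alg_carrier elt_def coefficients_proj proj_poly_of)

lemma coefficients_elt: "coefficients (elt c) = c"
  by (simp add: elt_def coefficients_proj coords_poly_of)

lemma coefficients_add: "r \<in> carrier alg \<Longrightarrow> s \<in> carrier alg \<Longrightarrow> coefficients (r \<oplus>\<^bsub>alg\<^esub> s) m = coefficients r m + coefficients s m"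
  by (auto simp: alg_carrier proj_add coefficients_proj coords_add)

lemma coefficients_smult: "r \<in> carrier alg \<Longrightarrow> coefficients (c \<odot>\<^bsub>alg\<^esub> r) m = c * coefficients r m"
  by (auto simp: alg_carrier proj_smult coefficients_proj coords_scal)

lemma coefficients_mult: "r \<in> carrier alg \<Longrightarrow> s \<in> carrier alg \<Longrightarrow> coefficients (r \<otimes>\<^bsub>alg\<^esub> s) = monomial_mult q (coefficients r) (coefficients s)"
  by (auto simp: alg_carrier proj_mult coefficients_proj coords_mult)

lemma coefficients_one: "coefficients \<one>\<^bsub>alg\<^esub> = unit_coeff M1"
  by (simp add: proj_one coefficients_proj coords_one)

lemma coefficients_zero: "coefficients \<zero>\<^bsub>alg\<^esub> m = 0"
  by (simp add: proj_zero coefficients_proj coords_zero)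

lemma coefficients_inject: "r \<in> carrier alg \<Longrightarrow> s \<in> carrier alg \<Longrightarrow> coefficients r = coefficients s \<Longrightarrow> r = s"
  using elt_coefficients by metis

lemma finsum_proj: "(\<Oplus>\<^bsub>alg\<^esub>m\<in>A. proj (f m)) = proj (\<Sum>m\<in>A. f m)"
proof -
  interpret A: ring alg by (rule ring_alg)
  show ?thesis
    by (induction A rule: infinite_finite_induct) (simp_all add: proj_zero proj_add)
qed

lemma alg_dimension: "has_dimension alg 8"
proof -
  interpret A: ring alg by (rule ring_alg)
  define b where "b m = proj (mon m :: (xyz, 'k) free_alg)" for m
  have inj: "inj b"
  proof (rule injI)
    fix m n assume "b m = b n"
    then have "unit_coeff m = (unit_coeff n :: monomial \<Rightarrow> 'k)" using coefficients_proj coords_mon unfolding b_def by metis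
    then show "m = n" unfolding unit_coeff_def by (metis zero_neq_one)
  qed
  have sum: "(\<Oplus>\<^bsub>alg\<^esub>s\<in>range b. c s \<odot>\<^bsub>alg\<^esub> s) = elt (\<lambda>m. c (b m))" for c
  proof -
    have "(\<Oplus>\<^bsub>alg\<^esub>s\<in>range b. c s \<odot>\<^bsub>alg\<^esub> s) = (\<Oplus>\<^bsub>alg\<^esub>m\<in>UNIV. c (b m) \<odot>\<^bsub>alg\<^esub> b m)"
      by (rule A.add.finprod_reindex) (auto simp: inj b_def proj_smult)
    then show ?thesis unfolding elt_def poly_of_def by (simp add: b_def proj_smult finsum_proj)
  qed
  show ?thesis unfolding has_dimension_def
  proof (intro exI[of _ "range b"] conjI ballI)
    show "card (range b) = 8" using card_image[OF inj] by (simp add: UNIV_monomial)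
    show "range b \<subseteq> carrier alg" by (auto simp: b_def)
    fix v assume v: "v \<in> carrier alg"
    show "\<exists>!c. c \<in> range b \<rightarrow>\<^sub>E UNIV \<and> v = (\<Oplus>\<^bsub>alg\<^esub>s\<in>range b. c s \<odot>\<^bsub>alg\<^esub> s)"
    proof (rule ex1I[of _ "\<lambda>s\<in>range b. coefficients v (the_inv b s)"])
      show "(\<lambda>s\<in>range b. coefficients v (the_inv b s)) \<in> range b \<rightarrow>\<^sub>E UNIV \<and> v = (\<Oplus>\<^bsub>alg\<^esub>s\<in>range b. (\<lambda>s\<in>range b. coefficients v (the_inv b s)) s \<odot>\<^bsub>alg\<^esub> s)"
        unfolding sum using elt_coefficients[OF v] by (simp add: the_inv_f_f[OF inj])
    next
      fix c assume c: "c \<in> range b \<rightarrow>\<^sub>E UNIV \<and> v = (\<Oplus>\<^bsub>alg\<^esub>s\<in>range b. c s \<odot>\<^bsub>alg\<^esub> s)"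
      then have "coefficients v = (\<lambda>m. c (b m))" unfolding sum by (simp add: coefficients_elt)
      then show "c = (\<lambda>s\<in>range b. coefficients v (the_inv b s))"
        using c by (intro extensionalityI[of _ "range b"]) (auto simp: PiE_def the_inv_f_f[OF inj])
    qed
  qed simp
qed

text \<open>The symmetrising form is the coefficient of \<open>xyz\<close>. It is symmetric and nondegenerate because
  each monomial is paired only with its partner, with the same value in both orders.\<close>

lemma alg_symmetric: "symmetric_algebra alg"
  unfolding symmetric_algebra_def
proof (intro conjI exI[of _ "\<lambda>r. coefficients r Mxyz"] ballI allI impI)
  show "k_algebra alg" by (rule k_algebra_alg)
  show "\<exists>n. has_dimension alg n" using alg_dimension by blast
next
  interpret A: ring alg by (rule ring_alg)
  fix a assume a: "a \<in> carrier alg" and z: "\<forall>b\<in>carrier alg. coefficients (a \<otimes>\<^bsub>alg\<^esub> b) Mxyz = 0"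
  have z': "monomial_mult q (coefficients a) c Mxyz = 0" for c
    using z[rule_format, OF elt_closed[of c]] by (simp add: coefficients_mult a coefficients_elt)
  have "coefficients a m = 0" for m
    using z'[of "unit_coeff M1"] z'[of "unit_coeff Mx"] z'[of "unit_coeff My"] z'[of "unit_coeff Mz"]
      z'[of "unit_coeff Mxy"] z'[of "unit_coeff Myz"] z'[of "unit_coeff Mzx"] z'[of "unit_coeff Mxyz"]
    by (cases m) (simp_all add: monomial_mult_def unit_coeff_def)
  then show "a = \<zero>\<^bsub>alg\<^esub>" using a by (intro coefficients_inject) (auto simp: coefficients_zero)
qed (simp_all add: coefficients_add coefficients_smult coefficients_mult monomial_mult_def algebra_simps)

text \<open>The product is triangular with respect to the degree, so the coefficients of an inverse can be
  found degree by degree.\<close>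

lemma left_inverse:
  assumes "c M1 \<noteq> 0"
  shows "\<exists>u. monomial_mult q u c = unit_coeff M1"
proof -
  define i where "i = 1 / c M1"
  define ux where "ux = - (i * c Mx) * i"
  define uy where "uy = - (i * c My) * i"
  define uz where "uz = - (i * c Mz) * i"
  define uxy where "uxy = - (i * c Mxy + ux * c My - q * (uy * c Mx)) * i"
  define uyz where "uyz = - (i * c Myz + uy * c Mz - q * (uz * c My)) * i"
  define uzx where "uzx = - (i * c Mzx + uz * c Mx - q * (ux * c Mz)) * i"
  define uxyz where "uxyz = - (i * c Mxyz + ux * c Myz + uy * c Mzx + uz * c Mxy + uxy * c Mz + uyz * c Mx + uzx * c My) * i"
  have i: "a * i * c M1 = a" for a using assms by (simp add: i_def)
  define u where "u m = (case m of M1 \<Rightarrow> i | Mx \<Rightarrow> ux | My \<Rightarrow> uy | Mz \<Rightarrow> uz | Mxy \<Rightarrow> uxy | Myz \<Rightarrow> uyz | Mzx \<Rightarrow> uzx | Mxyz \<Rightarrow> uxyz)" for m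
  have "ux * c M1 = - (i * c Mx)" "uy * c M1 = - (i * c My)" "uz * c M1 = - (i * c Mz)"
    "uxy * c M1 = - (i * c Mxy + ux * c My - q * (uy * c Mx))"
    "uyz * c M1 = - (i * c Myz + uy * c Mz - q * (uz * c My))"
    "uzx * c M1 = - (i * c Mzx + uz * c Mx - q * (ux * c Mz))"
    "uxyz * c M1 = - (i * c Mxyz + ux * c Myz + uy * c Mzx + uz * c Mxy + uxy * c Mz + uyz * c Mx + uzx * c My)"
    unfolding ux_def[of] uy_def[of] uz_def uxy_def uyz_def uzx_def uxyz_def by (rule i)+
  moreover have "i * c M1 = 1" using assms by (simp add: i_def)
  ultimately have "monomial_mult q u c = unit_coeff M1"
    by (simp add: fun_eq_iff all_monomial) (simp add: monomial_mult_def u_def unit_coeff_def)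
  then show ?thesis by blast
qed

text \<open>The elements without constant term form a left ideal, and all other elements have left inverses.\<close>

lemma alg_local: "is_local_ring alg"
proof -
  interpret A: ring alg by (rule ring_alg)
  define I where "I = {r \<in> carrier alg. coefficients r M1 = 0}"
  have I: "left_ideal alg I"
    unfolding left_ideal_def
  proof
    have "additive_subgroup I alg"
    proof (intro additive_subgroup.intro A.add.subgroupI)
      fix a assume a: "a \<in> I"
      have "coefficients (\<ominus>\<^bsub>alg\<^esub> a \<oplus>\<^bsub>alg\<^esub> a) M1 = 0" using a by (simp add: I_def A.l_neg coefficients_zero)
      then show "\<ominus>\<^bsub>alg\<^esub> a \<in> I" using a by (simp add: I_def coefficients_add)
    qed (auto simp: I_def coefficients_add coefficients_zero intro!: exI[of _ "\<zero>\<^bsub>alg\<^esub>"])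
    then show "additive_subgroup I alg" .
  qed (auto simp: I_def coefficients_mult monomial_mult_def)
  have one: "\<one>\<^bsub>alg\<^esub> \<notin> I" by (simp add: I_def coefficients_one unit_coeff_def)
  have big: "J = carrier alg" if J: "left_ideal alg J" and r: "r \<in> J" "r \<notin> I" for J r
  proof -
    interpret J: additive_subgroup J alg using J by (simp add: left_ideal_def)
    have rc: "r \<in> carrier alg" using r J.a_subset by auto
    then obtain u where "monomial_mult q u (coefficients r) = unit_coeff M1" using left_inverse[of "coefficients r"] r by (auto simp: I_def)
    then have "elt u \<otimes>\<^bsub>alg\<^esub> r = \<one>\<^bsub>alg\<^esub>" using rc by (intro coefficients_inject) (auto simp: coefficients_mult coefficients_elt coefficients_one)
    then have "\<one>\<^bsub>alg\<^esub> \<in> J" using J r(1) unfolding left_ideal_def by (metis elt_closed)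
    then have "s \<in> J" if "s \<in> carrier alg" for s using J that unfolding left_ideal_def by (metis A.r_one)
    then show ?thesis using J.a_subset by auto
  qed
  have "maximal_left_ideal alg I"
    unfolding maximal_left_ideal_def
  proof (intro conjI I allI impI)
    show "I \<noteq> carrier alg" using one A.one_closed by metis
  qed (use big in blast)
  moreover have "J = I" if "maximal_left_ideal alg J" for J
  proof -
    have "J \<subseteq> I" using that big unfolding maximal_left_ideal_def by blast
    then show ?thesis using that I one A.one_closed unfolding maximal_left_ideal_def by metis
  qed
  ultimately show ?thesis unfolding is_local_ring_def using ring_alg by blast
qed

end

section \<open>Bases and matrices\<close>

text \<open>A vector space with basis \<open>e 0, \<dots>, e (n - 1)\<close>, where \<open>cd v i\<close> are the coordinates of \<open>v\<close>. An enumerated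
  basis makes the operators on the space square matrices.\<close>

locale based_space = left_module "scalars :: 'k::field ring" V
  for V :: "('k::field, 'v, 'd) module_scheme" (structure) +
  fixes n :: nat and e :: "nat \<Rightarrow> 'v" and cd :: "'v \<Rightarrow> nat \<Rightarrow> 'k"
  assumes e_closed: "i < n \<Longrightarrow> e i \<in> carrier V"
    and expand: "v \<in> carrier V \<Longrightarrow> v = (\<Oplus>i\<in>{..<n}. cd v i \<odot> e i)"
    and cd_combination: "j < n \<Longrightarrow> cd (\<Oplus>i\<in>{..<n}. c i \<odot> e i) j = c j"

definition spans :: "('k::field, 'v, 'd) module_scheme \<Rightarrow> 'v set \<Rightarrow> bool" where
  "spans V A \<longleftrightarrow> finite A \<and> A \<subseteq> carrier V \<and> (\<forall>v\<in>carrier V. \<exists>c. v = (\<Oplus>\<^bsub>V\<^esub>a\<in>A. c a \<odot>\<^bsub>V\<^esub> a))"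

text \<open>A spanning set of minimal size is a basis: a nontrivial relation would make one of its
  elements superfluous.\<close>

lemma based_space_of_spanning:
  fixes V :: "('k::field, 'v, 'd) module_scheme" (structure)
  assumes V: "left_module scalars V" and A0: "spans V A0"
  shows "\<exists>n e cd. based_space V n e cd"
proof -
  interpret left_module "scalars :: 'k ring" V by fact
  have sm [simp]: "c \<odot> v \<in> carrier V" if "v \<in> carrier V" for c v using that by simp
  obtain A where A: "spans V A" and min: "\<And>B. spans V B \<Longrightarrow> card A \<le> card B"
    using ex_has_least_nat[of "spans V" A0 card] A0 by blast
  have fin: "finite A" and sub: "A \<subseteq> carrier V" and sp: "\<And>v. v \<in> carrier V \<Longrightarrow> \<exists>c. v = (\<Oplus>a\<in>A. c a \<odot> a)"
    using A by (auto simp: spans_def)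
  have cl: "(\<lambda>a. c a \<odot> a) \<in> B \<rightarrow> carrier V" if "B \<subseteq> A" for B c using that sub by auto
  have comb: "(\<Oplus>a\<in>B. (c a + r * d a) \<odot> a) = (\<Oplus>a\<in>B. c a \<odot> a) \<oplus> r \<odot> (\<Oplus>a\<in>B. d a \<odot> a)"
    if B: "B \<subseteq> A" for B c d r
  proof -
    have "(\<Oplus>a\<in>B. (c a + r * d a) \<odot> a) = (\<Oplus>a\<in>B. c a \<odot> a \<oplus> r \<odot> (d a \<odot> a))"
      by (rule M.finsum_cong') (use B sub smult_l_distr smult_assoc in \<open>auto simp: subset_iff\<close>)
    also have "\<dots> = (\<Oplus>a\<in>B. c a \<odot> a) \<oplus> (\<Oplus>a\<in>B. r \<odot> (d a \<odot> a))"
      by (rule M.finsum_addf) (use B sub in auto)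
    finally show ?thesis using smult_finsum[of r "\<lambda>a. d a \<odot> a" B] cl[OF B] by simp
  qed
  have indep: "c b = c' b" if eq: "(\<Oplus>a\<in>A. c a \<odot> a) = (\<Oplus>a\<in>A. c' a \<odot> a)" and b: "b \<in> A" for c c' b
  proof (rule ccontr)
    assume ne: "c b \<noteq> c' b"
    define d where "d a = c a + (-1) * c' a" for a
    have db: "d b \<noteq> 0" using ne by (simp add: d_def)
    have m1: "v \<oplus> (-1) \<odot> v = \<zero>" if "v \<in> carrier V" for v
      using smult_l_distr[of 1 "-1" v] smult_l_zero[of v] smult_one[of v] that by simp
    have d0: "(\<Oplus>a\<in>A. d a \<odot> a) = \<zero>"
      unfolding d_def comb[OF order_refl, of c "-1" c'] eq by (rule m1) (rule M.finsum_closed[OF cl[OF order_refl]])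
    have "spans V (A - {b})"
      unfolding spans_def
    proof (intro conjI ballI)
      fix v assume "v \<in> carrier V"
      from sp[OF this] obtain k where k: "v = (\<Oplus>a\<in>A. k a \<odot> a)" by (elim exE)
      define k' where "k' a = k a + (- (k b / d b)) * d a" for a
      have kb: "k' b = 0" using db by (simp add: k'_def)
      have "v = (\<Oplus>a\<in>A. k' a \<odot> a)"
      proof -
        have "(\<Oplus>a\<in>A. k' a \<odot> a) = v \<oplus> (- (k b / d b)) \<odot> \<zero>"
          unfolding k'_def comb[OF order_refl, of k "- (k b / d b)" d] d0 k[symmetric] ..
        then show ?thesis using smult_r_zero[of "- (k b / d b)"] \<open>v \<in> carrier V\<close> by simp
      qed
      also have "\<dots> = (\<Oplus>a\<in>insert b (A - {b}). k' a \<odot> a)" using b by (simp add: insert_absorb)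
      also have "\<dots> = k' b \<odot> b \<oplus> (\<Oplus>a\<in>A - {b}. k' a \<odot> a)"
        by (rule M.finsum_insert) (use fin sub b in auto)
      also have "\<dots> = (\<Oplus>a\<in>A - {b}. k' a \<odot> a)"
        using kb smult_l_zero[of b] b sub M.finsum_closed[OF cl[of "A - {b}" k']] by (simp add: subset_iff)
      finally have "v = (\<Oplus>a\<in>A - {b}. k' a \<odot> a)" .
      then show "\<exists>c. v = (\<Oplus>a\<in>A - {b}. c a \<odot> a)" by (intro exI[of _ k'])
    qed (use fin sub in auto)
    from min[OF this] show False using card_Diff1_less[OF fin b] by linarith
  qed
  define n where "n = card A"
  obtain e where e: "bij_betw e {..<n} A" using fin ex_bij_betw_nat_finite[of A] by (auto simp: n_def atLeast0LessThan)
  define cf where "cf v = (SOME c. v = (\<Oplus>a\<in>A. c a \<odot> a))" for v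
  have cf: "v = (\<Oplus>a\<in>A. cf v a \<odot> a)" if "v \<in> carrier V" for v
    unfolding cf_def by (rule someI_ex[OF sp[OF that]])
  have re: "(\<Oplus>i\<in>{..<n}. c (e i) \<odot> e i) = (\<Oplus>a\<in>A. c a \<odot> a)" for c
    using M.add.finprod_reindex[of "\<lambda>a. c a \<odot> a" e "{..<n}"] e cl[OF order_refl] by (simp add: bij_betw_def)
  have "based_space V n e (\<lambda>v i. cf v (e i))"
  proof
    show "e i \<in> carrier V" if "i < n" for i using that e sub by (auto simp: bij_betw_def)
    show "v = (\<Oplus>i\<in>{..<n}. cf v (e i) \<odot> e i)" if "v \<in> carrier V" for v
      unfolding re by (rule cf[OF that])
    fix j and c :: "nat \<Rightarrow> 'k" assume j: "j < n"
    define c' where "c' a = c (the_inv_into {..<n} e a)" for a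
    have c': "c' (e i) = c i" if "i < n" for i
      using that e by (simp add: c'_def the_inv_into_f_f bij_betw_def)
    have "(\<Oplus>i\<in>{..<n}. c i \<odot> e i) = (\<Oplus>i\<in>{..<n}. c' (e i) \<odot> e i)"
      by (rule M.finsum_cong') (use e sub c' in \<open>auto simp: bij_betw_def\<close>)
    then have eq: "(\<Oplus>i\<in>{..<n}. c i \<odot> e i) = (\<Oplus>a\<in>A. c' a \<odot> a)" by (simp only: re)
    have "cf (\<Oplus>a\<in>A. c' a \<odot> a) (e j) = c' (e j)"
      by (rule indep[OF cf[symmetric]]) (use e j M.finsum_closed cl[OF order_refl] in \<open>auto simp: bij_betw_def\<close>)
    then show "cf (\<Oplus>i\<in>{..<n}. c i \<odot> e i) (e j) = c j" unfolding eq using c'[OF j] by simp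
  qed
  then show ?thesis by blast
qed

context based_space
begin

lemma smult_in [simp]: "v \<in> carrier V \<Longrightarrow> c \<odot> v \<in> carrier V"
  by simp

definition combination :: "(nat \<Rightarrow> 'k) \<Rightarrow> 'v" where
  "combination c = (\<Oplus>i\<in>{..<n}. c i \<odot> e i)"

lemma combination_closed [simp]: "combination c \<in> carrier V"
  unfolding combination_def by (rule M.finsum_closed) (auto simp: e_closed)

lemma combination_cd: "v \<in> carrier V \<Longrightarrow> combination (cd v) = v"
  unfolding combination_def by (rule expand[symmetric])

lemma cd_of_combination: "j < n \<Longrightarrow> cd (combination c) j = c j"
  unfolding combination_def by (rule cd_combination)

lemma combination_cong: "(\<And>i. i < n \<Longrightarrow> c i = d i) \<Longrightarrow> combination c = combination d"
  unfolding combination_def by (rule M.finsum_cong') (auto simp: e_closed)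

lemma vector_eqI: "v \<in> carrier V \<Longrightarrow> w \<in> carrier V \<Longrightarrow> (\<And>i. i < n \<Longrightarrow> cd v i = cd w i) \<Longrightarrow> v = w"
  using combination_cong[of "cd v" "cd w"] by (simp add: combination_cd)

lemma combination_add: "combination (\<lambda>i. c i + d i) = combination c \<oplus> combination d"
proof -
  have "combination (\<lambda>i. c i + d i) = (\<Oplus>i\<in>{..<n}. c i \<odot> e i \<oplus> d i \<odot> e i)"
    unfolding combination_def
    by (rule M.finsum_cong') (use smult_l_distr e_closed in auto)
  also have "\<dots> = combination c \<oplus> combination d"
    unfolding combination_def by (rule M.finsum_addf) (auto simp: e_closed)
  finally show ?thesis .
qed

lemma combination_smult: "combination (\<lambda>i. r * c i) = r \<odot> combination c"
proof -
  have "combination (\<lambda>i. r * c i) = (\<Oplus>i\<in>{..<n}. r \<odot> (c i \<odot> e i))"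
    unfolding combination_def
    by (rule M.finsum_cong') (use smult_assoc e_closed in auto)
  also have "\<dots> = r \<odot> combination c"
    unfolding combination_def by (rule smult_finsum[symmetric]) (auto simp: e_closed)
  finally show ?thesis .
qed

lemma cd_add: "v \<in> carrier V \<Longrightarrow> w \<in> carrier V \<Longrightarrow> i < n \<Longrightarrow> cd (v \<oplus> w) i = cd v i + cd w i"
  using cd_of_combination[of i "\<lambda>i. cd v i + cd w i"] by (simp add: combination_add combination_cd)

lemma cd_smult: "v \<in> carrier V \<Longrightarrow> i < n \<Longrightarrow> cd (r \<odot> v) i = r * cd v i"
  using cd_of_combination[of i "\<lambda>i. r * cd v i"] by (simp add: combination_smult combination_cd)

lemma cd_zero: "i < n \<Longrightarrow> cd \<zero> i = 0"
proof -
  assume "i < n"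
  then have "cd \<zero> i = cd \<zero> i + cd \<zero> i"
    using cd_add[OF M.zero_closed M.zero_closed, of i] M.l_zero[OF M.zero_closed] by metis
  then show ?thesis by (metis add_cancel_right_right)
qed

lemma e_combination: "j < n \<Longrightarrow> e j = combination (\<lambda>i. if i = j then 1 else 0)"
proof -
  assume j: "j < n"
  have "combination (\<lambda>i. if i = j then 1 else 0) = (\<Oplus>i\<in>{..<n}. if i = j then e i else \<zero>)"
    unfolding combination_def
    by (rule M.finsum_cong') (use e_closed smult_one smult_l_zero in auto)
  also have "\<dots> = (\<Oplus>i\<in>{..<n}. if j = i then e i else \<zero>)" by (simp add: eq_commute[of j])
  also have "\<dots> = e j" by (rule M.add.finprod_singleton) (use j e_closed in auto)
  finally show ?thesis by simp
qed

lemma cd_e: "j < n \<Longrightarrow> i < n \<Longrightarrow> cd (e j) i = (if i = j then 1 else 0)"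
  by (simp add: e_combination cd_of_combination)

lemma e_inj: "inj_on e {..<n}"
  by (rule inj_onI) (metis cd_e lessThan_iff zero_neq_one)

definition mat_op :: "'k mat \<Rightarrow> 'v \<Rightarrow> 'v" where
  "mat_op A v = combination (\<lambda>i. \<Sum>j<n. A $$ (i, j) * cd v j)"

definition op_mat :: "('v \<Rightarrow> 'v) \<Rightarrow> 'k mat" where
  "op_mat L = mat n n (\<lambda>(i, j). cd (L (e j)) i)"

lemma op_mat_carrier [simp]: "op_mat L \<in> carrier_mat n n"
  by (simp add: op_mat_def)

lemma mat_op_closed [simp]: "mat_op A v \<in> carrier V"
  by (simp add: mat_op_def)

lemma cd_mat_op: "i < n \<Longrightarrow> cd (mat_op A v) i = (\<Sum>j<n. A $$ (i, j) * cd v j)"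
  by (simp add: mat_op_def cd_of_combination)

lemma mat_op_linear: "is_linear scalars V V (mat_op A)"
  by (rule is_linearI; (intro vector_eqI)?)
    (auto simp: cd_mat_op cd_add cd_smult sum.distrib sum_distrib_left algebra_simps)

lemma cd_finsum:
  assumes "f \<in> A \<rightarrow> carrier V" "i < n"
  shows "cd (\<Oplus>j\<in>A. f j) i = (\<Sum>j\<in>A. cd (f j) i)"
  using assms by (induction A rule: infinite_finite_induct) (auto simp: cd_zero cd_add)

lemma cd_linear:
  assumes L: "is_linear scalars V V L" and v: "v \<in> carrier V" and i: "i < n"
  shows "cd (L v) i = (\<Sum>j<n. cd (L (e j)) i * cd v j)"
proof -
  have "L (combination (cd v)) = (\<Oplus>j\<in>{..<n}. L (cd v j \<odot> e j))"
    unfolding combination_def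
    by (rule linear_finsum[OF left_module_axioms left_module_axioms L]) (auto simp: e_closed)
  then have "cd (L v) i = cd (\<Oplus>j\<in>{..<n}. L (cd v j \<odot> e j)) i" by (simp add: combination_cd v)
  also have "\<dots> = (\<Sum>j<n. cd (L (cd v j \<odot> e j)) i)"
    by (rule cd_finsum) (use is_linearD(1)[OF L] e_closed i in auto)
  also have "\<dots> = (\<Sum>j<n. cd (L (e j)) i * cd v j)"
    using is_linearD(1,3)[OF L] e_closed i by (intro sum.cong) (auto simp: cd_smult)
  finally show ?thesis .
qed

lemma mat_op_op_mat:
  assumes L: "is_linear scalars V V L" and v: "v \<in> carrier V"
  shows "mat_op (op_mat L) v = L v"
  using v is_linearD(1)[OF L v]
  by (intro vector_eqI) (auto simp: cd_mat_op op_mat_def cd_linear[OF L])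

lemma mat_op_mult: "A \<in> carrier_mat n n \<Longrightarrow> B \<in> carrier_mat n n \<Longrightarrow> mat_op (A * B) v = mat_op A (mat_op B v)"
  by (rule vector_eqI)
    (auto simp: cd_mat_op mult_mat_entry[where n=n] sum_distrib_left sum_distrib_right mult.assoc simp del: index_mult_mat(1) intro: sum.swap)

lemma mat_op_add: "A \<in> carrier_mat n n \<Longrightarrow> B \<in> carrier_mat n n \<Longrightarrow> mat_op (A + B) v = mat_op A v \<oplus> mat_op B v"
  by (rule vector_eqI) (auto simp: cd_mat_op cd_add sum.distrib algebra_simps)

lemma mat_op_smult: "A \<in> carrier_mat n n \<Longrightarrow> mat_op (r \<cdot>\<^sub>m A) v = r \<odot> mat_op A v"
  by (rule vector_eqI) (auto simp: cd_mat_op cd_smult sum_distrib_left algebra_simps)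

lemma mat_op_one: "v \<in> carrier V \<Longrightarrow> mat_op (1\<^sub>m n) v = v"
  by (rule vector_eqI) (auto simp: cd_mat_op if_distrib[of "\<lambda>x. x * _"] cong: if_cong)

lemma mat_op_zero: "mat_op (0\<^sub>m n n) v = \<zero>"
  by (rule vector_eqI) (auto simp: cd_mat_op cd_zero)

lemma mat_op_inject:
  assumes "A \<in> carrier_mat n n" "B \<in> carrier_mat n n" "\<And>v. v \<in> carrier V \<Longrightarrow> mat_op A v = mat_op B v"
  shows "A = B"
proof (rule eq_matI)
  fix i j assume "i < dim_row B" "j < dim_col B"
  then have ij: "i < n" "j < n" using assms by auto
  have "cd (mat_op A (e j)) i = A $$ (i, j)" for A using ij
    by (simp add: cd_mat_op cd_e if_distrib[of "\<lambda>x. _ * x"] cong: if_cong)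
  then show "A $$ (i, j) = B $$ (i, j)" using assms(3)[OF e_closed[OF ij(2)]] by metis
qed (use assms in auto)

end

section \<open>Modules over the quantum exterior algebra\<close>

context qext
begin

text \<open>The constants with \<open>x\<^sub>a x\<^sub>b = skew a b * x\<^sub>b x\<^sub>a\<close>. The value for \<open>a = b\<close>, where both sides vanish, is the one
  for which contractions satisfy the sign rule of the exterior algebra.\<close>

definition skew :: "xyz \<Rightarrow> xyz \<Rightarrow> 'k" where
  "skew a b = (if a = b then -1
     else if (a, b) \<in> {(Gx, Gy), (Gy, Gz), (Gz, Gx)} then - inverse q else - q)"

lemma skew_nz: "skew a b \<noteq> 0"
  using q by (simp add: skew_def)

lemma skew_inverse: "skew a b * skew b a = 1"
  using q by (cases a; cases b) (simp_all add: skew_def)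

lemma proj_skew: "proj (gen a * gen b) = proj (scal (skew a b) * (gen b * gen a))" (is "?P a b")
proof -
  have rel: "gen a * gen b + scal q * (gen b * gen a) \<in> rel_ideal" if "(a, b) \<in> {(Gy, Gx), (Gz, Gy), (Gx, Gz)}" for a b
    by (rule rels_in) (use that in \<open>auto simp: qext_relations_def Let_def\<close>)
  have sq: "gen a * gen a \<in> rel_ideal" for a
    by (rule rels_in, cases a) (simp_all add: qext_relations_def Let_def)
  have m: "scal (- c) = - (scal c :: (xyz, 'k) free_alg)" for c by (simp add: single_uminus)
  have 1: "?P a b" if "(a, b) \<in> {(Gy, Gx), (Gz, Gy), (Gx, Gz)}" for a b
    using rel[OF that] that unfolding proj_eq_iff by (auto simp: skew_def m)
  have 2: "?P b a" if "(a, b) \<in> {(Gy, Gx), (Gz, Gy), (Gx, Gz)}" for a b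
  proof -
    have "proj (scal (skew b a) * (gen a * gen b)) = proj (scal (skew b a) * (scal (skew a b) * (gen b * gen a)))"
      by (rule proj_scal_cong[OF 1[OF that]])
    also have "scal (skew b a) * (scal (skew a b) * (gen b * gen a)) = gen b * gen a"
      using skew_inverse[of b a] by (simp flip: mult.assoc scal_mult)
    finally show ?thesis by simp
  qed
  have 3: "?P a a" for a
    using ideal_add[OF sq[of a] sq[of a]] unfolding proj_eq_iff by (simp add: skew_def m)
  show ?thesis
    by (cases a; cases b) (simp_all add: 3 1 2)
qed

lemma proj_square: "proj (gen a * gen a) = proj 0"
  unfolding proj_eq_iff
  by (simp, rule rels_in, cases a) (simp_all add: qext_relations_def Let_def)

end

locale qext_module = qext q + M: left_module alg M
  for q :: "'k::field" and M :: "((xyz, 'k) free_alg set, 'm, 'd) module_scheme" (structure)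
begin

abbreviation "V \<equiv> restrict_to_field alg M"

sublocale V: left_module "scalars :: 'k ring" V
  by (rule left_module_restrict) (rule M.left_module_axioms)

definition xi :: "xyz \<Rightarrow> 'm \<Rightarrow> 'm" where
  "xi g m = proj (gen g) \<odot> m"

abbreviation scale :: "'k \<Rightarrow> 'm \<Rightarrow> 'm" (infixl "\<star>" 70) where
  "c \<star> m \<equiv> c \<odot>\<^bsub>V\<^esub> m"

lemma V_smult: "c \<star> m = proj (scal c) \<odot> m"
  by (rule restrict_smult)

lemma xi_closed [simp]: "m \<in> carrier M \<Longrightarrow> xi g m \<in> carrier M"
  by (simp add: xi_def)

lemma V_smult_closed [simp]: "m \<in> carrier M \<Longrightarrow> c \<star> m \<in> carrier M"
  by (simp add: V_smult)

lemma xi_linear: "is_linear scalars V V (xi g)"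
proof (rule is_linearI)
  fix c :: 'k and m assume m: "m \<in> carrier V"
  have "proj (gen g) \<otimes>\<^bsub>alg\<^esub> proj (scal c) = proj (scal c) \<otimes>\<^bsub>alg\<^esub> proj (gen g)"
    by (simp add: proj_mult scal_commute)
  then show "xi g (c \<star> m) = c \<star> xi g m"
    using m by (simp add: xi_def V_smult flip: M.smult_assoc)
qed (auto simp: xi_def M.smult_r_distr)

lemma xi_add: "m \<in> carrier M \<Longrightarrow> m' \<in> carrier M \<Longrightarrow> xi g (m \<oplus> m') = xi g m \<oplus> xi g m'"
  by (simp add: xi_def M.smult_r_distr)

lemma xi_smult: "m \<in> carrier M \<Longrightarrow> xi g (c \<star> m) = c \<star> xi g m"
  using is_linearD(3)[OF xi_linear, of c m g] by simp

lemma xi_skew: "m \<in> carrier M \<Longrightarrow> xi a (xi b m) = skew a b \<star> xi b (xi a m)"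
  using proj_skew[of a b] by (simp add: xi_def V_smult proj_mult flip: M.smult_assoc)

lemma xi_square: "m \<in> carrier M \<Longrightarrow> xi a (xi a m) = \<zero>"
  using proj_square[of a] by (simp add: xi_def proj_mult flip: M.smult_assoc proj_zero)

lemma V_smult_add: "m \<in> carrier M \<Longrightarrow> m' \<in> carrier M \<Longrightarrow> c \<star> (m \<oplus> m') = c \<star> m \<oplus> c \<star> m'"
  by (simp add: V_smult M.smult_r_distr)

lemma V_smult_smult: "m \<in> carrier M \<Longrightarrow> c \<star> (d \<star> m) = (c * d) \<star> m"
  using V.smult_assoc[of c d m] by simp

lemma V_add_smult: "m \<in> carrier M \<Longrightarrow> (c + d) \<star> m = c \<star> m \<oplus> d \<star> m"
  using V.smult_l_distr[of c d m] by simp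

lemma V_one: "m \<in> carrier M \<Longrightarrow> 1 \<star> m = m"
  using V.smult_one[of m] by simp

lemma V_zero: "m \<in> carrier M \<Longrightarrow> 0 \<star> m = \<zero>"
  using V.smult_l_zero[of m] by simp

lemma V_r_zero: "c \<star> \<zero> = \<zero>"
  using V.smult_r_zero[of c] by simp

lemma V_neg: "m \<in> carrier M \<Longrightarrow> m \<oplus> (-1) \<star> m = \<zero>"
  using V_add_smult[of m 1 "-1"] by (simp add: V_one V_zero)

lemma V_cancel: "m \<in> carrier M \<Longrightarrow> c \<star> m \<oplus> (- c) \<star> m = \<zero>"
  using V_add_smult[of m c "- c"] by (simp add: V_zero)

text \<open>The operators \<open>(m, m') \<mapsto> (x\<^sub>b m, x\<^sub>b m' + \<delta>\<^sub>a\<^sub>b \<alpha> m)\<close> satisfy the relations because \<open>\<alpha>\<close> commutes with the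
  generators like \<open>x\<^sub>a\<close>. They make \<open>M \<times> M\<close> an extension of \<open>M\<close> by itself, and the second component
  of a section is the operator \<open>S\<close>.\<close>

lemma skew_operator_cobounds:
  assumes ext: "ext1_vanishes alg M M"
    and \<alpha>: "is_linear scalars V V \<alpha>"
    and \<alpha>_skew: "\<And>b m. m \<in> carrier M \<Longrightarrow> \<alpha> (xi b m) = skew a b \<star> xi b (\<alpha> m)"
  shows "\<exists>S. is_linear scalars V V S \<and>
    (\<forall>b. \<forall>m\<in>carrier M. S (xi b m) = xi b (S m) \<oplus> (if b = a then \<alpha> m else \<zero>))"
proof -
  let ?W = "module_sum V V"
  have W [simp]: "carrier ?W = carrier M \<times> carrier M" "\<zero>\<^bsub>?W\<^esub> = (\<zero>, \<zero>)"
    "u \<oplus>\<^bsub>?W\<^esub> v = (fst u \<oplus> fst v, snd u \<oplus> snd v)" "c \<odot>\<^bsub>?W\<^esub> u = (c \<star> fst u, c \<star> snd u)" for u v c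
    by (auto simp: module_sum_def split: prod.split)
  have \<alpha>c [simp]: "\<alpha> m \<in> carrier M" if "m \<in> carrier M" for m using is_linearD(1)[OF \<alpha>] that by simp
  have \<alpha>add: "\<alpha> (m \<oplus> m') = \<alpha> m \<oplus> \<alpha> m'" if "m \<in> carrier M" "m' \<in> carrier M" for m m'
    using is_linearD(2)[OF \<alpha>, of m m'] that by simp
  have \<alpha>sm: "\<alpha> (c \<star> m) = c \<star> \<alpha> m" if "m \<in> carrier M" for c m
    using is_linearD(3)[OF \<alpha>, of c m] that by simp
  have \<alpha>0: "\<alpha> \<zero> = \<zero>"
    using linear_zero[OF V.left_module_axioms V.left_module_axioms \<alpha>] by simp
  have xi_zero: "xi g \<zero> = \<zero>" for g by (simp add: xi_def)
  have lmW: "left_module scalars ?W" by (rule left_module_sum) (rule V.left_module_axioms)+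
  define \<eta> where "\<eta> g u = (xi g (fst u), xi g (snd u) \<oplus> (if g = a then \<alpha> (fst u) else \<zero>))" for g u
  interpret E: operators ?W \<eta>
  proof (intro operators.intro lmW operators_axioms.intro)
    show "is_linear scalars ?W ?W (\<eta> g)" for g
    proof (rule is_linearI)
      fix u v assume "u \<in> carrier ?W" "v \<in> carrier ?W"
      then show "\<eta> g (u \<oplus>\<^bsub>?W\<^esub> v) = \<eta> g u \<oplus>\<^bsub>?W\<^esub> \<eta> g v"
        by (auto simp: \<eta>_def xi_add \<alpha>add M.a_ac)
    next
      fix c :: 'k and u assume "u \<in> carrier ?W"
      then show "\<eta> g (c \<odot>\<^bsub>?W\<^esub> u) = c \<odot>\<^bsub>?W\<^esub> \<eta> g u"
        by (auto simp: \<eta>_def xi_smult \<alpha>sm V_smult_add V_r_zero)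
    qed (auto simp: \<eta>_def)
  qed
  have \<eta>\<eta>: "\<eta> g (\<eta> h u) = (xi g (xi h (fst u)), xi g (xi h (snd u)) \<oplus>
      ((if h = a then xi g (\<alpha> (fst u)) else \<zero>) \<oplus> (if g = a then skew g h \<star> xi h (\<alpha> (fst u)) else \<zero>)))"
    if "u \<in> carrier ?W" for g h u
    using that by (auto simp: \<eta>_def xi_add xi_zero \<alpha>_skew M.a_ac)
  have sq: "\<eta> g (\<eta> g u) = \<zero>\<^bsub>?W\<^esub>" if u: "u \<in> carrier ?W" for g u
    unfolding \<eta>\<eta>[OF u] using u V_cancel[of "xi g (\<alpha> (fst u))" 1]
    by (auto simp: xi_square skew_def V_one)
  have rel: "\<eta> g (\<eta> h u) \<oplus>\<^bsub>?W\<^esub> (- skew g h) \<odot>\<^bsub>?W\<^esub> \<eta> h (\<eta> g u) = \<zero>\<^bsub>?W\<^esub>" if u: "u \<in> carrier ?W" for g h u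
  proof (cases "g = h")
    case True
    then show ?thesis using sq[OF u] by (simp add: V_r_zero)
  next
    case False
    have base: "xi g (xi h m) \<oplus> (- skew g h) \<star> xi h (xi g m) = \<zero>" if "m \<in> carrier M" for g h m
      using that by (subst xi_skew) (auto simp: V_cancel)
    have four: "(p \<oplus> r) \<oplus> c \<star> (p' \<oplus> r') = \<zero>"
      if "p \<oplus> c \<star> p' = \<zero>" "r \<oplus> c \<star> r' = \<zero>" "p \<in> carrier M" "p' \<in> carrier M" "r \<in> carrier M" "r' \<in> carrier M"
      for p p' r r' c
    proof -
      have "(p \<oplus> r) \<oplus> c \<star> (p' \<oplus> r') = (p \<oplus> c \<star> p') \<oplus> (r \<oplus> c \<star> r')"
        using that(3-6) by (simp add: V_smult_add M.a_ac)
      then show ?thesis using that(1,2) by simp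
    qed
    have inv: "skew g h * skew h g = 1" by (rule skew_inverse)
    have um: "fst u \<in> carrier M" "snd u \<in> carrier M" using u by auto
    show ?thesis
      unfolding \<eta>\<eta>[OF u]
      using False um inv V_neg[of "xi g (\<alpha> (fst u))"]
      by (auto simp: base V_cancel V_r_zero V_smult_smult intro!: four)
  qed
  interpret E: represented_algebra "qext_relations q" ?W \<eta>
  proof
    fix r u assume r: "r \<in> qext_relations q" and u: "u \<in> carrier ?W"
    consider g where "r = gen g * gen g" | g h where "r = gen g * gen h + scal (- skew g h) * (gen h * gen g)"
    proof -
      have "(\<exists>g. r = gen g * gen g) \<or> (\<exists>g h. r = gen g * gen h + scal (- skew g h) * (gen h * gen g))"
      proof -
        have "\<exists>g. r = gen g * gen g" if "r = gen Gx * gen Gx \<or> r = gen Gy * gen Gy \<or> r = gen Gz * gen Gz"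
          using that by auto
        moreover have "\<exists>g h. r = gen g * gen h + scal (- skew g h) * (gen h * gen g)"
          if "r = gen b * gen c + scal q * (gen c * gen b)" "(b, c) \<in> {(Gy, Gx), (Gz, Gy), (Gx, Gz)}" for b c
          using that by (intro exI[of _ b] exI[of _ c]) (auto simp: skew_def)
        ultimately show ?thesis using r unfolding qext_relations_def Let_def by auto
      qed
      then show thesis using that by blast
    qed
    then show "free_act ?W \<eta> r u = \<zero>\<^bsub>?W\<^esub>"
    proof cases
      case 1
      then show ?thesis using sq[OF u, of g] by (simp add: E.free_act_gen_mult[OF u] E.free_act_gen[OF u] del: W)
    next
      case 2
      then show ?thesis using rel[OF u, of g h]
        by (simp add: E.free_act_gen_mult[OF u] E.free_act_gen[OF u] E.free_act_add[OF u] E.free_act_scal[OF u] del: W)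
    qed
  qed
  let ?E = "module_of_operators ?W \<eta>"
  have E_scal: "proj (scal c) \<odot>\<^bsub>?E\<^esub> u = c \<odot>\<^bsub>?W\<^esub> u" if u: "u \<in> carrier ?W" for c u
    using E.free_act_scal[OF u, of c 1] by (simp add: E.proj_act[OF u] E.free_act_one[OF u] del: W)
  have E_gen: "proj (gen g) \<odot>\<^bsub>?E\<^esub> u = \<eta> g u" if u: "u \<in> carrier ?W" for g u
    by (simp add: E.proj_act[OF u] E.free_act_gen[OF u] del: W)
  note Elm = E.left_module_of_operators
  have i: "is_linear alg M ?E (\<lambda>m. (\<zero>, m))"
    by (rule is_linear_algI[OF M.left_module_axioms Elm])
      (auto simp: E_scal E_gen V_r_zero V_smult \<eta>_def xi_def \<alpha>0)
  have p: "is_linear alg ?E M fst"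
    by (rule is_linear_algI[OF Elm M.left_module_axioms]) (auto simp: E_scal E_gen V_smult \<eta>_def xi_def)
  obtain s where s: "is_linear alg M ?E s" and ps: "\<And>m. m \<in> carrier M \<Longrightarrow> fst (s m) = m"
  proof -
    have "\<exists>s. is_linear alg M ?E s \<and> (\<forall>m\<in>carrier M. fst (s m) = m)"
      by (rule ext1_splits[OF M.left_module_axioms M.left_module_axioms Elm ext i p])
        (auto simp: inj_on_def image_iff)
    then show thesis using that by blast
  qed
  have sc: "s m \<in> carrier M \<times> carrier M" if "m \<in> carrier M" for m using is_linearD(1)[OF s that] by simp
  show ?thesis
  proof (intro exI[of _ "\<lambda>m. snd (s m)"] conjI allI ballI)
    show "is_linear scalars V V (\<lambda>m. snd (s m))"
    proof (rule is_linearI)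
      fix c :: 'k and m assume m: "m \<in> carrier V"
      have "s (proj (scal c) \<odot> m) = c \<odot>\<^bsub>?W\<^esub> s m"
        using is_linearD(3)[OF s, of "proj (scal c)" m] m sc[of m] by (simp add: E_scal del: W(4))
      then show "snd (s (c \<star> m)) = c \<star> snd (s m)" by (simp add: V_smult)
    next
      fix m m' assume "m \<in> carrier V" "m' \<in> carrier V"
      then show "snd (s (m \<oplus>\<^bsub>V\<^esub> m')) = snd (s m) \<oplus>\<^bsub>V\<^esub> snd (s m')"
        using is_linearD(2)[OF s, of m m'] by simp
    qed (use sc in \<open>auto simp: mem_Times_iff\<close>)
    fix b m assume m: "m \<in> carrier M"
    have "s (xi b m) = \<eta> b (s m)"
      using is_linearD(3)[OF s _ m, of "proj (gen b)"] sc[OF m] by (simp add: xi_def E_gen)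
    then show "snd (s (xi b m)) = xi b (snd (s m)) \<oplus> (if b = a then \<alpha> m else \<zero>)"
      using ps[OF m] by (simp add: \<eta>_def)
  qed
qed


text \<open>Contractions on modules, obtained from those for matrices by the choice of a basis.\<close>

lemma contraction_operator:
  assumes based: "based_space V n e cd" and ext: "ext1_vanishes alg M M"
  shows "\<exists>T. is_linear scalars V V T \<and>
    (\<forall>b. \<forall>m\<in>carrier M. T (xi b m) = skew b a \<star> xi b (T m) \<oplus> (if b = a then m else \<zero>))"
proof -
  interpret B: based_space V n e cd by fact
  define \<Xi> where "\<Xi> b = B.op_mat (xi b)" for b
  have \<Xi> [simp]: "\<Xi> b \<in> carrier_mat n n" for b by (simp add: \<Xi>_def)
  have op\<Xi>: "B.mat_op (\<Xi> b) m = xi b m" if "m \<in> carrier M" for b m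
    unfolding \<Xi>_def by (rule B.mat_op_op_mat[OF xi_linear]) (use that in simp)
  have cl: "B.mat_op A m \<in> carrier M" for A m using B.mat_op_closed[of A m] by simp
  note sq = square_mat_simps[where n=n]
  have inject: "A = B" if "A \<in> carrier_mat n n" "B \<in> carrier_mat n n" "\<And>m. m \<in> carrier M \<Longrightarrow> B.mat_op A m = B.mat_op B m" for A B
    by (rule B.mat_op_inject) (use that in auto)
  interpret R: rigid_skew_system n \<Xi> skew
  proof
    show "\<Xi> b \<in> carrier_mat n n" for b by simp
    show "\<Xi> a * \<Xi> b = skew a b \<cdot>\<^sub>m (\<Xi> b * \<Xi> a)" for a b
      by (rule inject) (auto simp: sq B.mat_op_mult B.mat_op_smult op\<Xi> xi_skew[of _ a b])
    show "\<Xi> a * \<Xi> a = 0\<^sub>m n n" for a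
      by (rule inject) (auto simp: sq B.mat_op_mult B.mat_op_zero op\<Xi> xi_square)
    show "skew a a = -1" for a by (simp add: skew_def)
    show "skew a b \<noteq> 0" for a b by (rule skew_nz)
    fix A a assume A: "A \<in> carrier_mat n n" and sk: "\<And>b. A * \<Xi> b = skew a b \<cdot>\<^sub>m (\<Xi> b * A)"
    have "B.mat_op A (xi b m) = skew a b \<star> xi b (B.mat_op A m)" if m: "m \<in> carrier M" for b m
    proof -
      have "B.mat_op (A * \<Xi> b) m = B.mat_op (skew a b \<cdot>\<^sub>m (\<Xi> b * A)) m" by (simp only: sk)
      then show ?thesis using m A cl by (simp add: sq B.mat_op_mult B.mat_op_smult op\<Xi>)
    qed
    from skew_operator_cobounds[OF ext B.mat_op_linear this]
    obtain S where S: "is_linear scalars V V S"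
      and S\<Xi>: "\<And>b m. m \<in> carrier M \<Longrightarrow> S (xi b m) = xi b (S m) \<oplus> (if b = a then B.mat_op A m else \<zero>)"
      by blast
    have opS: "B.mat_op (B.op_mat S) m = S m" if "m \<in> carrier M" for m
      by (rule B.mat_op_op_mat[OF S]) (use that in simp)
    have Sc: "S m \<in> carrier M" if "m \<in> carrier M" for m using is_linearD(1)[OF S] that by simp
    show "\<exists>S\<in>carrier_mat n n. \<forall>b. S * \<Xi> b = \<Xi> b * S + (if b = a then A else 0\<^sub>m n n)"
    proof (intro bexI[of _ "B.op_mat S"] allI)
      show "B.op_mat S * \<Xi> b = \<Xi> b * B.op_mat S + (if b = a then A else 0\<^sub>m n n)" for b
        by (rule inject) (use A in \<open>auto simp: sq B.mat_op_mult B.mat_op_add B.mat_op_zero op\<Xi> opS S\<Xi> Sc\<close>)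
    qed simp
  qed
  have fin: "finite (UNIV :: xyz set)"
  proof (rule finite_subset)
    show "UNIV \<subseteq> {Gx, Gy, Gz}" using xyz.exhaust by blast
  qed simp
  obtain T where T: "T \<in> carrier_mat n n"
    and T\<Xi>: "\<And>b. T * \<Xi> b = inverse (skew a b) \<cdot>\<^sub>m (\<Xi> b * T) + (if b = a then 1\<^sub>m n else 0\<^sub>m n n)"
    using R.contraction_exists[OF fin, of a] by blast
  have inv: "inverse (skew a b) = skew b a" for b
    by (rule inverse_unique) (rule skew_inverse)
  show ?thesis
  proof (intro exI[of _ "B.mat_op T"] conjI allI ballI B.mat_op_linear)
    fix b m assume m: "m \<in> carrier M"
    have "B.mat_op (T * \<Xi> b) m = B.mat_op (inverse (skew a b) \<cdot>\<^sub>m (\<Xi> b * T) + (if b = a then 1\<^sub>m n else 0\<^sub>m n n)) m"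
      by (simp only: T\<Xi>)
    then show "B.mat_op T (xi b m) = skew b a \<star> xi b (B.mat_op T m) \<oplus> (if b = a then m else \<zero>)"
      using m T cl by (auto simp: sq B.mat_op_mult B.mat_op_smult B.mat_op_add B.mat_op_one B.mat_op_zero op\<Xi> inv)
  qed
qed

end

section \<open>Projectivity\<close>

text \<open>The dual basis for the symmetrising form.\<close>

primrec dual :: "monomial \<Rightarrow> monomial" where
  "dual M1 = Mxyz" | "dual Mx = Myz" | "dual My = Mzx" | "dual Mz = Mxy"
| "dual Mxy = Mz" | "dual Myz = Mx" | "dual Mzx = My" | "dual Mxyz = M1"

context qext_module
begin

abbreviation act :: "(xyz, 'k) free_alg \<Rightarrow> 'm \<Rightarrow> 'm" where
  "act f w \<equiv> proj f \<odot> w"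

lemma finsum_restrict: "finsum V f A = finsum M f A"
  by (simp add: finsum_def finprod_def restrict_to_field_def)

lemma act_mult: "w \<in> carrier M \<Longrightarrow> act (f * h) w = act f (act h w)"
  by (simp flip: proj_mult add: M.smult_assoc)

lemma act_gen: "act (gen g) w = xi g w"
  by (simp add: xi_def)

lemma act_one: "w \<in> carrier M \<Longrightarrow> act 1 w = w"
  by (simp flip: proj_one)

lemma act_add: "w \<in> carrier M \<Longrightarrow> act (f + h) w = act f w \<oplus> act h w"
  by (simp flip: proj_add add: M.smult_l_distr)

lemma act_scal: "w \<in> carrier M \<Longrightarrow> act (scal c * f) w = c \<star> act f w"
  by (simp add: act_mult V_smult)

lemma act_linear: "is_linear scalars V V (act f)"
proof (rule is_linearI)
  fix c :: 'k and m assume m: "m \<in> carrier V"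
  have "proj f \<otimes>\<^bsub>alg\<^esub> proj (scal c) = proj (scal c) \<otimes>\<^bsub>alg\<^esub> proj f"
    by (simp add: proj_mult scal_commute)
  then show "act f (c \<star> m) = c \<star> act f m"
    using m by (simp add: V_smult flip: M.smult_assoc)
qed (auto simp: M.smult_r_distr)

text \<open>The eight summands are contracted in pairs: \<open>S1\<close> to \<open>S4\<close> use \<open>T\<^sub>x\<close> to remove \<open>x\<close>, adding up \<open>S1\<close> with \<open>S2\<close> and
  \<open>S3\<close> with \<open>S4\<close> uses \<open>T\<^sub>y\<close> to remove \<open>y\<close>, and what remains is \<open>T\<^sub>z z w + z T\<^sub>z w = w\<close>. The operators in \<open>\<theta>\<close> that
  stand between a generator and its contraction commute with it up to constants, which cancel
  since \<open>xyz\<close> is invariant under cyclic permutations.\<close>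

lemma partition_of_unity:
  assumes T: "\<And>a. is_linear scalars V V (T a)"
    and T_xi: "\<And>a b m. m \<in> carrier M \<Longrightarrow>
      T a (xi b m) = skew b a \<star> xi b (T a m) \<oplus> (if b = a then m else \<zero>)"
    and w: "w \<in> carrier M"
  defines "\<theta> \<equiv> \<lambda>m. T Gz (T Gy (T Gx m))"
  shows "(\<Oplus>m\<in>UNIV. act (mon m) (\<theta> (act (mon (dual m)) w))) = w"
proof -
  have Tc [simp]: "T a m \<in> carrier M" if "m \<in> carrier M" for a m using is_linearD(1)[OF T] that by simp
  have Tadd: "T a (m \<oplus> m') = T a m \<oplus> T a m'" if "m \<in> carrier M" "m' \<in> carrier M" for a m m'
    using is_linearD(2)[OF T, of m m'] that by simp
  have Tsm: "T a (c \<star> m) = c \<star> T a m" if "m \<in> carrier M" for a c m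
    using is_linearD(3)[OF T, of c m] that by simp
  have \<theta>c [simp]: "\<theta> m \<in> carrier M" if "m \<in> carrier M" for m using that by (simp add: \<theta>_def)
  have \<theta>sm: "\<theta> (c \<star> m) = c \<star> \<theta> m" if "m \<in> carrier M" for c m using that by (simp add: \<theta>_def Tsm)
  define r where "r = inverse q"
  have rq: "r * q = 1" "q * r = 1" using q by (simp_all add: r_def)
  note sk = skew_def r_def[symmetric]
  note push = T_xi Tadd Tsm xi_add xi_smult V_smult_smult V_smult_add sk rq V_one
  have neg: "u \<oplus> ((-1) \<star> u \<oplus> v) = v" "((-1) \<star> u \<oplus> v) \<oplus> u = v" if "u \<in> carrier M" "v \<in> carrier M" for u v
    using V_neg[of u] that by (simp_all flip: M.a_assoc) (simp add: M.a_comm[of _ u] flip: M.a_assoc)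
  have 1: "\<theta> (xi Gx u) \<oplus> xi Gx (\<theta> u) = T Gz (T Gy u)" if u: "u \<in> carrier M" for u
  proof -
    have "\<theta> (xi Gx u) = (-1) \<star> xi Gx (\<theta> u) \<oplus> T Gz (T Gy u)"
      using u by (simp add: \<theta>_def push)
    then show ?thesis using u by (simp add: neg)
  qed
  have 2: "T Gz (T Gy (xi Gy u)) = r \<star> xi Gy (T Gz (T Gy u)) \<oplus> T Gz u" if u: "u \<in> carrier M" for u
    using u by (simp add: push)
  have 3: "T Gz (xi Gz u) \<oplus> xi Gz (T Gz u) = u" if u: "u \<in> carrier M" for u
    using u by (simp add: push neg)
  let ?a = "xi Gy (T Gz (T Gy (xi Gz w)))"
  let ?b = "xi Gz (xi Gy (T Gz (T Gy w)))"
  have S1: "\<theta> (xi Gx (xi Gy (xi Gz w))) \<oplus> xi Gx (\<theta> (xi Gy (xi Gz w))) = r \<star> ?a \<oplus> T Gz (xi Gz w)"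
    using w by (simp add: 1 2)
  have S2: "xi Gy (\<theta> (xi Gz (xi Gx w))) \<oplus> xi Gx (xi Gy (\<theta> (xi Gz w))) = (- r) \<star> ?a"
  proof -
    have "xi Gy (\<theta> (xi Gz (xi Gx w))) = (- r) \<star> xi Gy (\<theta> (xi Gx (xi Gz w)))"
      using w by (subst xi_skew[of w Gz Gx]) (simp_all add: \<theta>sm xi_smult sk)
    moreover have "xi Gx (xi Gy (\<theta> (xi Gz w))) = (- r) \<star> xi Gy (xi Gx (\<theta> (xi Gz w)))"
      using w by (subst xi_skew[of _ Gx Gy]) (simp_all add: sk)
    ultimately show ?thesis using w 1[of "xi Gz w"] by (simp flip: V_smult_add xi_add)
  qed
  have S3: "xi Gz (\<theta> (xi Gx (xi Gy w))) \<oplus> xi Gz (xi Gx (\<theta> (xi Gy w))) = r \<star> ?b \<oplus> xi Gz (T Gz w)"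
    using w 1[of "xi Gy w"] by (simp flip: xi_add) (simp add: 2 xi_add xi_smult)
  have S4: "xi Gy (xi Gz (\<theta> (xi Gx w))) \<oplus> xi Gx (xi Gy (xi Gz (\<theta> w))) = (- r) \<star> ?b"
  proof -
    have "xi Gx (xi Gy (xi Gz v)) = xi Gy (xi Gz (xi Gx v))" if v: "v \<in> carrier M" for v
    proof -
      have "xi Gx (xi Gy (xi Gz v)) = (- r) \<star> xi Gy (xi Gx (xi Gz v))"
        using v by (subst xi_skew[of _ Gx Gy]) (simp_all add: sk)
      also have "xi Gx (xi Gz v) = (- q) \<star> xi Gz (xi Gx v)"
        using v by (subst xi_skew[of _ Gx Gz]) (simp_all add: sk)
      finally show ?thesis using v by (simp add: xi_smult V_smult_smult rq V_one)
    qed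
    then have "xi Gy (xi Gz (\<theta> (xi Gx w))) \<oplus> xi Gx (xi Gy (xi Gz (\<theta> w))) = xi Gy (xi Gz (T Gz (T Gy w)))"
      using w 1[of w] by (simp flip: xi_add)
    also have "\<dots> = (- r) \<star> xi Gz (xi Gy (T Gz (T Gy w)))"
      using w by (subst xi_skew[of _ Gy Gz]) (simp_all add: sk)
    finally show ?thesis .
  qed
  have swap: "((p1 \<oplus> p2) \<oplus> (p3 \<oplus> p5)) \<oplus> ((p4 \<oplus> p7) \<oplus> (p6 \<oplus> p8)) =
      p1 \<oplus> (p2 \<oplus> (p3 \<oplus> (p4 \<oplus> (p5 \<oplus> (p6 \<oplus> (p7 \<oplus> p8))))))"
    if "p1 \<in> carrier M" "p2 \<in> carrier M" "p3 \<in> carrier M" "p4 \<in> carrier M" "p5 \<in> carrier M" "p6 \<in> carrier M" "p7 \<in> carrier M" "p8 \<in> carrier M"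
    for p1 p2 p3 p4 p5 p6 p7 p8
    using that by (simp add: M.a_ac)
  have cancel: "(r \<star> u \<oplus> v) \<oplus> (- r) \<star> u = v" if "u \<in> carrier M" "v \<in> carrier M" for u v
    using V_cancel[of u r] that by (simp add: M.a_comm[of _ v] M.a_assoc)
  have "(\<Oplus>m\<in>UNIV. act (mon m) (\<theta> (act (mon (dual m)) w))) =
    \<theta> (xi Gx (xi Gy (xi Gz w))) \<oplus> (xi Gx (\<theta> (xi Gy (xi Gz w))) \<oplus> (xi Gy (\<theta> (xi Gz (xi Gx w))) \<oplus>
    (xi Gz (\<theta> (xi Gx (xi Gy w))) \<oplus> (xi Gx (xi Gy (\<theta> (xi Gz w))) \<oplus> (xi Gy (xi Gz (\<theta> (xi Gx w))) \<oplus>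
    (xi Gz (xi Gx (\<theta> (xi Gy w))) \<oplus> xi Gx (xi Gy (xi Gz (\<theta> w)))))))))"
    unfolding UNIV_monomial using w
    by (simp add: act_mult act_gen act_one Pi_def)
  also have "\<dots> = w"
    by (subst swap[symmetric]) (use w in \<open>simp_all add: S1 S2 S3 S4 cancel 3\<close>)
  finally show ?thesis .
qed

text \<open>The section of \<open>\<Lambda> \<otimes>\<^sub>k M \<rightarrow> M\<close> is \<open>w \<mapsto> \<Sum> e \<otimes> \<theta>(e\<^sup>* w)\<close>, where \<open>\<Lambda> \<otimes>\<^sub>k M\<close> is the free module on a basis of
  \<open>M\<close>. It is linear since \<open>\<Sum> g e \<otimes> e\<^sup>* = \<Sum> e \<otimes> e\<^sup>* g\<close> for each generator \<open>g\<close>.\<close>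

lemma projective_of_partition:
  assumes based: "based_space V n e cd" and \<theta>: "is_linear scalars V V \<theta>"
    and unity: "\<And>w. w \<in> carrier M \<Longrightarrow> (\<Oplus>m\<in>UNIV. act (mon m) (\<theta> (act (mon (dual m)) w))) = w"
  shows "projective alg M"
proof -
  interpret B: based_space V n e cd by fact
  interpret A: ring alg by (rule ring_alg)
  define B where "B = e ` {..<n}"
  define F where "F = free_module alg B"
  have F: "left_module alg F" unfolding F_def by (rule left_module_free) (rule ring_alg)
  have \<theta>c [simp]: "\<theta> m \<in> carrier M" if "m \<in> carrier M" for m using is_linearD(1)[OF \<theta>] that by simp
  define G where "G w j f = cd (\<theta> (act f w)) j" for w j f
  have G_add: "G w j (f + h) = G w j f + G w j h" if "w \<in> carrier M" "j < n" for w j f h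
    using that is_linearD(2)[OF \<theta>] by (simp add: G_def act_add B.cd_add[simplified])
  have G_scal: "G w j (scal c * f) = c * G w j f" if "w \<in> carrier M" "j < n" for w j c f
    using that is_linearD(3)[OF \<theta>] by (simp add: G_def act_scal B.cd_smult[simplified])
  have G_coords: "G w j f = (\<Sum>m\<in>UNIV. coords f m * G w j (mon m))" if "w \<in> carrier M" "j < n" for w j f
  proof -
    have "G w j f = G w j (poly_of (coords f))" by (simp add: G_def proj_poly_of)
    then show ?thesis using that by (simp add: poly_of_def sum_monomial G_add G_scal del: mon.simps)
  qed
  define ix where "ix b = the_inv_into {..<n} e b" for b
  have ix: "ix (e j) = j" if "j < n" for j using that B.e_inj by (simp add: ix_def the_inv_into_f_f)
  have ixB: "ix b < n" if "b \<in> B" for b using that ix by (auto simp: B_def)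
  define i where "i w b = (if b \<in> B then elt (\<lambda>m. G w (ix b) (mon (dual m))) else \<zero>\<^bsub>alg\<^esub>)" for w b
  have elt_add: "elt c \<oplus>\<^bsub>alg\<^esub> elt d = elt (\<lambda>m. c m + d m)" for c d
    by (rule coefficients_inject) (auto simp: fun_eq_iff coefficients_add coefficients_elt)
  have elt_scal: "proj (scal c) \<otimes>\<^bsub>alg\<^esub> elt d = elt (\<lambda>m. c * d m)" for c d
    by (simp add: proj_mult elt_def) (simp add: poly_of_def sum_distrib_left scal_mult mult.assoc)
  have elt_gen: "proj (gen g) \<otimes>\<^bsub>alg\<^esub> elt d = elt (monomial_mult q (unit_coeff (gen_monomial g)) d)" for g d
    by (rule coefficients_inject) (auto simp: coefficients_mult coefficients_elt coefficients_proj coords_gen)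
  have i_closed: "i w \<in> carrier F" for w
  proof -
    have "{b. i w b \<noteq> \<zero>\<^bsub>alg\<^esub>} \<subseteq> B" by (auto simp: i_def)
    then show ?thesis unfolding F_def free_carrier by (auto simp: i_def B_def intro: finite_subset)
  qed
  have i: "is_linear alg M F i"
  proof (rule is_linear_algI[OF M.left_module_axioms F i_closed])
    fix w w' assume w: "w \<in> carrier M" "w' \<in> carrier M"
    have "G (w \<oplus> w') j f = G w j f + G w' j f" if "j < n" for j f
      using w that is_linearD(2)[OF \<theta>] by (simp add: G_def M.smult_r_distr B.cd_add[simplified])
    then show "i (w \<oplus> w') = i w \<oplus>\<^bsub>F\<^esub> i w'"
      by (auto simp: F_def i_def fun_eq_iff elt_add ixB)
  next
    fix c w assume w: "w \<in> carrier M"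
    have "G (act (scal c) w) j f = c * G w j f" if "j < n" for j f
      using w that is_linearD(3)[OF act_linear, of c w f] is_linearD(3)[OF \<theta>]
      by (simp add: G_def V_smult[symmetric] B.cd_smult[simplified])
    then show "i (act (scal c) w) = proj (scal c) \<odot>\<^bsub>F\<^esub> i w"
      by (auto simp: F_def i_def fun_eq_iff elt_scal ixB)
  next
    fix g w assume w: "w \<in> carrier M"
    have "G (act (gen g) w) j (mon (dual m)) = monomial_mult q (unit_coeff (gen_monomial g)) (\<lambda>m. G w j (mon (dual m))) m"
      if j: "j < n" for j m
    proof -
      \<comment> \<open>The Casimir identity: both sides are determined by the coefficients of \<open>e\<^sup>* g\<close>.\<close>
      have "G (act (gen g) w) j (mon (dual m)) = G w j (mon (dual m) * gen g)" using w by (simp add: G_def act_mult)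
      also have "\<dots> = (\<Sum>m'\<in>UNIV. monomial_mult q (unit_coeff (dual m)) (unit_coeff (gen_monomial g)) m' * G w j (mon m'))"
        unfolding G_coords[OF w j, of "mon (dual m) * gen g"] by (simp add: coords_mult coords_mon coords_gen)
      also have "\<dots> = monomial_mult q (unit_coeff (gen_monomial g)) (\<lambda>m. G w j (mon (dual m))) m"
        by (cases g; cases m; simp add: sum_monomial monomial_mult_def unit_coeff_def del: mon.simps)
      finally show ?thesis .
    qed
    then show "i (act (gen g) w) = proj (gen g) \<odot>\<^bsub>F\<^esub> i w"
      by (auto simp: F_def i_def fun_eq_iff elt_gen ixB)
  qed
  define p where "p = linear_extension alg M (\<lambda>b. b)"
  have Bsub: "B \<subseteq> carrier M" using B.e_closed by (auto simp: B_def)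
  have p: "is_linear alg F M p"
    unfolding p_def F_def by (rule M.linear_extension_linear) (use Bsub in auto)
  have pi: "p (i w) = w" if w: "w \<in> carrier M" for w
  proof -
    have "p (i w) = (\<Oplus>b\<in>B. i w b \<odot> b)"
      unfolding p_def
      by (rule M.linear_extension_superset[of B]) (use Bsub i_closed[of w] in \<open>auto simp: F_def B_def i_def\<close>)
    also have "\<dots> = (\<Oplus>j\<in>{..<n}. i w (e j) \<odot> e j)"
      unfolding B_def
      by (rule M.add.finprod_reindex) (use B.e_inj Bsub i_closed[of w] in \<open>auto simp: F_def free_carrier B_def\<close>)
    also have "\<dots> = w"
    proof (rule B.vector_eqI)
      have iec: "i w (e j) \<odot> e j \<in> carrier M" if "j < n" for j
        using that Bsub i_closed[of w] by (auto simp: F_def free_carrier B_def)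
      fix k assume k: "k < n"
      have "cd (\<Oplus>j\<in>{..<n}. i w (e j) \<odot> e j) k = (\<Sum>j<n. cd (i w (e j) \<odot> e j) k)"
        using B.cd_finsum[of "\<lambda>j. i w (e j) \<odot> e j" "{..<n}" k] iec k by (simp add: finsum_restrict)
      also have "\<dots> = (\<Sum>j<n. \<Sum>m\<in>UNIV. cd (act (mon m) (e j)) k * cd (\<theta> (act (mon (dual m)) w)) j)"
      proof (rule sum.cong)
        fix j assume "j \<in> {..<n}"
        then have j: "j < n" and eB: "e j \<in> B" and ec: "e j \<in> carrier M" using Bsub by (auto simp: B_def)
        have "i w (e j) = proj (poly_of (\<lambda>m. G w j (mon (dual m))))" using eB by (simp add: i_def ix[OF j] elt_def)
        then have "cd (i w (e j) \<odot> e j) k = (\<Sum>m\<in>UNIV. G w j (mon (dual m)) * cd (act (mon m) (e j)) k)"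
          using ec k by (simp add: poly_of_def sum_monomial act_add act_scal B.cd_add[simplified] B.cd_smult[simplified] del: mon.simps dual.simps)
        then show "cd (i w (e j) \<odot> e j) k = (\<Sum>m\<in>UNIV. cd (act (mon m) (e j)) k * cd (\<theta> (act (mon (dual m)) w)) j)"
          by (simp add: G_def mult.commute)
      qed simp
      also have "\<dots> = (\<Sum>m\<in>UNIV. cd (act (mon m) (\<theta> (act (mon (dual m)) w))) k)"
        using w k by (subst sum.swap) (simp add: B.cd_linear[OF act_linear])
      also have "\<dots> = cd (\<Oplus>m\<in>UNIV. act (mon m) (\<theta> (act (mon (dual m)) w))) k"
        using B.cd_finsum[of "\<lambda>m. act (mon m) (\<theta> (act (mon (dual m)) w))" UNIV k] w k by (simp add: finsum_restrict)
      also have "\<dots> = cd w k" using unity[OF w] by simp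
      finally show "cd (\<Oplus>j\<in>{..<n}. i w (e j) \<odot> e j) k = cd w k" .
    qed (use w Bsub i_closed[of w] in \<open>auto intro!: M.finsum_closed simp: F_def free_carrier B_def\<close>)
    finally show ?thesis .
  qed
  show ?thesis
    unfolding projective_def
  proof (intro conjI M.left_module_axioms exI[of _ B] bexI ballI)
    show "restrict i (carrier M) \<in> module_hom alg M (free_module alg B)"
      by (rule is_linear_restrict[OF M.left_module_axioms i[unfolded F_def]])
    show "restrict p (carrier F) \<in> module_hom alg (free_module alg B) M"
      unfolding F_def by (rule is_linear_restrict[OF F[unfolded F_def] p[unfolded F_def]])
    show "restrict p (carrier F) (restrict i (carrier M) w) = w" if "w \<in> carrier M" for w
      using that pi i_closed by simp
  qed
qed

lemma projective_if_ext1_vanishes: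
  assumes "based_space V n e cd" "ext1_vanishes alg M M"
  shows "projective alg M"
proof -
  have "\<forall>a. \<exists>T. is_linear scalars V V T \<and>
    (\<forall>b. \<forall>m\<in>carrier M. T (xi b m) = skew b a \<star> xi b (T m) \<oplus> (if b = a then m else \<zero>))"
    using contraction_operator[OF assms] by blast
  then obtain T where T: "\<And>a. is_linear scalars V V (T a)"
    and T_xi: "\<And>a b m. m \<in> carrier M \<Longrightarrow> T a (xi b m) = skew b a \<star> xi b (T a m) \<oplus> (if b = a then m else \<zero>)"
    by metis
  show ?thesis
    by (rule projective_of_partition[OF assms(1) _ partition_of_unity[OF T T_xi]])
      (rule linear_compose[OF linear_compose[OF T T] T])
qed


text \<open>The products of the eight monomials with module generators span the module.\<close>

lemma spans_restrict_of_finitely_generated: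
  assumes "finitely_generated alg M"
  shows "\<exists>A. spans V A"
proof -
  obtain S where S: "finite S" "S \<subseteq> carrier M"
    and gen: "\<And>m. m \<in> carrier M \<Longrightarrow> \<exists>c\<in>S \<rightarrow> carrier alg. m = (\<Oplus>s\<in>S. c s \<odot> s)"
    using assms unfolding finitely_generated_def by blast
  define A where "A = (\<lambda>(m, s). act (mon m) s) ` (UNIV \<times> S)"
  have A: "finite A" "A \<subseteq> carrier M" using S by (auto simp: A_def)
  define H where "H = {v. \<exists>c. v = (\<Oplus>\<^bsub>V\<^esub>a\<in>A. c a \<star> a)}"
  have H0: "\<zero> \<in> H"
  proof -
    have "(\<Oplus>\<^bsub>V\<^esub>a\<in>A. 0 \<star> a) = (\<Oplus>a\<in>A. \<zero>)"
      unfolding finsum_restrict by (rule M.finsum_cong') (use A V_zero in auto)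
    then show ?thesis unfolding H_def by (auto intro!: exI[of _ "\<lambda>_. 0"])
  qed
  have Hadd: "u \<oplus> v \<in> H" if "u \<in> H" "v \<in> H" for u v
  proof -
    from that obtain c d where c: "u = (\<Oplus>\<^bsub>V\<^esub>a\<in>A. c a \<star> a)" and d: "v = (\<Oplus>\<^bsub>V\<^esub>a\<in>A. d a \<star> a)"
      unfolding H_def by auto
    have "u \<oplus> v = (\<Oplus>a\<in>A. c a \<star> a \<oplus> d a \<star> a)"
      unfolding c d finsum_restrict by (rule M.finsum_addf[symmetric]) (use A in auto)
    also have "\<dots> = (\<Oplus>\<^bsub>V\<^esub>a\<in>A. (c a + d a) \<star> a)"
      unfolding finsum_restrict by (rule M.finsum_cong') (use A V_add_smult in auto)
    finally show ?thesis unfolding H_def by (auto intro!: exI[of _ "\<lambda>a. c a + d a"])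
  qed
  have Hsm: "r \<star> b \<in> H" if b: "b \<in> A" for r b
  proof -
    have "(\<Oplus>\<^bsub>V\<^esub>a\<in>A. (if b = a then r else 0) \<star> a) = (\<Oplus>a\<in>A. if b = a then r \<star> a else \<zero>)"
      unfolding finsum_restrict by (rule M.finsum_cong') (use A V_zero in auto)
    also have "\<dots> = r \<star> b" by (rule M.add.finprod_singleton[OF b A(1)]) (use A in auto)
    finally show ?thesis unfolding H_def by (auto intro!: exI[of _ "\<lambda>a. if b = a then r else 0"])
  qed
  have Hact: "r \<odot> s \<in> H" if "r \<in> carrier alg" and s: "s \<in> S" for r s
  proof -
    have sc: "s \<in> carrier M" using S s by auto
    have "act (\<Sum>m\<in>J. scal (c m) * mon m) s \<in> H" for J and c :: "monomial \<Rightarrow> 'k"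
    proof (induction J rule: infinite_finite_induct)
      case (insert m J)
      have "c m \<star> act (mon m) s \<in> H" by (rule Hsm) (use s in \<open>auto simp: A_def\<close>)
      then show ?case using insert Hadd sc by (simp add: act_add act_scal)
    qed (use H0 sc in \<open>simp_all flip: proj_zero\<close>)
    then have "elt (coefficients r) \<odot> s \<in> H" unfolding elt_def poly_of_def .
    then show ?thesis using elt_coefficients[OF that(1)] by simp
  qed
  have "m \<in> H" if m: "m \<in> carrier M" for m
  proof -
    obtain c where c: "c \<in> S \<rightarrow> carrier alg" "m = (\<Oplus>s\<in>S. c s \<odot> s)" using gen[OF m] by auto
    have "(\<Oplus>s\<in>J. c s \<odot> s) \<in> H" if "J \<subseteq> S" for J
      using finite_subset[OF that S(1)] that
    proof (induction J rule: finite_induct)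
      case empty
      then show ?case using H0 by simp
    next
      case (insert s J)
      have "(\<Oplus>s\<in>insert s J. c s \<odot> s) = c s \<odot> s \<oplus> (\<Oplus>s\<in>J. c s \<odot> s)"
        by (rule M.finsum_insert) (use insert c(1) S in auto)
      moreover have "c s \<odot> s \<in> H" "(\<Oplus>s\<in>J. c s \<odot> s) \<in> H"
        using insert c(1) by (auto intro: Hact)
      ultimately show ?case by (simp only: Hadd)
    qed
    from this[OF order_refl] show ?thesis using c(2) by simp
  qed
  then show ?thesis using A by (intro exI[of _ A]) (auto simp: spans_def H_def)
qed

end

lemma spans_of_has_dimension:
  assumes "has_dimension V n"
  shows "\<exists>A. spans V A"
proof -
  obtain B where "finite B" "B \<subseteq> carrier V" and B: "\<forall>v\<in>carrier V. \<exists>!c. c \<in> B \<rightarrow>\<^sub>E UNIV \<and> v = (\<Oplus>\<^bsub>V\<^esub>b\<in>B. c b \<odot>\<^bsub>V\<^esub> b)"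
    using assms unfolding has_dimension_def by blast
  then have "spans V B" unfolding spans_def by (auto dest: ex1_implies_ex)
  then show ?thesis by blast
qed

theorem (in qext) ext1_vanishes_imp_projective:
  assumes M: "left_module alg M" and fin: "spans (restrict_to_field alg M) A" and ext: "ext1_vanishes alg M M"
  shows "projective alg M"
proof -
  interpret qext_module q M using M by (intro qext_module.intro qext_axioms)
  obtain n e cd where "based_space V n e cd"
    using based_space_of_spanning[OF V.left_module_axioms fin] by blast
  then show ?thesis using projective_if_ext1_vanishes ext by blast
qed

theorem corollary4p4:
  fixes q :: "'k::field"
  assumes "q \<noteq> 0"
  shows "k_algebra (qext_algebra q) \<and>
    has_dimension (qext_algebra q) 8 \<and>
    is_local_ring (qext_algebra q) \<and>
    symmetric_algebra (qext_algebra q) \<and>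
    (\<forall>M :: ((xyz, 'k) free_alg set, 'm) module.
      finite_dimensional_module (qext_algebra q) M \<longrightarrow>
      trivial_group (Ext (qext_algebra q) 1 M M) \<longrightarrow>
      trivial_group (Ext (qext_algebra q) 2 M M) \<longrightarrow>
      projective (qext_algebra q) M) \<and>
    satisfies_ARC TYPE('m) (qext_algebra q) \<and>
    satisfies_TC2 TYPE('m) (qext_algebra q)"
proof -
  interpret qext q using assms by (rule qext.intro)
  have fg: "\<exists>A. spans (restrict_to_field alg M) A" if "left_module alg M" "finitely_generated alg M"
    for M :: "((xyz, 'k) free_alg set, 'm) module"
  proof -
    interpret qext_module q M using that(1) by (intro qext_module.intro qext_axioms)
    show ?thesis by (rule spans_restrict_of_finitely_generated[OF that(2)])
  qed
  have "projective alg M" if "finite_dimensional_module alg M" "trivial_group (Ext alg 1 M M)"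
    for M :: "((xyz, 'k) free_alg set, 'm) module"
    using that ext1_vanishes_imp_projective spans_of_has_dimension ext1_vanishes_if_trivial
    unfolding finite_dimensional_module_def by metis
  moreover have "satisfies_ARC TYPE('m) alg"
    unfolding satisfies_ARC_def
  proof (intro allI impI)
    fix M :: "((xyz, 'k) free_alg set, 'm) module"
    assume M: "left_module alg M" and fin: "finitely_generated alg M"
      and ext: "\<forall>i>0. trivial_group (Ext alg i M (module_sum M (regular_module alg)))"
    have reg: "left_module alg (regular_module alg)" by (rule left_module_regular) (rule ring_alg)
    have "ext1_vanishes alg M (module_sum M (regular_module alg))"
      by (rule ext1_vanishes_if_trivial[OF M left_module_sum[OF M reg]]) (use ext in simp)
    then have "ext1_vanishes alg M M" by (rule ext1_vanishes_summand[OF reg])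
    then show "projective alg M" using fg[OF M fin] ext1_vanishes_imp_projective[OF M] by blast
  qed
  moreover have "satisfies_TC2 TYPE('m) alg"
    unfolding satisfies_TC2_def
  proof (intro allI impI)
    fix M :: "((xyz, 'k) free_alg set, 'm) module"
    assume M: "left_module alg M" and fin: "finitely_generated alg M"
      and ext: "\<forall>i>0. trivial_group (Ext alg i M M)"
    have "ext1_vanishes alg M M"
      by (rule ext1_vanishes_if_trivial[OF M M]) (use ext in simp)
    then show "projective alg M" using fg[OF M fin] ext1_vanishes_imp_projective[OF M] by blast
  qed
  ultimately show ?thesis
    using k_algebra_alg alg_dimension alg_local alg_symmetric unfolding alg_eq by blast
qed

end
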